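(* Let $G$ be a connected compact semisimple Lie group and $H\subset G$ a compact subgroup such that $G/H$ is almost effective. Suppose that the standard metric $(\cdot,\cdot)$ on $G/H$ is Einstein and that its Casimir constant $c$ satisfies $c>3/10$. Then $(\cdot,\cdot)$ is a point of local minimum of the scalar curvature functional $S$ on the set $\mathcal{M}_1$.
   Context: $\mathfrak{h}\subset\mathfrak{g}$ are the Lie algebras of $H$ and $G$; almost effective means that $\mathfrak{h}$ contains no nontrivial ideal of $\mathfrak{g}$. $B$ is the Killing form of $\mathfrak{g}$ (so $-B$ is positive definite), and $\mathfrak{p}$ is the $(-B)$-orthogonal complement of $\mathfrak{h}$ in $\mathfrak{g}$, identified with the tangent space of $G/H$ at $eH$. $G$-invariant Riemannian metrics on $G/H$ are identified with $\operatorname{Ad}(H)$-invariant inner products on $\mathfrak{p}$. The standard (Killing) metric is the one given by $(\cdot,\cdot)=-B(\cdot,\cdot)|_{\mathfrak{p}}$. $\mathcal{M}_1$ is the set of $\operatorname{Ad}(H)$-invariant inner products on $\mathfrak{p}$ with the same volume as the standard metric (i.e. with determinant $1$ relative to $-B|_{\mathfrak{p}}$), with its natural topology. $S$ assigns to each invariant metric its (constant) scalar curvature. It is known that the critical points of $S$ on $\mathcal{M}_1$ are exactly the Einstein metrics in $\mathcal{M}_1$. Casimir constant: if the standard metric is Einstein with $\operatorname{Ric}=r\,(\cdot,\cdot)$, its Casimir constant is the number $c$ related to $r$ by $c=\frac{4r-1}{2}$ (it is known that $\frac14\le r\le\frac12$ and $0\le c\le\frac12$). *)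

theory Defs
  imports "HOL-Analysis.Analysis" "HOL-Algebra.Coset"
begin

section \<open>Lie groups\<close>

text \<open>On an open set, \<open>C\<^sup>k\<close> for maps between Euclidean spaces. In finite dimension, testing the
  differential on each fixed vector amounts to testing it as an operator-valued map.\<close>

primrec Ck_on :: "nat \<Rightarrow> 'a::euclidean_space set \<Rightarrow> ('a \<Rightarrow> 'b::euclidean_space) \<Rightarrow> bool" where
  "Ck_on 0 S f = continuous_on S f"
| "Ck_on (Suc k) S f =
     ((\<forall>x\<in>S. f differentiable (at x)) \<and> (\<forall>v. Ck_on k S (\<lambda>x. frechet_derivative f (at x) v)))"

definition smooth_on :: "'a::euclidean_space set \<Rightarrow> ('a \<Rightarrow> 'b::euclidean_space) \<Rightarrow> bool" where
  "smooth_on S f \<longleftrightarrow> open S \<and> (\<forall>k. Ck_on k S f)"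

text \<open>A chart is a pair of a domain and a coordinate map; the values of the coordinate map
  outside the domain are irrelevant.\<close>

type_synonym ('g, 'a) chart = "'g set \<times> ('g \<Rightarrow> 'a)"

definition chart_inv :: "('g, 'a) chart \<Rightarrow> 'a \<Rightarrow> 'g" where
  "chart_inv \<kappa> = the_inv_into (fst \<kappa>) (snd \<kappa>)"

definition is_chart :: "'g topology \<Rightarrow> ('g, 'a::euclidean_space) chart \<Rightarrow> bool" where
  "is_chart T \<kappa> \<longleftrightarrow> openin T (fst \<kappa>) \<and> open (snd \<kappa> ` fst \<kappa>) \<and>
     homeomorphic_map (subtopology T (fst \<kappa>)) (top_of_set (snd \<kappa> ` fst \<kappa>)) (snd \<kappa>)"

locale lie_group = group G
  for G :: "('g, 'm) monoid_scheme" (structure) +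
  fixes T :: "'g topology" and A :: "('g, 'a::euclidean_space) chart set"
  assumes topspace_eq: "topspace T = carrier G"
    and Hausdorff: "Hausdorff_space T"
    and second_countable: "second_countable T"
    and charts: "\<kappa> \<in> A \<Longrightarrow> is_chart T \<kappa>"
    and charts_cover: "(\<Union>\<kappa>\<in>A. fst \<kappa>) = carrier G"
    and charts_compatible: "\<lbrakk>\<kappa> \<in> A; \<eta> \<in> A\<rbrakk> \<Longrightarrow>
      smooth_on (snd \<kappa> ` (fst \<kappa> \<inter> fst \<eta>)) (\<lambda>x. snd \<eta> (chart_inv \<kappa> x))"
    and continuous_mult: "continuous_map (prod_topology T T) T (\<lambda>(a, b). a \<otimes> b)"
    and continuous_inv: "continuous_map T T (\<lambda>a. inv a)"
    and smooth_mult: "\<lbrakk>\<kappa> \<in> A; \<eta> \<in> A; \<mu> \<in> A\<rbrakk> \<Longrightarrow>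
      smooth_on {(x, y). x \<in> snd \<kappa> ` fst \<kappa> \<and> y \<in> snd \<eta> ` fst \<eta> \<and>
                         chart_inv \<kappa> x \<otimes> chart_inv \<eta> y \<in> fst \<mu>}
        (\<lambda>(x, y). snd \<mu> (chart_inv \<kappa> x \<otimes> chart_inv \<eta> y))"
    and smooth_inv: "\<lbrakk>\<kappa> \<in> A; \<mu> \<in> A\<rbrakk> \<Longrightarrow>
      smooth_on {x. x \<in> snd \<kappa> ` fst \<kappa> \<and> inv (chart_inv \<kappa> x) \<in> fst \<mu>}
        (\<lambda>x. snd \<mu> (inv (chart_inv \<kappa> x)))"


section \<open>The Lie algebra of a Lie group\<close>

text \<open>From here on \<open>\<kappa>\<close> is a chart around the identity. It identifies the tangent space of \<open>G\<close>
  at the identity with the model space \<open>'a\<close>.\<close>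

definition origin :: "('g, 'm) monoid_scheme \<Rightarrow> ('g, 'a) chart \<Rightarrow> 'a" where
  "origin G \<kappa> = snd \<kappa> \<one>\<^bsub>G\<^esub>"

text \<open>The left-invariant vector field with value \<open>v\<close> at the identity, in the chart \<open>\<kappa>\<close>: at the
  point \<open>a\<close> with coordinates \<open>x\<close> it is the image of \<open>v\<close> under the differential of left
  translation by \<open>a\<close>.\<close>

definition left_inv_field ::
    "('g, 'm) monoid_scheme \<Rightarrow> ('g, 'a::euclidean_space) chart \<Rightarrow> 'a \<Rightarrow> 'a \<Rightarrow> 'a" where
  "left_inv_field G \<kappa> v x =
     frechet_derivative (\<lambda>y. snd \<kappa> (chart_inv \<kappa> x \<otimes>\<^bsub>G\<^esub> chart_inv \<kappa> y)) (at (origin G \<kappa>)) v"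

text \<open>The commutator of vector fields is \<open>[X, Y] = DY X - DX Y\<close>; for left-invariant fields it is
  evaluated at the identity.\<close>

definition lie_bracket ::
    "('g, 'm) monoid_scheme \<Rightarrow> ('g, 'a::euclidean_space) chart \<Rightarrow> 'a \<Rightarrow> 'a \<Rightarrow> 'a" where
  "lie_bracket G \<kappa> u v =
     frechet_derivative (left_inv_field G \<kappa> v) (at (origin G \<kappa>)) u -
     frechet_derivative (left_inv_field G \<kappa> u) (at (origin G \<kappa>)) v"

definition Ad ::
    "('g, 'm) monoid_scheme \<Rightarrow> ('g, 'a::euclidean_space) chart \<Rightarrow> 'g \<Rightarrow> 'a \<Rightarrow> 'a" where
  "Ad G \<kappa> a v =
     frechet_derivative (\<lambda>y. snd \<kappa> (a \<otimes>\<^bsub>G\<^esub> chart_inv \<kappa> y \<otimes>\<^bsub>G\<^esub> inv\<^bsub>G\<^esub> a)) (at (origin G \<kappa>)) v"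

text \<open>The tangent space at the identity of a closed subgroup \<open>H\<close>: the velocities of the curves in
  \<open>H\<close> through the identity. Only the germ of a curve matters, so it may be assumed to stay in the
  chart domain; the coordinate map being a homeomorphism, differentiability of the coordinates at
  \<open>0\<close> is differentiability of the curve there.\<close>

definition lie_subalgebra_of ::
    "('g, 'm) monoid_scheme \<Rightarrow> ('g, 'a::euclidean_space) chart \<Rightarrow> 'g set \<Rightarrow> 'a set" where
  "lie_subalgebra_of G \<kappa> H = {v. \<exists>\<gamma>::real \<Rightarrow> 'g. (\<forall>t. \<gamma> t \<in> H \<inter> fst \<kappa>) \<and> \<gamma> 0 = \<one>\<^bsub>G\<^esub> \<and>
     ((\<lambda>t. snd \<kappa> (\<gamma> t)) has_vector_derivative v) (at 0)}"

definition linear_trace :: "('a::euclidean_space \<Rightarrow> 'a) \<Rightarrow> real" where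
  "linear_trace L = (\<Sum>b\<in>Basis. L b \<bullet> b)"

definition killing_form ::
    "('g, 'm) monoid_scheme \<Rightarrow> ('g, 'a::euclidean_space) chart \<Rightarrow> 'a \<Rightarrow> 'a \<Rightarrow> real" where
  "killing_form G \<kappa> u v = linear_trace (\<lambda>w. lie_bracket G \<kappa> u (lie_bracket G \<kappa> v w))"

definition lie_ideal ::
    "('g, 'm) monoid_scheme \<Rightarrow> ('g, 'a::euclidean_space) chart \<Rightarrow> 'a set \<Rightarrow> bool" where
  "lie_ideal G \<kappa> I \<longleftrightarrow> subspace I \<and> (\<forall>x. \<forall>y\<in>I. lie_bracket G \<kappa> x y \<in> I)"

definition derived_algebra ::
    "('g, 'm) monoid_scheme \<Rightarrow> ('g, 'a::euclidean_space) chart \<Rightarrow> 'a set \<Rightarrow> 'a set" where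
  "derived_algebra G \<kappa> J = span {lie_bracket G \<kappa> x y | x y. x \<in> J \<and> y \<in> J}"

definition lie_solvable ::
    "('g, 'm) monoid_scheme \<Rightarrow> ('g, 'a::euclidean_space) chart \<Rightarrow> 'a set \<Rightarrow> bool" where
  "lie_solvable G \<kappa> J \<longleftrightarrow> (\<exists>n. (derived_algebra G \<kappa> ^^ n) J = {0})"

definition semisimple ::
    "('g, 'm) monoid_scheme \<Rightarrow> ('g, 'a::euclidean_space) chart \<Rightarrow> bool" where
  "semisimple G \<kappa> \<longleftrightarrow> (\<forall>I. lie_ideal G \<kappa> I \<and> lie_solvable G \<kappa> I \<longrightarrow> I = {0})"

definition almost_effective ::
    "('g, 'm) monoid_scheme \<Rightarrow> ('g, 'a::euclidean_space) chart \<Rightarrow> 'g set \<Rightarrow> bool" where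
  "almost_effective G \<kappa> H \<longleftrightarrow>
     (\<forall>I. lie_ideal G \<kappa> I \<and> I \<subseteq> lie_subalgebra_of G \<kappa> H \<longrightarrow> I = {0})"

definition isotropy_complement ::
    "('g, 'm) monoid_scheme \<Rightarrow> ('g, 'a::euclidean_space) chart \<Rightarrow> 'g set \<Rightarrow> 'a set" where
  "isotropy_complement G \<kappa> H = {x. \<forall>y\<in>lie_subalgebra_of G \<kappa> H. killing_form G \<kappa> x y = 0}"

text \<open>The projection onto the complement along the isotropy algebra.\<close>

definition isotropy_proj ::
    "('g, 'm) monoid_scheme \<Rightarrow> ('g, 'a::euclidean_space) chart \<Rightarrow> 'g set \<Rightarrow> 'a \<Rightarrow> 'a" where
  "isotropy_proj G \<kappa> H x =
     (THE y. y \<in> isotropy_complement G \<kappa> H \<and> x - y \<in> lie_subalgebra_of G \<kappa> H)"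


section \<open>Riemannian curvature in coordinates\<close>

text \<open>A Riemannian metric near a point of a coordinate space \<open>P\<close> (a linear subspace of a Euclidean
  space) is a map \<open>m\<close> sending a point \<open>x \<in> P\<close> to an inner product \<open>m x\<close> on \<open>P\<close>.\<close>

definition inner_product_on :: "'a::real_vector set \<Rightarrow> ('a \<Rightarrow> 'a \<Rightarrow> real) \<Rightarrow> bool" where
  "inner_product_on P g \<longleftrightarrow>
     (\<forall>x\<in>P. \<forall>y\<in>P. g x y = g y x) \<and>
     (\<forall>x\<in>P. \<forall>y\<in>P. \<forall>z\<in>P. g (x + y) z = g x z + g y z) \<and>
     (\<forall>x\<in>P. \<forall>y\<in>P. \<forall>c. g (c *\<^sub>R x) y = c * g x y) \<and>
     (\<forall>x\<in>P. x \<noteq> 0 \<longrightarrow> 0 < g x x)"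

definition orthonormal_basis_on :: "'a::real_vector set \<Rightarrow> ('a \<Rightarrow> 'a \<Rightarrow> real) \<Rightarrow> 'a set \<Rightarrow> bool" where
  "orthonormal_basis_on P g E \<longleftrightarrow>
     E \<subseteq> P \<and> span E = P \<and> (\<forall>x\<in>E. \<forall>y\<in>E. g x y = (if x = y then 1 else 0))"

definition dir_deriv :: "('a::euclidean_space \<Rightarrow> 'b::real_normed_vector) \<Rightarrow> 'a \<Rightarrow> 'a \<Rightarrow> 'b" where
  "dir_deriv f x u = vector_derivative (\<lambda>t::real. f (x + t *\<^sub>R u)) (at 0)"

text \<open>The Christoffel map of the Levi-Civita connection: for constant fields \<open>u\<close>, \<open>v\<close>, \<open>w\<close> on \<open>P\<close>
  the Koszul formula reads \<open>2 m (\<nabla>\<^sub>u v, w) = \<partial>\<^sub>u m (v, w) + \<partial>\<^sub>v m (u, w) - \<partial>\<^sub>w m (u, v)\<close>.\<close>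

definition christoffel ::
    "'a::euclidean_space set \<Rightarrow> ('a \<Rightarrow> 'a \<Rightarrow> 'a \<Rightarrow> real) \<Rightarrow> 'a \<Rightarrow> 'a \<Rightarrow> 'a \<Rightarrow> 'a" where
  "christoffel P m x u v = (THE z. z \<in> P \<and> (\<forall>w\<in>P. 2 * m x z w =
     dir_deriv (\<lambda>y. m y v w) x u + dir_deriv (\<lambda>y. m y u w) x v - dir_deriv (\<lambda>y. m y u v) x w))"

text \<open>\<open>R(u, v) w = \<nabla>\<^sub>u \<nabla>\<^sub>v w - \<nabla>\<^sub>v \<nabla>\<^sub>u w\<close> for constant fields.\<close>

definition riemann_curvature ::
    "'a::euclidean_space set \<Rightarrow> ('a \<Rightarrow> 'a \<Rightarrow> 'a \<Rightarrow> real) \<Rightarrow> 'a \<Rightarrow> 'a \<Rightarrow> 'a \<Rightarrow> 'a \<Rightarrow> 'a" where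
  "riemann_curvature P m x u v w =
     dir_deriv (\<lambda>y. christoffel P m y v w) x u - dir_deriv (\<lambda>y. christoffel P m y u w) x v +
     christoffel P m x u (christoffel P m x v w) - christoffel P m x v (christoffel P m x u w)"

text \<open>The sums below do not depend on the choice of the orthonormal basis: \<open>Ric(v, w)\<close> is the
  trace of \<open>u \<mapsto> R(u, v) w\<close>, and the scalar curvature is the trace of \<open>Ric\<close> with respect to
  the metric.\<close>

definition ricci_curvature ::
    "'a::euclidean_space set \<Rightarrow> ('a \<Rightarrow> 'a \<Rightarrow> 'a \<Rightarrow> real) \<Rightarrow> 'a \<Rightarrow> 'a \<Rightarrow> 'a \<Rightarrow> real" where
  "ricci_curvature P m x v w =
     (\<Sum>e\<in>(SOME E. orthonormal_basis_on P (m x) E). m x (riemann_curvature P m x e v w) e)"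

definition scalar_curvature ::
    "'a::euclidean_space set \<Rightarrow> ('a \<Rightarrow> 'a \<Rightarrow> 'a \<Rightarrow> real) \<Rightarrow> 'a \<Rightarrow> real" where
  "scalar_curvature P m x =
     (\<Sum>e\<in>(SOME E. orthonormal_basis_on P (m x) E). ricci_curvature P m x e e)"


section \<open>Invariant metrics on a homogeneous space\<close>

text \<open>An inner product on the complement \<open>\<pp>\<close> is extended to the whole Lie algebra through the
  projection, i.e. with the isotropy algebra as its kernel. So an element of the following set is
  determined by its restriction to \<open>\<pp>\<close>.\<close>

definition invariant_inner_products ::
    "('g, 'm) monoid_scheme \<Rightarrow> ('g, 'a::euclidean_space) chart \<Rightarrow> 'g set \<Rightarrow> ('a \<Rightarrow> 'a \<Rightarrow> real) set" where
  "invariant_inner_products G \<kappa> H = {g.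
     inner_product_on (isotropy_complement G \<kappa> H) g \<and>
     (\<forall>x y. g x y = g (isotropy_proj G \<kappa> H x) (isotropy_proj G \<kappa> H y)) \<and>
     (\<forall>a\<in>H. \<forall>x\<in>isotropy_complement G \<kappa> H. \<forall>y\<in>isotropy_complement G \<kappa> H.
        g (Ad G \<kappa> a x) (Ad G \<kappa> a y) = g x y)}"

definition standard_metric ::
    "('g, 'm) monoid_scheme \<Rightarrow> ('g, 'a::euclidean_space) chart \<Rightarrow> 'g set \<Rightarrow> 'a \<Rightarrow> 'a \<Rightarrow> real" where
  "standard_metric G \<kappa> H x y =
     - killing_form G \<kappa> (isotropy_proj G \<kappa> H x) (isotropy_proj G \<kappa> H y)"

text \<open>The Leibniz formula for the determinant of the Gram matrix of a finite family \<open>E\<close>.\<close>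

definition gram_det :: "('a \<Rightarrow> 'a \<Rightarrow> real) \<Rightarrow> 'a set \<Rightarrow> real" where
  "gram_det g E = (\<Sum>\<sigma> | \<sigma> permutes E. of_int (sign \<sigma>) * (\<Prod>e\<in>E. g e (\<sigma> e)))"

text \<open>The determinant of \<open>g\<close> relative to \<open>g'\<close> is the quotient of their Gram determinants in a
  common basis, and the square of the quotient of the volume elements.\<close>

definition same_volume_on ::
    "'a::real_vector set \<Rightarrow> ('a \<Rightarrow> 'a \<Rightarrow> real) \<Rightarrow> ('a \<Rightarrow> 'a \<Rightarrow> real) \<Rightarrow> bool" where
  "same_volume_on P g g' \<longleftrightarrow>
     (\<forall>E. E \<subseteq> P \<and> independent E \<and> span E = P \<longrightarrow> gram_det g E = gram_det g' E)"

definition unit_volume_metrics ::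
    "('g, 'm) monoid_scheme \<Rightarrow> ('g, 'a::euclidean_space) chart \<Rightarrow> 'g set \<Rightarrow> ('a \<Rightarrow> 'a \<Rightarrow> real) set" where
  "unit_volume_metrics G \<kappa> H = {g \<in> invariant_inner_products G \<kappa> H.
     same_volume_on (isotropy_complement G \<kappa> H) g (standard_metric G \<kappa> H)}"

text \<open>Put \<open>s(x) = \<kappa>\<^sup>-\<^sup>1(origin + x)\<close>. Near \<open>0\<close> the map \<open>x \<mapsto> s(x)H\<close> from \<open>\<pp>\<close> to \<open>G/H\<close> is the
  inverse of a chart of \<open>G/H\<close> around \<open>eH\<close>. \<open>maurer_cartan x u\<close> is the tangent vector \<open>ds\<^sub>x(u)\<close>
  translated back to the identity by \<open>s(x)\<^sup>-\<^sup>1\<close>, and its class modulo the isotropy algebra is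
  the tangent vector of \<open>G/H\<close> translated back to \<open>eH\<close>. Hence \<open>coset_metric\<close> is the coordinate
  expression on \<open>\<pp>\<close> of the \<open>G\<close>-invariant Riemannian metric on \<open>G/H\<close> given at \<open>eH\<close> by \<open>g\<close>.\<close>

definition maurer_cartan ::
    "('g, 'm) monoid_scheme \<Rightarrow> ('g, 'a::euclidean_space) chart \<Rightarrow> 'a \<Rightarrow> 'a \<Rightarrow> 'a" where
  "maurer_cartan G \<kappa> x u = frechet_derivative
     (\<lambda>y. snd \<kappa> (inv\<^bsub>G\<^esub> (chart_inv \<kappa> (origin G \<kappa> + x)) \<otimes>\<^bsub>G\<^esub> chart_inv \<kappa> (origin G \<kappa> + y))) (at x) u"

definition coset_metric ::
    "('g, 'm) monoid_scheme \<Rightarrow> ('g, 'a::euclidean_space) chart \<Rightarrow> ('a \<Rightarrow> 'a \<Rightarrow> real) \<Rightarrow>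
     'a \<Rightarrow> 'a \<Rightarrow> 'a \<Rightarrow> real" where
  "coset_metric G \<kappa> g x u v = g (maurer_cartan G \<kappa> x u) (maurer_cartan G \<kappa> x v)"

text \<open>Ricci and scalar curvature at \<open>eH\<close>; by homogeneity the latter is the constant value of the
  scalar curvature, and the former determines the Ricci tensor everywhere.\<close>

definition Ric ::
    "('g, 'm) monoid_scheme \<Rightarrow> ('g, 'a::euclidean_space) chart \<Rightarrow> 'g set \<Rightarrow> ('a \<Rightarrow> 'a \<Rightarrow> real) \<Rightarrow>
     'a \<Rightarrow> 'a \<Rightarrow> real" where
  "Ric G \<kappa> H g = ricci_curvature (isotropy_complement G \<kappa> H) (coset_metric G \<kappa> g) 0"

definition scal ::
    "('g, 'm) monoid_scheme \<Rightarrow> ('g, 'a::euclidean_space) chart \<Rightarrow> 'g set \<Rightarrow> ('a \<Rightarrow> 'a \<Rightarrow> real) \<Rightarrow>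
     real" where
  "scal G \<kappa> H g = scalar_curvature (isotropy_complement G \<kappa> H) (coset_metric G \<kappa> g) 0"

definition einstein_constant ::
    "('g, 'm) monoid_scheme \<Rightarrow> ('g, 'a::euclidean_space) chart \<Rightarrow> 'g set \<Rightarrow> ('a \<Rightarrow> 'a \<Rightarrow> real) \<Rightarrow>
     real \<Rightarrow> bool" where
  "einstein_constant G \<kappa> H g r \<longleftrightarrow>
     (\<forall>x\<in>isotropy_complement G \<kappa> H. \<forall>y\<in>isotropy_complement G \<kappa> H. Ric G \<kappa> H g x y = r * g x y)"

text \<open>Inner products carry the topology of pointwise convergence of functions of two vectors. On
  bilinear forms on a finite-dimensional space it is the usual vector space topology.\<close>

definition local_min_on :: "'b::topological_space set \<Rightarrow> ('b \<Rightarrow> real) \<Rightarrow> 'b \<Rightarrow> bool" where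
  "local_min_on M f x \<longleftrightarrow> x \<in> M \<and> (\<forall>\<^sub>F y in at x within M. f x \<le> f y)"

end

theory Submission
  imports Defs
begin

text \<open>Let \<open>std\<close> be the standard metric and \<open>y\<close> an invariant metric of the same volume. In an
  orthonormal basis of the isotropy complement for \<open>std\<close> that diagonalises \<open>y\<close>, write the
  eigenvalues of \<open>y\<close> as \<open>exp (a e)\<close>; equality of volumes means \<open>\<Sum> a e = 0\<close>. With the structure
  constants \<open>C e f k = std [e, f] k\<close>, the scalar curvature of \<open>y\<close> is
  \<open>1/2 \<Sum> exp (- a e) - 1/4 \<Sum> (C e f k)\<^sup>2 exp (a k - a e - a f)\<close> (lemma \<open>scal_diagonal\<close>). Since \<open>std\<close>
  comes from the Killing form, \<open>(C e f k)\<^sup>2\<close> is symmetric in its three indices. If \<open>std\<close> is Einstein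
  with constant \<open>r\<close>, comparing the Ricci form with the Killing form shows that for every \<open>e\<close> the sum of
  \<open>(C e f k)\<^sup>2\<close> over \<open>f\<close> and \<open>k\<close> is \<open>L = 2 - 4 r = 1 - 2 c\<close> (\<open>einstein_structure_constants\<close>).
  Hence the part of the scalar curvature that is linear in \<open>a\<close> vanishes, and the quadratic part is
  \<open>(1/4 - 3/8 L) \<Sum> (a e)\<^sup>2 + 1/4 \<Sum> (C e f k)\<^sup>2 a e a f \<ge> (1/4 - 5/8 L) \<Sum> (a e)\<^sup>2\<close>,
  because \<open>2 \<bar>a e a f\<bar> \<le> (a e)\<^sup>2 + (a f)\<^sup>2\<close>. The last coefficient is positive for \<open>L < 2/5\<close>, that
  is, for \<open>c > 3/10\<close>; quadratic bounds for \<open>exp\<close> near \<open>0\<close> turn this into an inequality on a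
  neighbourhood of \<open>std\<close> (\<open>weighted_exponential_inequality\<close>).

  The rest derives the formula for the scalar curvature from the coordinate definitions. The bracket
  is the skew part of the second derivative of the multiplication at the identity. Second derivatives
  of group identities show that \<open>Ad\<close> respects it (\<open>Ad_bracket\<close>), that the derivative of \<open>Ad\<close> at the
  identity is \<open>ad\<close> (\<open>D_Ad_pt\<close>), and that the Maurer-Cartan form satisfies its structure equation
  (\<open>structure_equation\<close>). On a compact group \<open>Ad\<close> is bounded, and a bounded group of linear maps
  preserves an inner product (\<open>bounded_group_invariant_inner_product\<close>); each \<open>ad x\<close> is skew for it,
  so the Killing form is negative, and definite because the centre is a solvable ideal
  (\<open>kf_negative\<close>). This splits the Lie algebra into the isotropy algebra \<open>hh\<close> and its complement
  \<open>pp\<close>. Read in the frame given by the Maurer-Cartan form, the Koszul formula becomes algebraic, and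
  the curvature at the base point is given by Nomizu's formula (\<open>riemann_curvature_0\<close>), whose traces
  are \<open>scal_formula\<close> and the Ricci form used in \<open>einstein_structure_constants\<close>.\<close>


section \<open>Smooth maps\<close>

abbreviation D :: "('a::euclidean_space \<Rightarrow> 'b::euclidean_space) \<Rightarrow> 'a \<Rightarrow> 'a \<Rightarrow> 'b"
  where "D f x v \<equiv> frechet_derivative f (at x) v"

definition D2 :: "('a::euclidean_space \<Rightarrow> 'b::euclidean_space) \<Rightarrow> 'a \<Rightarrow> 'a \<Rightarrow> 'a \<Rightarrow> 'b"
  where "D2 f x a b = D (\<lambda>y. D f y a) x b"

lemma D_eqI: "(f has_derivative f') (at x) \<Longrightarrow> D f x = f'"
  using frechet_derivative_at by metis

lemma has_derivative_D: "f differentiable (at x) \<Longrightarrow> (f has_derivative D f x) (at x)"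
  by (simp add: frechet_derivative_works[symmetric])

text \<open>The functions \<open>f\<close> and \<open>g\<close> have the same derivatives at \<open>x\<close>, if any, so
  \<open>frechet_derivative\<close> chooses the same one.\<close>

lemma D_cong:
  assumes "open S" "x \<in> S" "\<And>y. y \<in> S \<Longrightarrow> f y = g y"
  shows "D f x = D g x"
proof (cases "f differentiable (at x)")
  case True
  have "(g has_derivative D f x) (at x)"
    by (rule has_derivative_transform_within_open[OF has_derivative_D[OF True] assms(1,2)]) (simp add: assms(3))
  then show ?thesis using D_eqI by metis
next
  case False
  have "\<not> g differentiable (at x)"
  proof
    assume "g differentiable (at x)"
    then have "(f has_derivative D g x) (at x)"
      using has_derivative_transform_within_open[OF has_derivative_D assms(1,2), of g f] assms(3) by auto
    with False show False by (auto simp: differentiable_def)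
  qed
  with False have "(f has_derivative f') (at x) = (g has_derivative f') (at x)" for f'
    by (auto simp: differentiable_def)
  then show ?thesis by (simp add: frechet_derivative_def)
qed

lemma differentiable_cong:
  fixes f g :: "'a::euclidean_space \<Rightarrow> 'b::euclidean_space"
  assumes "open S" "x \<in> S" "\<And>y. y \<in> S \<Longrightarrow> f y = g y" "f differentiable (at x)"
  shows "g differentiable (at x)"
  using has_derivative_transform_within_open[OF has_derivative_D[OF assms(4)] assms(1,2,3)]
  by (auto simp: differentiable_def)

lemma Ck_on_SucD: "Ck_on (Suc k) S f \<Longrightarrow> Ck_on k S f"
proof (induction k arbitrary: f)
  case 0
  then show ?case
    by (simp add: continuous_at_imp_continuous_on differentiable_imp_continuous_within)
next
  case (Suc k)
  show ?case
    using Suc.prems Suc.IH unfolding Ck_on.simps(2)[of "Suc k"] Ck_on.simps(2)[of k S f] by blast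
qed

lemma Ck_on_cong:
  assumes "open S" "\<And>x. x \<in> S \<Longrightarrow> f x = g x" "Ck_on k S f"
  shows "Ck_on k S g"
  using assms(2,3)
proof (induction k arbitrary: f g)
  case 0
  then show ?case by (simp cong: continuous_on_cong)
next
  case (Suc k)
  have "g differentiable (at x)" if "x \<in> S" for x
    using differentiable_cong[OF assms(1) that] Suc.prems that by auto
  moreover have "Ck_on k S (\<lambda>x. D g x v)" for v
    by (rule Suc.IH[of "\<lambda>x. D f x v"]) (use Suc.prems D_cong[OF assms(1), of _ f g] in auto)
  ultimately show ?case by simp
qed

lemma Ck_on_subset:
  "Ck_on k S f \<Longrightarrow> S' \<subseteq> S \<Longrightarrow> Ck_on k S' f"
  by (induction k arbitrary: f) (auto intro: continuous_on_subset)

lemma Ck_on_const: "Ck_on k S (\<lambda>x. c)"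
  by (induction k arbitrary: c) auto

lemma Ck_on_add:
  assumes "open S" "Ck_on k S f" "Ck_on k S g"
  shows "Ck_on k S (\<lambda>x. f x + g x)"
  using assms(2,3)
proof (induction k arbitrary: f g)
  case 0
  then show ?case by (auto intro: continuous_intros)
next
  case (Suc k)
  have d: "((\<lambda>x. f x + g x) has_derivative (\<lambda>v. D f x v + D g x v)) (at x)" if "x \<in> S" for x
    using Suc.prems that by (auto intro!: has_derivative_add has_derivative_D)
  have "Ck_on k S (\<lambda>x. D (\<lambda>x. f x + g x) x v)" for v
    by (rule Ck_on_cong[OF assms(1) _ Suc.IH[of "\<lambda>x. D f x v" "\<lambda>x. D g x v"]])
      (use Suc.prems D_eqI[OF d] in auto)
  then show ?case using d by (auto simp: differentiable_def)
qed

lemma Ck_on_sum: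
  assumes "open S" "finite I" "\<And>i. i \<in> I \<Longrightarrow> Ck_on k S (f i)"
  shows "Ck_on k S (\<lambda>x. \<Sum>i\<in>I. f i x)"
  using assms(2,3) by (induction I) (auto intro: Ck_on_const Ck_on_add[OF assms(1)])

lemma Ck_on_scaleR:
  fixes f :: "'a::euclidean_space \<Rightarrow> real"
  assumes "open S" "Ck_on k S f" "Ck_on k S g"
  shows "Ck_on k S (\<lambda>x. f x *\<^sub>R g x)"
  using assms(2,3)
proof (induction k arbitrary: f g)
  case 0
  then show ?case by (auto intro: continuous_intros)
next
  case (Suc k)
  have d: "((\<lambda>x. f x *\<^sub>R g x) has_derivative (\<lambda>v. f x *\<^sub>R D g x v + D f x v *\<^sub>R g x)) (at x)" if "x \<in> S" for x
    using Suc.prems that by (auto intro!: has_derivative_scaleR has_derivative_D)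
  have "Ck_on k S (\<lambda>x. D (\<lambda>x. f x *\<^sub>R g x) x v)" for v
  proof (rule Ck_on_cong[OF assms(1)])
    show "Ck_on k S (\<lambda>x. f x *\<^sub>R D g x v + D f x v *\<^sub>R g x)"
      by (intro Ck_on_add[OF assms(1)] Suc.IH) (use Suc.prems Ck_on_SucD in \<open>auto simp del: Ck_on.simps(1)\<close>)
  qed (use D_eqI[OF d] in auto)
  then show ?case using d by (auto simp: differentiable_def)
qed

lemma Ck_on_linear_comp:
  assumes "open S" "bounded_linear L" "Ck_on k S f"
  shows "Ck_on k S (\<lambda>x. L (f x))"
  using assms(3)
proof (induction k arbitrary: f)
  case 0
  then show ?case using assms(2) by (auto intro: bounded_linear.continuous_on)
next
  case (Suc k)
  have d: "((\<lambda>x. L (f x)) has_derivative (\<lambda>v. L (D f x v))) (at x)" if "x \<in> S" for x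
    using Suc.prems that by (auto intro!: bounded_linear.has_derivative[OF assms(2)] has_derivative_D)
  have "Ck_on k S (\<lambda>x. D (\<lambda>x. L (f x)) x v)" for v
    by (rule Ck_on_cong[OF assms(1) _ Suc.IH[of "\<lambda>x. D f x v"]])
      (use Suc.prems D_eqI[OF d] in auto)
  then show ?case using d by (auto simp: differentiable_def)
qed

lemma Ck_on_ident: "Ck_on k S (\<lambda>x. x)"
  by (cases k) (auto intro: Ck_on_const)

lemma linear_expansion:
  assumes "linear f" shows "f v = (\<Sum>b\<in>Basis. (v \<bullet> b) *\<^sub>R f b)"
proof -
  have "f v = f (\<Sum>b\<in>Basis. (v \<bullet> b) *\<^sub>R b)" by (simp add: euclidean_representation)
  also have "\<dots> = (\<Sum>b\<in>Basis. (v \<bullet> b) *\<^sub>R f b)"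
    by (simp add: linear_sum[OF assms] linear_scale[OF assms])
  finally show ?thesis .
qed

text \<open>\<open>Ck_on\<close> tests derivatives on fixed vectors, whereas the chain rule applies \<open>D g (f x)\<close> to the
  moving vector \<open>D f x v\<close>. Expanding the latter in coordinates leaves sums of products of smooth
  functions with the compositions of \<open>\<lambda>y. D g y b\<close> and \<open>f\<close>, to which the induction applies.\<close>

lemma Ck_on_compose:
  fixes f :: "'a::euclidean_space \<Rightarrow> 'b::euclidean_space" and g :: "'b \<Rightarrow> 'c::euclidean_space"
  assumes "open S" "open S'" "f ` S \<subseteq> S'" "Ck_on k S f" "Ck_on k S' g"
  shows "Ck_on k S (\<lambda>x. g (f x))"
  using assms(4,5)
proof (induction k arbitrary: g)
  case 0
  then show ?case using assms(3) by (auto intro: continuous_on_compose2)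
next
  case (Suc k)
  have d: "((\<lambda>x. g (f x)) has_derivative (\<lambda>v. D g (f x) (D f x v))) (at x)" if "x \<in> S" for x
  proof -
    have "g differentiable (at (f x))" using Suc.prems(2) that assms(3) by auto
    moreover have "f differentiable (at x)" using Suc.prems(1) that by auto
    ultimately show ?thesis
      using diff_chain_at[OF has_derivative_D has_derivative_D] by (auto simp: o_def)
  qed
  have "Ck_on k S (\<lambda>x. D (\<lambda>x. g (f x)) x v)" for v
  proof (rule Ck_on_cong[OF assms(1)])
    show "Ck_on k S (\<lambda>x. \<Sum>b\<in>Basis. (D f x v \<bullet> b) *\<^sub>R D g (f x) b)"
    proof (intro Ck_on_sum Ck_on_scaleR assms(1) finite_Basis)
      fix b :: 'b
      show "Ck_on k S (\<lambda>x. D f x v \<bullet> b)"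
        by (rule Ck_on_linear_comp[OF assms(1) bounded_linear_inner_left]) (use Suc.prems in auto)
      show "Ck_on k S (\<lambda>x. D g (f x) b)"
        by (rule Suc.IH) (use Suc.prems Ck_on_SucD in \<open>auto simp del: Ck_on.simps(1)\<close>)
    qed
    fix x assume x: "x \<in> S"
    have "linear (D g (f x))"
      by (rule linear_frechet_derivative) (use Suc.prems(2) x assms(3) in auto)
    then show "(\<Sum>b\<in>Basis. (D f x v \<bullet> b) *\<^sub>R D g (f x) b) = D (\<lambda>x. g (f x)) x v"
      using linear_expansion D_eqI[OF d[OF x]] by metis
  qed
  then show ?case using d by (auto simp: differentiable_def)
qed

lemma Ck_on_Pair:
  assumes "open S" "Ck_on k S f" "Ck_on k S g"
  shows "Ck_on k S (\<lambda>x. (f x, g x))"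
proof -
  have "bounded_linear (\<lambda>x. (x, 0::'c))" "bounded_linear (\<lambda>x. (0::'b, x))" for x :: 'a
    by (auto intro!: bounded_linear_Pair bounded_linear_ident bounded_linear_zero)
  then have "Ck_on k S (\<lambda>x. (f x, 0) + (0, g x))"
    by (intro Ck_on_add[OF assms(1)]) (auto intro: Ck_on_linear_comp[OF assms(1)] assms)
  then show ?thesis by simp
qed

lemma smooth_onD_open: "smooth_on S f \<Longrightarrow> open S"
  by (simp add: smooth_on_def)

lemma smooth_on_subset: "smooth_on S f \<Longrightarrow> open S' \<Longrightarrow> S' \<subseteq> S \<Longrightarrow> smooth_on S' f"
  by (auto simp: smooth_on_def intro: Ck_on_subset)

lemma smooth_on_cong: "smooth_on S f \<Longrightarrow> (\<And>x. x \<in> S \<Longrightarrow> f x = g x) \<Longrightarrow> smooth_on S g"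
  by (auto simp: smooth_on_def intro: Ck_on_cong)

lemma smooth_on_const: "open S \<Longrightarrow> smooth_on S (\<lambda>x. c)"
  by (auto simp: smooth_on_def intro: Ck_on_const)

lemma smooth_on_linear_comp: "bounded_linear L \<Longrightarrow> smooth_on S f \<Longrightarrow> smooth_on S (\<lambda>x. L (f x))"
  by (auto simp: smooth_on_def intro: Ck_on_linear_comp)

lemma smooth_on_ident: "open S \<Longrightarrow> smooth_on S (\<lambda>x. x)"
  by (auto simp: smooth_on_def intro: Ck_on_ident)

lemma smooth_on_linear: "open S \<Longrightarrow> bounded_linear L \<Longrightarrow> smooth_on S L"
  using smooth_on_linear_comp smooth_on_ident by blast

lemma smooth_on_Pair: "smooth_on S f \<Longrightarrow> smooth_on S g \<Longrightarrow> smooth_on S (\<lambda>x. (f x, g x))"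
  by (auto simp: smooth_on_def intro: Ck_on_Pair)

lemma smooth_on_add: "smooth_on S f \<Longrightarrow> smooth_on S g \<Longrightarrow> smooth_on S (\<lambda>x. f x + g x)"
  by (auto simp: smooth_on_def intro: Ck_on_add)

lemma smooth_on_compose:
  "smooth_on S f \<Longrightarrow> smooth_on S' g \<Longrightarrow> f ` S \<subseteq> S' \<Longrightarrow> smooth_on S (\<lambda>x. g (f x))"
  unfolding smooth_on_def using Ck_on_compose by blast

lemma smooth_on_D: "smooth_on S f \<Longrightarrow> smooth_on S (\<lambda>x. D f x v)"
  unfolding smooth_on_def by (metis Ck_on.simps(2))

lemma smooth_on_continuous: "smooth_on S f \<Longrightarrow> continuous_on S f"
  unfolding smooth_on_def by (metis Ck_on.simps(1))

lemma smooth_on_differentiable: "smooth_on S f \<Longrightarrow> x \<in> S \<Longrightarrow> f differentiable (at x)"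
  unfolding smooth_on_def by (metis Ck_on.simps(2))

lemma smooth_on_has_derivative: "smooth_on S f \<Longrightarrow> x \<in> S \<Longrightarrow> (f has_derivative D f x) (at x)"
  by (intro has_derivative_D smooth_on_differentiable)

lemma smooth_on_linear_D: "smooth_on S f \<Longrightarrow> x \<in> S \<Longrightarrow> linear (D f x)"
  by (intro linear_frechet_derivative smooth_on_differentiable)

lemma smooth_on_has_D2: "smooth_on S f \<Longrightarrow> x \<in> S \<Longrightarrow> ((\<lambda>y. D f y a) has_derivative D2 f x a) (at x)"
  unfolding D2_def by (intro smooth_on_has_derivative[of S] smooth_on_D)

lemma smooth_on_vimage_open:
  assumes "smooth_on S f" "open V" shows "open {x \<in> S. f x \<in> V}"
proof -
  have "open (S \<inter> f -` V)"
    using continuous_open_preimage[OF smooth_on_continuous[OF assms(1)] smooth_onD_open[OF assms(1)] assms(2)] .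
  moreover have "{x \<in> S. f x \<in> V} = S \<inter> f -` V" by auto
  ultimately show ?thesis by simp
qed

lemma linear_D2_right: "smooth_on S f \<Longrightarrow> x \<in> S \<Longrightarrow> linear (D2 f x a)"
  by (rule has_derivative_linear[OF smooth_on_has_D2])

lemma linear_D2_left:
  assumes f: "smooth_on S f" and x: "x \<in> S" shows "linear (\<lambda>a. D2 f x a b)"
proof (rule linearI)
  note S = smooth_onD_open[OF f]
  fix a a' :: 'a and c :: real
  have "D2 f x (a + a') = D (\<lambda>y. D f y a + D f y a') x"
    using D_cong[OF S x, of "\<lambda>y. D f y (a + a')" "\<lambda>y. D f y a + D f y a'"]
      linear_add[OF smooth_on_linear_D[OF f]] by (auto simp: D2_def)
  also have "\<dots> = (\<lambda>b. D2 f x a b + D2 f x a' b)"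
    by (intro D_eqI has_derivative_add smooth_on_has_D2[OF f x])
  finally show "D2 f x (a + a') b = D2 f x a b + D2 f x a' b" by simp
  have "D2 f x (c *\<^sub>R a) = D (\<lambda>y. c *\<^sub>R D f y a) x"
    using D_cong[OF S x, of "\<lambda>y. D f y (c *\<^sub>R a)" "\<lambda>y. c *\<^sub>R D f y a"]
      linear_scale[OF smooth_on_linear_D[OF f]] by (auto simp: D2_def)
  also have "\<dots> = (\<lambda>b. c *\<^sub>R D2 f x a b)"
    by (intro D_eqI has_derivative_scaleR_right smooth_on_has_D2[OF f x])
  finally show "D2 f x (c *\<^sub>R a) b = c *\<^sub>R D2 f x a b" by simp
qed

lemma D_compose:
  assumes "smooth_on S f" "smooth_on S' g" "x \<in> S" "f x \<in> S'"
  shows "D (\<lambda>y. g (f y)) x v = D g (f x) (D f x v)"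
  using D_eqI[OF has_derivative_compose[OF smooth_on_has_derivative[OF assms(1,3)]
    smooth_on_has_derivative[OF assms(2,4)]]] by simp


section \<open>Second derivatives\<close>

lemma has_vector_derivative_along_line:
  assumes "smooth_on S f" "x + t *\<^sub>R u \<in> S"
  shows "((\<lambda>t. f (x + t *\<^sub>R u)) has_vector_derivative D f (x + t *\<^sub>R u) u) (at t)"
proof -
  have "((\<lambda>t. f (x + t *\<^sub>R u)) has_derivative (\<lambda>h. D f (x + t *\<^sub>R u) (h *\<^sub>R u))) (at t)"
  proof (rule has_derivative_compose[where f = "\<lambda>t. x + t *\<^sub>R u" and f' = "\<lambda>h. h *\<^sub>R u"])
    show "((\<lambda>t. x + t *\<^sub>R u) has_derivative (\<lambda>h. h *\<^sub>R u)) (at t)"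
      by (auto intro!: derivative_eq_intros)
  qed (rule smooth_on_has_derivative[OF assms])
  then show ?thesis
    by (simp add: has_vector_derivative_def linear_scale[OF smooth_on_linear_D[OF assms]])
qed

lemma has_real_derivative_along_line:
  fixes f :: "'a::euclidean_space \<Rightarrow> real"
  assumes "smooth_on S f" "p + t *\<^sub>R u \<in> S"
  shows "((\<lambda>t. f (p + t *\<^sub>R u)) has_real_derivative D f (p + t *\<^sub>R u) u) (at t)"
  using has_vector_derivative_along_line[OF assms]
  by (simp add: has_real_derivative_iff_has_vector_derivative)

text \<open>The second difference of \<open>f\<close> on a parallelogram, evaluated by two applications of the mean
  value theorem.\<close>

lemma second_difference:
  fixes f :: "'a::euclidean_space \<Rightarrow> real"
  assumes f: "smooth_on S f" and h: "h > 0"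
    and S: "\<And>s t. 0 \<le> s \<Longrightarrow> s \<le> h \<Longrightarrow> 0 \<le> t \<Longrightarrow> t \<le> h \<Longrightarrow> x + s *\<^sub>R a + t *\<^sub>R b \<in> S"
  shows "\<exists>s t. 0 \<le> s \<and> s \<le> h \<and> 0 \<le> t \<and> t \<le> h \<and>
    f (x + h *\<^sub>R a + h *\<^sub>R b) - f (x + h *\<^sub>R a) - f (x + h *\<^sub>R b) + f x =
    h * h * D2 f (x + s *\<^sub>R a + t *\<^sub>R b) a b"
proof -
  define \<phi> where "\<phi> s = f (x + h *\<^sub>R b + s *\<^sub>R a) - f (x + s *\<^sub>R a)" for s
  have "\<exists>s>0. s < h \<and> \<phi> h - \<phi> 0 = (h - 0) * (D f (x + h *\<^sub>R b + s *\<^sub>R a) a - D f (x + s *\<^sub>R a) a)"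
    unfolding \<phi>_def
  proof (rule MVT2[OF h])
    fix s assume s: "0 \<le> s" "s \<le> h"
    show "((\<lambda>s. f (x + h *\<^sub>R b + s *\<^sub>R a) - f (x + s *\<^sub>R a)) has_real_derivative
        D f (x + h *\<^sub>R b + s *\<^sub>R a) a - D f (x + s *\<^sub>R a) a) (at s)"
      using S[of s h] S[of s 0] s h
      by (intro DERIV_diff has_real_derivative_along_line[OF f]) (auto simp: algebra_simps)
  qed
  then obtain s where s: "0 < s" "s < h"
    and 1: "\<phi> h - \<phi> 0 = h * (D f (x + h *\<^sub>R b + s *\<^sub>R a) a - D f (x + s *\<^sub>R a) a)" by auto
  define \<psi> where "\<psi> t = D f (x + s *\<^sub>R a + t *\<^sub>R b) a" for t
  have "\<exists>t>0. t < h \<and> \<psi> h - \<psi> 0 = (h - 0) * D2 f (x + s *\<^sub>R a + t *\<^sub>R b) a b"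
    unfolding \<psi>_def D2_def
  proof (rule MVT2[OF h])
    fix t assume t: "0 \<le> t" "t \<le> h"
    show "((\<lambda>t. D f (x + s *\<^sub>R a + t *\<^sub>R b) a) has_real_derivative
        D (\<lambda>y. D f y a) (x + s *\<^sub>R a + t *\<^sub>R b) b) (at t)"
      using S[of s t] s t by (intro has_real_derivative_along_line[OF smooth_on_D[OF f]]) auto
  qed
  then obtain t where t: "0 < t" "t < h" and 2: "\<psi> h - \<psi> 0 = h * D2 f (x + s *\<^sub>R a + t *\<^sub>R b) a b"
    by auto
  have "f (x + h *\<^sub>R a + h *\<^sub>R b) - f (x + h *\<^sub>R a) - f (x + h *\<^sub>R b) + f x = \<phi> h - \<phi> 0"
    by (simp add: \<phi>_def algebra_simps)
  also have "\<dots> = h * (\<psi> h - \<psi> 0)"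
    unfolding 1 by (simp add: \<psi>_def algebra_simps)
  also have "\<dots> = h * h * D2 f (x + s *\<^sub>R a + t *\<^sub>R b) a b" unfolding 2 by simp
  finally show ?thesis using s t by (intro exI[of _ s] exI[of _ t]) auto
qed

text \<open>The second difference is symmetric in \<open>a\<close> and \<open>b\<close>; divided by \<open>h\<^sup>2\<close> it is a value of either
  mixed derivative at a point close to \<open>x\<close>.\<close>

lemma D2_commute_real:
  fixes f :: "'a::euclidean_space \<Rightarrow> real"
  assumes f: "smooth_on S f" and x: "x \<in> S"
  shows "D2 f x a b = D2 f x b a"
proof (rule ccontr)
  assume ne: "D2 f x a b \<noteq> D2 f x b a"
  define \<epsilon> where "\<epsilon> = \<bar>D2 f x a b - D2 f x b a\<bar> / 2"
  have \<epsilon>: "\<epsilon> > 0" using ne by (simp add: \<epsilon>_def)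
  have S: "open S" using smooth_onD_open[OF f] .
  have c: "continuous_on S (\<lambda>y. D2 f y a b)" for a b
    unfolding D2_def by (intro smooth_on_continuous smooth_on_D f)
  obtain d1 where d1: "d1 > 0" "\<And>y. y \<in> S \<Longrightarrow> dist y x < d1 \<Longrightarrow> dist (D2 f y a b) (D2 f x a b) < \<epsilon>"
    using c[of a b] x \<epsilon> unfolding continuous_on_iff by metis
  obtain d2 where d2: "d2 > 0" "\<And>y. y \<in> S \<Longrightarrow> dist y x < d2 \<Longrightarrow> dist (D2 f y b a) (D2 f x b a) < \<epsilon>"
    using c[of b a] x \<epsilon> unfolding continuous_on_iff by metis
  obtain d3 where d3: "d3 > 0" "ball x d3 \<subseteq> S" using S x open_contains_ball by blast
  define d where "d = min d1 (min d2 d3)"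
  define h where "h = d / (2 * (1 + norm a + norm b))"
  have d: "d > 0" using d1 d2 d3 by (simp add: d_def)
  have n: "1 + norm a + norm b > 0" by (smt (verit) norm_ge_zero)
  have h: "h > 0" using d n by (simp add: h_def)
  have near: "dist (x + s *\<^sub>R a + t *\<^sub>R b) x < d"
    if "0 \<le> s" "s \<le> h" "0 \<le> t" "t \<le> h" for s t
  proof -
    have "dist (x + s *\<^sub>R a + t *\<^sub>R b) x = norm (s *\<^sub>R a + t *\<^sub>R b)" by (simp add: dist_norm)
    also have "\<dots> \<le> s * norm a + t * norm b"
      using norm_triangle_ineq[of "s *\<^sub>R a" "t *\<^sub>R b"] that by simp
    also have "\<dots> \<le> h * norm a + h * norm b"
      using that by (intro add_mono mult_right_mono) auto
    also have "\<dots> \<le> h * (1 + norm a + norm b)" using h by (simp add: algebra_simps)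
    also have "\<dots> = d / 2" using n unfolding h_def by (subst mult.commute) (simp add: divide_simps)
    also have "\<dots> < d" using d by simp
    finally show ?thesis .
  qed
  have inS: "x + s *\<^sub>R a + t *\<^sub>R b \<in> S" if "0 \<le> s" "s \<le> h" "0 \<le> t" "t \<le> h" for s t
    using near[OF that] d3 by (auto simp: d_def dist_commute)
  have inS': "x + s *\<^sub>R b + t *\<^sub>R a \<in> S" if "0 \<le> s" "s \<le> h" "0 \<le> t" "t \<le> h" for s t
    using inS[of t s] that by (simp add: algebra_simps)
  obtain s t where st: "0 \<le> s" "s \<le> h" "0 \<le> t" "t \<le> h"
    and 1: "f (x + h *\<^sub>R a + h *\<^sub>R b) - f (x + h *\<^sub>R a) - f (x + h *\<^sub>R b) + f x =
      h * h * D2 f (x + s *\<^sub>R a + t *\<^sub>R b) a b"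
    using second_difference[OF f h inS] by blast
  obtain s' t' where st': "0 \<le> s'" "s' \<le> h" "0 \<le> t'" "t' \<le> h"
    and 2: "f (x + h *\<^sub>R b + h *\<^sub>R a) - f (x + h *\<^sub>R b) - f (x + h *\<^sub>R a) + f x =
      h * h * D2 f (x + s' *\<^sub>R b + t' *\<^sub>R a) b a"
    using second_difference[OF f h inS'] by blast
  have swap: "x + h *\<^sub>R b + h *\<^sub>R a = x + h *\<^sub>R a + h *\<^sub>R b" "x + s' *\<^sub>R b + t' *\<^sub>R a = x + t' *\<^sub>R a + s' *\<^sub>R b"
    by (simp_all add: algebra_simps)
  have "h * h * D2 f (x + s *\<^sub>R a + t *\<^sub>R b) a b = h * h * D2 f (x + t' *\<^sub>R a + s' *\<^sub>R b) b a"
    using 1 2 unfolding swap by linarith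
  then have "D2 f (x + s *\<^sub>R a + t *\<^sub>R b) a b = D2 f (x + t' *\<^sub>R a + s' *\<^sub>R b) b a" using h by simp
  moreover have "dist (D2 f (x + s *\<^sub>R a + t *\<^sub>R b) a b) (D2 f x a b) < \<epsilon>"
    using d1(2)[OF inS[OF st]] near[OF st] by (simp add: d_def)
  moreover have "dist (D2 f (x + t' *\<^sub>R a + s' *\<^sub>R b) b a) (D2 f x b a) < \<epsilon>"
    using d2(2)[OF inS[OF st'(3,4,1,2)]] near[OF st'(3,4,1,2)] by (simp add: d_def)
  ultimately have "dist (D2 f x a b) (D2 f x b a) < \<epsilon> + \<epsilon>"
    using dist_triangle_less_add by (metis dist_commute)
  then show False by (simp add: \<epsilon>_def dist_real_def)
qed

lemma D_linear_comp:
  assumes "bounded_linear L" "f differentiable (at x)"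
  shows "D (\<lambda>y. L (f y)) x v = L (D f x v)"
  using D_eqI[OF bounded_linear.has_derivative[OF assms(1) has_derivative_D[OF assms(2)]]] by simp

lemma D2_commute:
  assumes f: "smooth_on S f" and x: "x \<in> S"
  shows "D2 f x a b = D2 f x b a"
proof (rule euclidean_eqI)
  fix i :: 'b assume "i \<in> Basis"
  have S: "open S" using smooth_onD_open[OF f] .
  have D2i: "D2 (\<lambda>y. f y \<bullet> i) x a b = D2 f x a b \<bullet> i" for a b
  proof -
    have "D2 (\<lambda>y. f y \<bullet> i) x a b = D (\<lambda>y. D f y a \<bullet> i) x b"
      unfolding D2_def
      by (subst D_cong[OF S x, of _ "\<lambda>y. D f y a \<bullet> i"])
        (simp_all add: D_linear_comp[OF bounded_linear_inner_left smooth_on_differentiable[OF f]])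
    also have "\<dots> = D2 f x a b \<bullet> i"
      unfolding D2_def
      by (intro D_linear_comp bounded_linear_inner_left smooth_on_differentiable[OF smooth_on_D[OF f] x])
    finally show ?thesis .
  qed
  show "D2 f x a b \<bullet> i = D2 f x b a \<bullet> i"
    using D2_commute_real[OF smooth_on_linear_comp[OF bounded_linear_inner_left f, of i] x, of a b]
    by (simp add: D2i)
qed

text \<open>The product rule for the derivative of \<open>g\<close> taken at a moving point in a moving direction, from
  which the second-order chain rule follows.\<close>

lemma has_derivative_D_apply:
  fixes g :: "'b::euclidean_space \<Rightarrow> 'c::euclidean_space"
    and \<phi> \<psi> :: "'a::euclidean_space \<Rightarrow> 'b"
  assumes g: "smooth_on S g" and \<phi>x: "\<phi> x \<in> S"
    and \<phi>: "(\<phi> has_derivative \<phi>') (at x)" and \<psi>: "(\<psi> has_derivative \<psi>') (at x)"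
  shows "((\<lambda>y. D g (\<phi> y) (\<psi> y)) has_derivative
    (\<lambda>b. D2 g (\<phi> x) (\<psi> x) (\<phi>' b) + D g (\<phi> x) (\<psi>' b))) (at x)"
proof -
  have d: "((\<lambda>y. \<Sum>i\<in>Basis. (\<psi> y \<bullet> i) *\<^sub>R D g (\<phi> y) i) has_derivative
    (\<lambda>b. \<Sum>i\<in>Basis. (\<psi> x \<bullet> i) *\<^sub>R D2 g (\<phi> x) i (\<phi>' b) + (\<psi>' b \<bullet> i) *\<^sub>R D g (\<phi> x) i)) (at x)"
    by (intro has_derivative_sum has_derivative_scaleR has_derivative_inner_left \<psi>
        has_derivative_compose[OF \<phi> smooth_on_has_D2[OF g \<phi>x]])
  have ev: "\<forall>\<^sub>F y in at x. (\<Sum>i\<in>Basis. (\<psi> y \<bullet> i) *\<^sub>R D g (\<phi> y) i) = D g (\<phi> y) (\<psi> y)"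
  proof -
    have "(\<phi> \<longlongrightarrow> \<phi> x) (at x)"
      using has_derivative_continuous[OF \<phi>] by (simp add: continuous_at)
    then have "\<forall>\<^sub>F y in at x. \<phi> y \<in> S"
      using topological_tendstoD smooth_onD_open[OF g] \<phi>x by blast
    then show ?thesis
      by eventually_elim (metis linear_expansion smooth_on_linear_D[OF g])
  qed
  have eq: "(\<Sum>i\<in>Basis. (\<psi> x \<bullet> i) *\<^sub>R D g (\<phi> x) i) = D g (\<phi> x) (\<psi> x)"
    by (metis linear_expansion smooth_on_linear_D[OF g \<phi>x])
  have "((\<lambda>y. D g (\<phi> y) (\<psi> y)) has_derivative
    (\<lambda>b. \<Sum>i\<in>Basis. (\<psi> x \<bullet> i) *\<^sub>R D2 g (\<phi> x) i (\<phi>' b) + (\<psi>' b \<bullet> i) *\<^sub>R D g (\<phi> x) i)) (at x)"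
    by (rule has_derivative_transform_eventually[OF d ev]) (use eq in auto)
  moreover have "(\<Sum>i\<in>Basis. (\<psi> x \<bullet> i) *\<^sub>R D2 g (\<phi> x) i (\<phi>' b) + (\<psi>' b \<bullet> i) *\<^sub>R D g (\<phi> x) i) =
      D2 g (\<phi> x) (\<psi> x) (\<phi>' b) + D g (\<phi> x) (\<psi>' b)" for b
    unfolding sum.distrib
    using linear_expansion[OF linear_D2_left[OF g \<phi>x], of "\<psi> x" "\<phi>' b"]
      linear_expansion[OF smooth_on_linear_D[OF g \<phi>x], of "\<psi>' b"] by simp
  ultimately show ?thesis by simp
qed

lemma D2_compose:
  assumes f: "smooth_on S f" and g: "smooth_on S' g" and x: "x \<in> S" and im: "f ` S \<subseteq> S'"
  shows "D2 (\<lambda>y. g (f y)) x a b = D2 g (f x) (D f x a) (D f x b) + D g (f x) (D2 f x a b)"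
proof -
  have fx: "f x \<in> S'" using x im by auto
  have "D2 (\<lambda>y. g (f y)) x a = D (\<lambda>y. D g (f y) (D f y a)) x"
    unfolding D2_def
    by (rule D_cong[OF smooth_onD_open[OF f] x]) (use D_compose[OF f g] im in auto)
  also have "\<dots> = (\<lambda>b. D2 g (f x) (D f x a) (D f x b) + D g (f x) (D2 f x a b))"
    by (rule D_eqI, rule has_derivative_D_apply[where \<phi> = f and \<psi> = "\<lambda>y. D f y a", OF g fx])
      (rule smooth_on_has_derivative[OF f x] smooth_on_has_D2[OF f x])+
  finally show ?thesis by simp
qed

lemma D2_cong:
  assumes "open S" "x \<in> S" "\<And>y. y \<in> S \<Longrightarrow> f y = g y"
  shows "D2 f x = D2 g x"
proof -
  have "D (\<lambda>y. D f y a) x = D (\<lambda>y. D g y a) x" for a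
    by (rule D_cong[OF assms(1,2)]) (use D_cong[OF assms(1) _ assms(3)] in auto)
  then show ?thesis by (simp add: D2_def fun_eq_iff)
qed

lemma D_Pair:
  assumes "f differentiable (at x)" "g differentiable (at x)"
  shows "D (\<lambda>y. (f y, g y)) x v = (D f x v, D g x v)"
  using D_eqI[OF has_derivative_Pair[OF has_derivative_D[OF assms(1)] has_derivative_D[OF assms(2)]]] by simp

lemma D2_Pair:
  assumes f: "smooth_on S f" and g: "smooth_on S g" and x: "x \<in> S"
  shows "D2 (\<lambda>y. (f y, g y)) x a b = (D2 f x a b, D2 g x a b)"
proof -
  have "D2 (\<lambda>y. (f y, g y)) x a = D (\<lambda>y. (D f y a, D g y a)) x"
    unfolding D2_def by (rule D_cong[OF smooth_onD_open[OF f] x])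
      (use D_Pair[OF smooth_on_differentiable[OF f] smooth_on_differentiable[OF g]] in auto)
  also have "\<dots> = (\<lambda>b. (D2 f x a b, D2 g x a b))"
    by (intro D_eqI has_derivative_Pair smooth_on_has_D2[OF f x] smooth_on_has_D2[OF g x])
  finally show ?thesis by simp
qed

lemma D_bounded_linear: "bounded_linear L \<Longrightarrow> D L x v = L v"
  using D_eqI[OF bounded_linear_imp_has_derivative] by metis

lemma D2_bounded_linear: "bounded_linear L \<Longrightarrow> D2 L x a b = 0"
  unfolding D2_def by (simp add: D_bounded_linear)

lemma D_second:
  assumes f: "smooth_on S f" and xy: "(x, y) \<in> S"
  shows "D (\<lambda>y. f (x, y)) y v = D f (x, y) (0, v)"
proof -
  have "((\<lambda>y. (x, y)) has_derivative (\<lambda>v. (0, v))) (at y)"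
    by (auto intro!: derivative_eq_intros)
  from has_derivative_compose[OF this smooth_on_has_derivative[OF f xy]]
  show ?thesis using D_eqI by metis
qed

lemma D_first:
  assumes f: "smooth_on S f" and xy: "(x, y) \<in> S"
  shows "D (\<lambda>x. f (x, y)) x v = D f (x, y) (v, 0)"
proof -
  have "((\<lambda>x. (x, y)) has_derivative (\<lambda>v. (v, 0))) (at x)"
    by (auto intro!: derivative_eq_intros)
  from has_derivative_compose[OF this smooth_on_has_derivative[OF f xy]]
  show ?thesis using D_eqI by metis
qed


lemma D_prod_map:
  assumes S: "smooth_on S f" and p: "fst p \<in> S" "snd p \<in> S"
  shows "D (\<lambda>p. (f (fst p), f (snd p))) p w = (D f (fst p) (fst w), D f (snd p) (snd w))"
proof -
  have "((\<lambda>p. f (fst p)) has_derivative (\<lambda>w. D f (fst p) (fst w))) (at p)"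
    "((\<lambda>p. f (snd p)) has_derivative (\<lambda>w. D f (snd p) (snd w))) (at p)"
    using p by (auto intro!: has_derivative_compose[OF _ smooth_on_has_derivative[OF S]]
      bounded_linear_imp_has_derivative bounded_linear_fst bounded_linear_snd)
  then have "((\<lambda>p. (f (fst p), f (snd p))) has_derivative
      (\<lambda>w. (D f (fst p) (fst w), D f (snd p) (snd w)))) (at p)"
    by (rule has_derivative_Pair)
  then show ?thesis using D_eqI by fastforce
qed

text \<open>The two components depend on different variables. Automorphisms and translations act on pairs in
  this way, so they contribute nothing to mixed second derivatives of the multiplication.\<close>

lemma D2_prod_map:
  fixes f :: "'a::euclidean_space \<Rightarrow> 'b::euclidean_space"
  assumes S: "smooth_on S f" and p: "fst p \<in> S" "snd p \<in> S"
  shows "D2 (\<lambda>p. (f (fst p), f (snd p))) p (0, v) (u, 0) = 0"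
proof -
  have W: "open (S \<times> S)" using smooth_onD_open[OF S] by (simp add: open_Times)
  have pW: "p \<in> S \<times> S" using p by (cases p) auto
  have lin: "linear (D f y)" if "y \<in> S" for y using smooth_on_linear_D[OF S that] .
  have "D2 (\<lambda>p. (f (fst p), f (snd p))) p (0, v) (u, 0) = D (\<lambda>p. (0, D f (snd p) v)) p (u, 0)"
    unfolding D2_def
    by (subst D_cong[OF W pW, of _ "\<lambda>p. (0, D f (snd p) v)"])
      (auto simp: D_prod_map[OF S] linear_0[OF lin])
  also have "\<dots> = (0, D2 f (snd p) v 0)"
  proof -
    have "((\<lambda>p. D f (snd p) v) has_derivative (\<lambda>w. D2 f (snd p) v (snd w))) (at p)"
      using has_derivative_compose[OF bounded_linear_imp_has_derivative[OF bounded_linear_snd], of "\<lambda>y. D f y v"]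
        smooth_on_has_D2[OF S p(2), of v] by fastforce
    from D_eqI[OF has_derivative_Pair[OF has_derivative_const[of "0::'b"] this]] show ?thesis by simp
  qed
  also have "D2 f (snd p) v 0 = 0" by (rule linear_0[OF linear_D2_right[OF S p(2)]])
  finally show ?thesis by (simp add: zero_prod_def)
qed


section \<open>A Lie group in a chart around the identity\<close>

locale lie_chart = lie_group G T A
  for G :: "('g, 'm) monoid_scheme" (structure)
    and T :: "'g topology" and A :: "('g, 'a::euclidean_space) chart set" +
  fixes \<kappa> :: "('g, 'a) chart"
  assumes \<kappa>: "\<kappa> \<in> A" and one_dom: "\<one> \<in> fst \<kappa>"
begin

lemma chart_dom_carrier: "\<eta> \<in> A \<Longrightarrow> fst \<eta> \<subseteq> carrier G"
  using charts_cover by auto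

lemma chart_inj: assumes "\<eta> \<in> A" shows "inj_on (snd \<eta>) (fst \<eta>)"
proof -
  have "homeomorphic_map (subtopology T (fst \<eta>)) (top_of_set (snd \<eta> ` fst \<eta>)) (snd \<eta>)"
    using charts[OF assms] by (simp add: is_chart_def)
  moreover have "topspace (subtopology T (fst \<eta>)) = fst \<eta>"
    using chart_dom_carrier[OF assms] topspace_eq by auto
  ultimately show ?thesis using homeomorphic_imp_injective_map by metis
qed

lemma chart_inv_left: "\<eta> \<in> A \<Longrightarrow> a \<in> fst \<eta> \<Longrightarrow> chart_inv \<eta> (snd \<eta> a) = a"
  unfolding chart_inv_def by (rule the_inv_into_f_f[OF chart_inj])

lemma chart_inv_right: "\<eta> \<in> A \<Longrightarrow> x \<in> snd \<eta> ` fst \<eta> \<Longrightarrow> snd \<eta> (chart_inv \<eta> x) = x"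
  by (auto simp: chart_inv_left)

lemma chart_inv_dom: "\<eta> \<in> A \<Longrightarrow> x \<in> snd \<eta> ` fst \<eta> \<Longrightarrow> chart_inv \<eta> x \<in> fst \<eta>"
  by (auto simp: chart_inv_left)

abbreviation org :: 'a where "org \<equiv> origin G \<kappa>"
abbreviation crd :: "'g \<Rightarrow> 'a" where "crd \<equiv> snd \<kappa>"
abbreviation pt :: "'a \<Rightarrow> 'g" where "pt \<equiv> chart_inv \<kappa>"
definition U :: "'a set" where "U = snd \<kappa> ` fst \<kappa>"

lemma open_U: "open U"
  using charts[OF \<kappa>] by (simp add: is_chart_def U_def)

lemma org_U: "org \<in> U"
  using one_dom by (simp add: U_def origin_def)

lemma pt_crd [simp]: "a \<in> fst \<kappa> \<Longrightarrow> pt (crd a) = a"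
  by (rule chart_inv_left[OF \<kappa>])

lemma crd_pt [simp]: "x \<in> U \<Longrightarrow> crd (pt x) = x"
  unfolding U_def by (rule chart_inv_right[OF \<kappa>])

lemma pt_dom [simp]: "x \<in> U \<Longrightarrow> pt x \<in> fst \<kappa>"
  unfolding U_def by (rule chart_inv_dom[OF \<kappa>])

lemma crd_U [simp]: "a \<in> fst \<kappa> \<Longrightarrow> crd a \<in> U"
  by (auto simp: U_def)

lemma dom_carrier [simp]: "a \<in> fst \<kappa> \<Longrightarrow> a \<in> carrier G"
  using chart_dom_carrier[OF \<kappa>] by auto

lemma pt_carrier [simp]: "x \<in> U \<Longrightarrow> pt x \<in> carrier G" by simp

lemma pt_org [simp]: "pt org = \<one>"
  using one_dom by (simp add: origin_def)

lemma crd_one [simp]: "crd \<one> = org"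
  by (simp add: origin_def)

lemma openin_dom: "openin T (fst \<kappa>)"
  using charts[OF \<kappa>] by (simp add: is_chart_def)

lemma openin_crd_vimage: assumes "open V" shows "openin T {a \<in> fst \<kappa>. crd a \<in> V}"
proof -
  have "homeomorphic_map (subtopology T (fst \<kappa>)) (top_of_set U) crd"
    using charts[OF \<kappa>] by (simp add: is_chart_def U_def)
  then have "continuous_map (subtopology T (fst \<kappa>)) (top_of_set U) crd"
    by (rule homeomorphic_imp_continuous_map)
  moreover have "openin (top_of_set U) (U \<inter> V)"
    using assms by (simp add: openin_open_Int)
  ultimately have "openin (subtopology T (fst \<kappa>)) {a \<in> topspace (subtopology T (fst \<kappa>)). crd a \<in> U \<inter> V}"
    by (rule openin_continuous_map_preimage)
  moreover have "{a \<in> topspace (subtopology T (fst \<kappa>)). crd a \<in> U \<inter> V} = {a \<in> fst \<kappa>. crd a \<in> V}"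
    unfolding topspace_subtopology using openin_subset[OF openin_dom] crd_U by blast
  ultimately have "openin (subtopology T (fst \<kappa>)) {a \<in> fst \<kappa>. crd a \<in> V}"
    by simp
  then show ?thesis using openin_trans_full[OF _ openin_dom] by auto
qed


subsection \<open>Multiplication and inversion in the chart\<close>

definition mul :: "'a \<times> 'a \<Rightarrow> 'a" where "mul p = crd (pt (fst p) \<otimes> pt (snd p))"
definition mul_dom :: "('a \<times> 'a) set" where
  "mul_dom = {p. fst p \<in> U \<and> snd p \<in> U \<and> pt (fst p) \<otimes> pt (snd p) \<in> fst \<kappa>}"
definition ivt :: "'a \<Rightarrow> 'a" where "ivt x = crd (inv (pt x))"
definition ivt_dom :: "'a set" where "ivt_dom = {x \<in> U. inv (pt x) \<in> fst \<kappa>}"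

lemma smooth_mul: "smooth_on mul_dom mul"
proof -
  have "mul = (\<lambda>(x, y). crd (pt x \<otimes> pt y))" by (auto simp: mul_def)
  moreover have "mul_dom = {(x, y). x \<in> crd ` fst \<kappa> \<and> y \<in> crd ` fst \<kappa> \<and> pt x \<otimes> pt y \<in> fst \<kappa>}"
    by (auto simp: mul_dom_def U_def)
  ultimately show ?thesis using Defs.lie_group.smooth_mult[OF lie_group_axioms \<kappa> \<kappa> \<kappa>] by simp
qed

lemma smooth_ivt: "smooth_on ivt_dom ivt"
proof -
  have "ivt_dom = {x. x \<in> crd ` fst \<kappa> \<and> inv (pt x) \<in> fst \<kappa>}"
    by (auto simp: ivt_dom_def U_def)
  moreover have "ivt = (\<lambda>x. crd (inv (pt x)))" by (auto simp: ivt_def)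
  ultimately show ?thesis using Defs.lie_group.smooth_inv[OF lie_group_axioms \<kappa> \<kappa>] by simp
qed

lemma mul_domD: "p \<in> mul_dom \<Longrightarrow> fst p \<in> U" "p \<in> mul_dom \<Longrightarrow> snd p \<in> U"
  "p \<in> mul_dom \<Longrightarrow> mul p \<in> U" "p \<in> mul_dom \<Longrightarrow> pt (mul p) = pt (fst p) \<otimes> pt (snd p)"
  by (auto simp: mul_dom_def mul_def)

lemma ivt_domD: "x \<in> ivt_dom \<Longrightarrow> x \<in> U" "x \<in> ivt_dom \<Longrightarrow> ivt x \<in> U"
  "x \<in> ivt_dom \<Longrightarrow> pt (ivt x) = inv (pt x)"
  by (auto simp: ivt_dom_def ivt_def)

lemma unit_right: "x \<in> U \<Longrightarrow> (x, org) \<in> mul_dom" "x \<in> U \<Longrightarrow> mul (x, org) = x"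
  by (auto simp: mul_dom_def mul_def org_U)

lemma unit_left: "x \<in> U \<Longrightarrow> (org, x) \<in> mul_dom" "x \<in> U \<Longrightarrow> mul (org, x) = x"
  by (auto simp: mul_dom_def mul_def org_U)

lemma org_ivt: "org \<in> ivt_dom" "ivt org = org"
  by (auto simp: ivt_dom_def ivt_def org_U one_dom)

lemma open_mul_dom: "open mul_dom" and open_ivt_dom: "open ivt_dom"
  using smooth_onD_open smooth_mul smooth_ivt by blast+

lemma mul_ivt: "x \<in> ivt_dom \<Longrightarrow> (x, ivt x) \<in> mul_dom" "x \<in> ivt_dom \<Longrightarrow> mul (x, ivt x) = org"
  by (auto simp: mul_dom_def mul_def ivt_domD one_dom)

lemma D_mul_first: assumes "x \<in> U" shows "D mul (x, org) (u, 0) = u"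
proof -
  have "D (\<lambda>x. mul (x, org)) x u = D (\<lambda>x. x) x u"
    using D_cong[OF open_U assms, of "\<lambda>x. mul (x, org)" "\<lambda>x. x"] unit_right by auto
  then show ?thesis using D_first[OF smooth_mul unit_right(1)[OF assms], of u] by simp
qed

lemma D_mul_second: assumes "x \<in> U" shows "D mul (org, x) (0, u) = u"
proof -
  have "D (\<lambda>x. mul (org, x)) x u = D (\<lambda>x. x) x u"
    using D_cong[OF open_U assms, of "\<lambda>x. mul (org, x)" "\<lambda>x. x"] unit_left by auto
  then show ?thesis using D_second[OF smooth_mul unit_left(1)[OF assms], of u] by simp
qed

lemma D_mul: "D mul (org, org) (u, v) = u + v"
proof -
  have "D mul (org, org) ((u, 0) + (0, v)) = u + v"
    using linear_add[OF smooth_on_linear_D[OF smooth_mul unit_right(1)[OF org_U]]]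
      D_mul_first[OF org_U] D_mul_second[OF org_U] by metis
  then show ?thesis by simp
qed

lemma D_ivt: "D ivt org v = - v"
proof -
  have "D (\<lambda>x. mul (x, ivt x)) org v = D (\<lambda>x. org) org v"
    using D_cong[OF open_ivt_dom org_ivt(1), of "\<lambda>x. mul (x, ivt x)" "\<lambda>x. org"] mul_ivt by auto
  moreover have "D (\<lambda>x. mul (x, ivt x)) org v = D mul (org, org) (D (\<lambda>x. (x, ivt x)) org v)"
    using D_compose[of ivt_dom "\<lambda>x. (x, ivt x)" mul_dom mul org v]
      smooth_on_Pair[OF smooth_on_ident[OF open_ivt_dom] smooth_ivt] smooth_mul
      org_ivt mul_ivt unit_right(1)[OF org_U] by auto
  moreover have "D (\<lambda>x. (x, ivt x)) org v = (v, D ivt org v)"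
    by (subst D_Pair) (auto intro: smooth_on_differentiable[OF smooth_ivt org_ivt(1)])
  ultimately have "v + D ivt org v = 0" by (simp add: D_mul)
  then show ?thesis by (simp add: add_eq_0_iff)
qed


subsection \<open>The bracket\<close>

text \<open>The mixed second derivative of the multiplication at the identity, whose skew part is the bracket.\<close>

definition beta :: "'a \<Rightarrow> 'a \<Rightarrow> 'a" where "beta u v = D2 mul (org, org) (0, v) (u, 0)"

abbreviation br :: "'a \<Rightarrow> 'a \<Rightarrow> 'a" where "br \<equiv> lie_bracket G \<kappa>"

lemma left_inv_field_eq: "x \<in> U \<Longrightarrow> left_inv_field G \<kappa> v x = D mul (x, org) (0, v)"
  using D_second[OF smooth_mul unit_right(1), of x v] by (simp add: left_inv_field_def mul_def)

lemma D_left_inv_field: "D (left_inv_field G \<kappa> v) org u = beta u v"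
proof -
  have "D (left_inv_field G \<kappa> v) org u = D (\<lambda>x. D mul (x, org) (0, v)) org u"
    using D_cong[OF open_U org_U, of "left_inv_field G \<kappa> v" "\<lambda>x. D mul (x, org) (0, v)"]
      left_inv_field_eq by auto
  also have "\<dots> = D (\<lambda>p. D mul p (0, v)) (org, org) (u, 0)"
    using D_first[OF smooth_on_D[OF smooth_mul] unit_right(1)[OF org_U]] .
  finally show ?thesis by (simp add: beta_def D2_def)
qed

lemma bracket_beta: "br u v = beta u v - beta v u"
  by (simp add: lie_bracket_def D_left_inv_field)

lemma org2: "(org, org) \<in> mul_dom" by (rule unit_right(1)[OF org_U])

lemma linear_beta: "linear (beta u)" "linear (\<lambda>u. beta u v)"
proof -
  have "linear (\<lambda>v. (0::'a, v::'a))" "linear (\<lambda>v. (v::'a, 0::'a))"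
    by (auto intro!: linearI)
  with linear_D2_left[OF smooth_mul org2] linear_D2_right[OF smooth_mul org2]
  show "linear (beta u)" "linear (\<lambda>u. beta u v)"
    unfolding beta_def using linear_compose[unfolded o_def] by blast+
qed

lemma linear_br_right: "linear (br u)"
  unfolding bracket_beta[abs_def] by (intro linear_compose_sub linear_beta)

lemma linear_br_left: "linear (\<lambda>u. br u v)"
  unfolding bracket_beta by (intro linear_compose_sub linear_beta)

lemma br_skew: "br v u = - br u v"
  by (simp add: bracket_beta)

lemma br_self [simp]: "br u u = 0"
  by (simp add: bracket_beta)

lemmas br_simps = linear_add[OF linear_br_right] linear_add[OF linear_br_left]
  linear_diff[OF linear_br_right] linear_diff[OF linear_br_left]
  linear_scale[OF linear_br_right] linear_scale[OF linear_br_left]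
  linear_neg[OF linear_br_right] linear_neg[OF linear_br_left]
  linear_0[OF linear_br_right] linear_0[OF linear_br_left]


subsection \<open>The adjoint representation\<close>

definition cnj :: "'g \<Rightarrow> 'a \<Rightarrow> 'a" where "cnj a y = crd (a \<otimes> pt y \<otimes> inv a)"

lemma Ad_cnj: "Ad G \<kappa> a v = D (cnj a) org v"
  by (simp add: Ad_def cnj_def[abs_def])

lemma cnj_org [simp]: "a \<in> carrier G \<Longrightarrow> cnj a org = org"
  by (simp add: cnj_def)

text \<open>The element \<open>a\<close> need not lie in the domain of \<open>\<kappa>\<close>: multiplication by \<open>a\<close> goes into a chart around
  \<open>a\<close>, and multiplication by \<open>inv a\<close>, given in a chart around \<open>inv a\<close>, comes back into \<open>\<kappa>\<close>.\<close>

lemma smooth_cnj: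
  assumes a: "a \<in> carrier G"
  obtains S where "smooth_on S (cnj a)" "org \<in> S" "S \<subseteq> U"
    "\<And>y. y \<in> S \<Longrightarrow> a \<otimes> pt y \<otimes> inv a \<in> fst \<kappa>"
proof -
  obtain \<mu> where \<mu>: "\<mu> \<in> A" "a \<in> fst \<mu>" using a charts_cover by blast
  obtain \<eta> where \<eta>: "\<eta> \<in> A" "inv a \<in> fst \<eta>" using inv_closed[OF a] charts_cover by blast
  define f1 where "f1 = (\<lambda>(x, y). snd \<mu> (chart_inv \<mu> x \<otimes> pt y))"
  define S1 where "S1 = {(x, y). x \<in> snd \<mu> ` fst \<mu> \<and> y \<in> crd ` fst \<kappa> \<and> chart_inv \<mu> x \<otimes> pt y \<in> fst \<mu>}"
  define f2 where "f2 = (\<lambda>(x, y). crd (chart_inv \<mu> x \<otimes> chart_inv \<eta> y))"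
  define S2 where "S2 = {(x, y). x \<in> snd \<mu> ` fst \<mu> \<and> y \<in> snd \<eta> ` fst \<eta> \<and>
    chart_inv \<mu> x \<otimes> chart_inv \<eta> y \<in> fst \<kappa>}"
  have f1: "smooth_on S1 f1" and f2: "smooth_on S2 f2"
    using smooth_mult[OF \<mu>(1) \<kappa> \<mu>(1)] smooth_mult[OF \<mu>(1) \<eta>(1) \<kappa>]
    by (simp_all add: f1_def S1_def f2_def S2_def)
  define i1 where "i1 y = (snd \<mu> a, y)" for y :: 'a
  define i2 where "i2 z = (z, snd \<eta> (inv a))" for z :: 'a
  have i1: "smooth_on UNIV i1" and i2: "smooth_on UNIV i2"
    unfolding i1_def i2_def by (auto intro!: smooth_on_Pair smooth_on_const smooth_on_ident)
  define R1 where "R1 = {y \<in> UNIV. i1 y \<in> S1}"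
  have R1: "open R1"
    unfolding R1_def using smooth_on_vimage_open[OF i1 smooth_onD_open[OF f1]] .
  have s1: "smooth_on R1 (\<lambda>y. f1 (i1 y))"
    by (rule smooth_on_compose[OF smooth_on_subset[OF i1 R1] f1]) (auto simp: R1_def)
  have s2: "smooth_on R1 (\<lambda>y. i2 (f1 (i1 y)))"
    by (rule smooth_on_compose[OF s1 i2]) auto
  define S where "S = {y \<in> R1. i2 (f1 (i1 y)) \<in> S2}"
  have S: "open S"
    unfolding S_def using smooth_on_vimage_open[OF s2 smooth_onD_open[OF f2]] .
  have s3: "smooth_on S (\<lambda>y. f2 (i2 (f1 (i1 y))))"
    by (rule smooth_on_compose[OF smooth_on_subset[OF s2 S] f2]) (auto simp: S_def)
  have val: "chart_inv \<mu> (f1 (i1 y)) = a \<otimes> pt y" "y \<in> U" "f2 (i2 (f1 (i1 y))) = cnj a y" if "y \<in> R1" for y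
    using that by (auto simp: R1_def S1_def f1_def i1_def i2_def f2_def cnj_def U_def
        chart_inv_left[OF \<mu>(1)] chart_inv_left[OF \<eta>(1)] \<mu>(2) \<eta>(2))
  show ?thesis
  proof
    show "smooth_on S (cnj a)"
      by (rule smooth_on_cong[OF s3]) (auto simp: S_def val)
    show "S \<subseteq> U" using val by (auto simp: S_def)
    have "org \<in> R1" using org_U \<mu> a
      by (auto simp: R1_def i1_def S1_def U_def chart_inv_left[OF \<mu>(1)])
    moreover have "i2 (f1 (i1 org)) \<in> S2"
      using \<mu> \<eta> a one_dom by (auto simp: S2_def i2_def f1_def i1_def
          chart_inv_left[OF \<mu>(1)] chart_inv_left[OF \<eta>(1)])
    ultimately show "org \<in> S" by (simp add: S_def)
    fix y assume y: "y \<in> S"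
    then have "i2 (f1 (i1 y)) \<in> S2" "y \<in> R1" by (auto simp: S_def)
    then show "a \<otimes> pt y \<otimes> inv a \<in> fst \<kappa>"
      using val(1)[of y] by (auto simp: S2_def i2_def chart_inv_left[OF \<eta>(1)] \<eta>(2))
  qed
qed

lemma linear_Ad: assumes "a \<in> carrier G" shows "linear (Ad G \<kappa> a)"
proof -
  obtain S where "smooth_on S (cnj a)" "org \<in> S" using smooth_cnj[OF assms] .
  from smooth_on_linear_D[OF this] show ?thesis unfolding Ad_cnj[abs_def] .
qed

lemma Ad_one: "Ad G \<kappa> \<one> v = v"
proof -
  have "D (cnj \<one>) org v = D (\<lambda>x. x) org v"
    using D_cong[OF open_U org_U, of "cnj \<one>" "\<lambda>x. x"] by (auto simp: cnj_def)
  then show ?thesis by (simp add: Ad_cnj)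
qed

lemma Ad_mult:
  assumes a: "a \<in> carrier G" and b: "b \<in> carrier G"
  shows "Ad G \<kappa> (a \<otimes> b) v = Ad G \<kappa> a (Ad G \<kappa> b v)"
proof -
  obtain S where S: "smooth_on S (cnj a)" "org \<in> S" "S \<subseteq> U"
    "\<And>y. y \<in> S \<Longrightarrow> a \<otimes> pt y \<otimes> inv a \<in> fst \<kappa>" using smooth_cnj[OF a] by blast
  obtain R where R: "smooth_on R (cnj b)" "org \<in> R" "R \<subseteq> U"
    "\<And>y. y \<in> R \<Longrightarrow> b \<otimes> pt y \<otimes> inv b \<in> fst \<kappa>" using smooth_cnj[OF b] by blast
  have "cnj (a \<otimes> b) y = cnj a (cnj b y)" if "y \<in> R" for y
  proof -
    have "y \<in> U" using R(3) that by auto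
    then have "pt y \<in> carrier G" by simp
    moreover have "pt (cnj b y) = b \<otimes> pt y \<otimes> inv b" using R(4)[OF that] by (simp add: cnj_def)
    ultimately show ?thesis using a b by (simp add: cnj_def m_assoc inv_mult_group)
  qed
  then have "D (cnj (a \<otimes> b)) org v = D (\<lambda>y. cnj a (cnj b y)) org v"
    using D_cong[OF smooth_onD_open[OF R(1)] R(2), of "cnj (a \<otimes> b)" "\<lambda>y. cnj a (cnj b y)"] by auto
  also have "\<dots> = D (cnj a) org (D (cnj b) org v)"
    using D_compose[OF R(1) S(1) R(2)] S(2) b by simp
  finally show ?thesis by (simp add: Ad_cnj)
qed

lemma Ad_inv: "a \<in> carrier G \<Longrightarrow> Ad G \<kappa> (inv a) (Ad G \<kappa> a v) = v"
    "a \<in> carrier G \<Longrightarrow> Ad G \<kappa> a (Ad G \<kappa> (inv a) v) = v"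
  by (simp_all add: Ad_mult[symmetric] Ad_one)

text \<open>Conjugation \<open>C\<close> is a homomorphism. The mixed second derivative of \<open>C (x y) = C x C y\<close> at the
  identity says that \<open>beta\<close> is preserved up to the second derivative of \<open>C\<close>; that one is symmetric
  and disappears in the bracket.\<close>

lemma Ad_bracket:
  assumes a: "a \<in> carrier G"
  shows "Ad G \<kappa> a (br u v) = br (Ad G \<kappa> a u) (Ad G \<kappa> a v)"
proof -
  obtain S where S: "smooth_on S (cnj a)" "org \<in> S" "S \<subseteq> U"
    "\<And>y. y \<in> S \<Longrightarrow> a \<otimes> pt y \<otimes> inv a \<in> fst \<kappa>" using smooth_cnj[OF a] by blast
  note oS = smooth_onD_open[OF S(1)]
  define C where "C p = (cnj a (fst p), cnj a (snd p))" for p :: "'a \<times> 'a"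
  define W where "W = {p \<in> mul_dom. mul p \<in> S} \<inter> S \<times> S"
  have W: "open W" unfolding W_def
    by (intro open_Int smooth_on_vimage_open[OF smooth_mul] open_Times oS)
  have o: "(org, org) \<in> W" using org2 S(2) unit_right[OF org_U] by (simp add: W_def)
  have sfst: "smooth_on W (\<lambda>p. cnj a (fst p))" and ssnd: "smooth_on W (\<lambda>p. cnj a (snd p))"
    by (rule smooth_on_compose[OF smooth_on_linear[OF W bounded_linear_fst] S(1)],
        force simp: W_def,
        rule smooth_on_compose[OF smooth_on_linear[OF W bounded_linear_snd] S(1)],
        force simp: W_def)
  have sC: "smooth_on W C" unfolding C_def by (intro smooth_on_Pair sfst ssnd)
  have smW: "smooth_on W mul" by (rule smooth_on_subset[OF smooth_mul W]) (auto simp: W_def)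
  have CW: "C p \<in> mul_dom" "cnj a (mul p) = mul (C p)" if p: "p \<in> W" for p
  proof -
    have 1: "fst p \<in> S" "snd p \<in> S" "p \<in> mul_dom" "mul p \<in> S" using p by (auto simp: W_def)
    have 2: "pt (cnj a y) = a \<otimes> pt y \<otimes> inv a" "cnj a y \<in> U" "pt y \<in> carrier G" if "y \<in> S" for y
      using S that by (auto simp: cnj_def)
    have cancel: "inv a \<otimes> (a \<otimes> w) = w" if "w \<in> carrier G" for w
      using a that by (simp add: m_assoc[symmetric])
    have 3: "pt (cnj a (fst p)) \<otimes> pt (cnj a (snd p)) = a \<otimes> pt (mul p) \<otimes> inv a"
      using 1 2 a mul_domD(4)[OF 1(3)] cancel by (simp add: m_assoc)
    then show "C p \<in> mul_dom" using 1 2 S(4)[OF 1(4)] by (simp add: mul_dom_def C_def)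
    show "cnj a (mul p) = mul (C p)" using 3 by (simp add: C_def mul_def[of "(_, _)"] cnj_def[of a "mul p"])
  qed
  have lin: "linear (D (cnj a) org)" using smooth_on_linear_D[OF S(1,2)] .
  have DC: "D C (org, org) w = (D (cnj a) org (fst w), D (cnj a) org (snd w))" for w
    unfolding C_def using D_prod_map[OF S(1), of "(org, org)"] S(2) by simp
  have D2C: "D2 C (org, org) (0, v) (u, 0) = 0" for u v
    unfolding C_def using D2_prod_map[OF S(1), of "(org, org)"] S(2) by simp
  have key: "D2 (cnj a) org v u + Ad G \<kappa> a (beta u v) = beta (Ad G \<kappa> a u) (Ad G \<kappa> a v)" for u v
  proof -
    have oo: "mul (org, org) = org" "C (org, org) = (org, org)"
      using unit_right[OF org_U] a by (simp_all add: C_def)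
    have "D2 (\<lambda>p. cnj a (mul p)) (org, org) (0, v) (u, 0) = D2 (\<lambda>p. mul (C p)) (org, org) (0, v) (u, 0)"
      by (subst D2_cong[OF W o, of _ "\<lambda>p. mul (C p)"]) (simp_all add: CW)
    moreover have "D2 (\<lambda>p. cnj a (mul p)) (org, org) (0, v) (u, 0) =
        D2 (cnj a) org v u + D (cnj a) org (beta u v)"
      by (subst D2_compose[OF smW S(1) o]) (auto simp: W_def oo D_mul beta_def)
    moreover have "D2 (\<lambda>p. mul (C p)) (org, org) (0, v) (u, 0) =
        beta (D (cnj a) org u) (D (cnj a) org v)"
      by (subst D2_compose[OF sC smooth_mul o])
        (auto simp: oo DC D2C linear_0[OF lin] CW beta_def
          linear_0[OF smooth_on_linear_D[OF smooth_mul org2]])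
    ultimately show ?thesis by (simp add: Ad_cnj)
  qed
  have "br (Ad G \<kappa> a u) (Ad G \<kappa> a v) =
      (D2 (cnj a) org v u + Ad G \<kappa> a (beta u v)) - (D2 (cnj a) org u v + Ad G \<kappa> a (beta v u))"
    unfolding bracket_beta key ..
  also have "\<dots> = Ad G \<kappa> a (beta u v) - Ad G \<kappa> a (beta v u)"
    using D2_commute[OF S(1,2), of u v] by simp
  also have "\<dots> = Ad G \<kappa> a (br u v)"
    by (simp add: bracket_beta linear_diff[OF linear_Ad[OF a]])
  finally show ?thesis ..
qed


text \<open>Conjugation as a function of both the conjugating and the conjugated point; its mixed second
  derivative at the identity is the derivative of \<open>Ad\<close> there.\<close>

definition cnj2 :: "'a \<times> 'a \<Rightarrow> 'a" where "cnj2 p = cnj (pt (fst p)) (snd p)"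
definition cnj2_dom :: "('a \<times> 'a) set" where
  "cnj2_dom = {p \<in> {p \<in> mul_dom. fst p \<in> ivt_dom}. (mul p, ivt (fst p)) \<in> mul_dom}"

lemma smooth_cnj2: "smooth_on cnj2_dom cnj2"
proof -
  define W where "W = {p \<in> mul_dom. fst p \<in> ivt_dom}"
  have W: "open W" unfolding W_def
    by (intro smooth_on_vimage_open[OF smooth_on_linear[OF open_mul_dom bounded_linear_fst]] open_ivt_dom)
  have s1: "smooth_on W (\<lambda>p. (mul p, ivt (fst p)))"
    by (intro smooth_on_Pair smooth_on_subset[OF smooth_mul W]
        smooth_on_compose[OF smooth_on_linear[OF W bounded_linear_fst] smooth_ivt]) (auto simp: W_def)
  have o: "open cnj2_dom" unfolding cnj2_dom_def W_def[symmetric]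
    using smooth_on_vimage_open[OF s1 open_mul_dom] .
  have s2: "smooth_on cnj2_dom (\<lambda>p. mul (mul p, ivt (fst p)))"
    by (rule smooth_on_compose[OF smooth_on_subset[OF s1 o] smooth_mul]) (auto simp: cnj2_dom_def W_def)
  show ?thesis
  proof (rule smooth_on_cong[OF s2])
    fix p assume "p \<in> cnj2_dom"
    then have p: "p \<in> mul_dom" "fst p \<in> ivt_dom" by (auto simp: cnj2_dom_def)
    then show "mul (mul p, ivt (fst p)) = cnj2 p"
      by (simp add: cnj2_def cnj_def mul_def[of "(_, _)"] ivt_domD mul_domD)
  qed
qed

lemma cnj2_org: "x \<in> ivt_dom \<Longrightarrow> (x, org) \<in> cnj2_dom" "x \<in> U \<Longrightarrow> cnj2 (x, org) = org"
  by (auto simp: cnj2_dom_def unit_right mul_ivt cnj2_def ivt_domD(1))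

lemma Ad_pt: "x \<in> ivt_dom \<Longrightarrow> Ad G \<kappa> (pt x) v = D cnj2 (x, org) (0, v)"
  using D_second[OF smooth_cnj2 cnj2_org(1), of x v] by (simp add: Ad_cnj cnj2_def)

lemma D_cnj2_first: assumes x: "x \<in> ivt_dom" shows "D cnj2 (x, org) (u, 0) = 0"
proof -
  have "D (\<lambda>x. cnj2 (x, org)) x u = D (\<lambda>x. org) x u"
    using D_cong[OF open_ivt_dom x, of "\<lambda>x. cnj2 (x, org)" "\<lambda>x. org"] cnj2_org(2) ivt_domD by auto
  then show ?thesis using D_first[OF smooth_cnj2 cnj2_org(1)[OF x], of u] by simp
qed

text \<open>Differentiate \<open>(x y x\<^sup>-\<^sup>1) x = x y\<close> once in \<open>y\<close> and once in \<open>x\<close>: the left-hand side gives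
  \<open>beta v u\<close> plus the derivative in question, the right-hand side \<open>beta u v\<close>.\<close>

lemma D2_cnj2: "D2 cnj2 (org, org) (0, v) (u, 0) = br u v"
proof -
  have o: "(org, org) \<in> cnj2_dom" using cnj2_org(1)[OF org_ivt(1)] .
  note W = smooth_onD_open[OF smooth_cnj2]
  define C where "C p = (cnj2 p, fst p)" for p
  have sf: "smooth_on cnj2_dom fst" by (rule smooth_on_linear[OF W bounded_linear_fst])
  have sC: "smooth_on cnj2_dom C" unfolding C_def by (intro smooth_on_Pair smooth_cnj2 sf)
  have CW: "C p \<in> mul_dom" "mul (C p) = mul p" if "p \<in> cnj2_dom" for p
  proof -
    have p: "p \<in> mul_dom" "fst p \<in> ivt_dom" "(mul p, ivt (fst p)) \<in> mul_dom"
      using that by (auto simp: cnj2_dom_def)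
    have U: "fst p \<in> U" "snd p \<in> U" using mul_domD p by auto
    have c: "cnj2 p = mul (mul p, ivt (fst p))" using p
      by (simp add: cnj2_def cnj_def mul_def[of "(_, _)"] ivt_domD mul_domD)
    have 1: "pt (cnj2 p) = pt (fst p) \<otimes> pt (snd p) \<otimes> inv (pt (fst p))" "cnj2 p \<in> U"
      unfolding c using p mul_domD ivt_domD by auto
    have 2: "pt (cnj2 p) \<otimes> pt (fst p) = pt (fst p) \<otimes> pt (snd p)"
      unfolding 1 using U by (simp add: m_assoc)
    show "C p \<in> mul_dom" using 1 2 U p(1) by (simp add: C_def mul_dom_def)
    show "mul (C p) = mul p" using 2 by (simp add: C_def mul_def)
  qed
  have DC: "D C (org, org) w = (D cnj2 (org, org) w, fst w)" for w
    unfolding C_def using smooth_on_differentiable[OF smooth_cnj2 o] smooth_on_differentiable[OF sf o]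
    by (subst D_Pair) (auto simp: D_bounded_linear bounded_linear_fst)
  have Dc: "D cnj2 (org, org) (0, v) = v" for v
    using Ad_pt[OF org_ivt(1)] by (simp add: Ad_one)
  have "D2 (\<lambda>p. mul (C p)) (org, org) (0, v) (u, 0) = D2 mul (org, org) (0, v) (u, 0)"
    by (subst D2_cong[OF W o, of _ mul]) (simp_all add: CW)
  moreover have "D2 (\<lambda>p. mul (C p)) (org, org) (0, v) (u, 0) =
     D2 mul (org, org) (v, 0) (0, u) + D mul (org, org) (D2 cnj2 (org, org) (0, v) (u, 0), 0)"
  proof (subst D2_compose[OF sC smooth_mul o])
    show "C ` cnj2_dom \<subseteq> mul_dom" using CW(1) by blast
    have "D2 C (org, org) (0, v) (u, 0) = (D2 cnj2 (org, org) (0, v) (u, 0), 0)"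
      unfolding C_def by (simp add: D2_Pair[OF smooth_cnj2 sf o] D2_bounded_linear bounded_linear_fst)
    moreover have "C (org, org) = (org, org)" by (simp add: C_def cnj2_org org_U)
    ultimately show "D2 mul (C (org, org)) (D C (org, org) (0, v)) (D C (org, org) (u, 0)) +
        D mul (C (org, org)) (D2 C (org, org) (0, v) (u, 0)) =
      D2 mul (org, org) (v, 0) (0, u) + D mul (org, org) (D2 cnj2 (org, org) (0, v) (u, 0), 0)"
      by (simp add: DC Dc D_cnj2_first[OF org_ivt(1)])
  qed
  ultimately have "beta u v = D2 mul (org, org) (v, 0) (0, u) + D2 cnj2 (org, org) (0, v) (u, 0)"
    by (simp add: D_mul beta_def)
  then show ?thesis
    using D2_commute[OF smooth_mul org2, of "(v, 0)" "(0, u)"] by (simp add: bracket_beta beta_def)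
qed

lemma D_Ad_pt:
  "((\<lambda>x. Ad G \<kappa> (pt x) v) has_derivative (\<lambda>u. br u v)) (at org)"
proof -
  have "((\<lambda>x. D cnj2 (x, org) (0, v)) has_derivative (\<lambda>u. D2 cnj2 (org, org) (0, v) (u, 0))) (at org)"
  proof (rule has_derivative_compose[where f = "\<lambda>x. (x, org)" and f' = "\<lambda>u. (u, 0)"])
    show "((\<lambda>x. (x, org)) has_derivative (\<lambda>u. (u, 0))) (at org)"
      by (auto intro!: derivative_eq_intros)
  qed (rule smooth_on_has_D2[OF smooth_cnj2 cnj2_org(1)[OF org_ivt(1)]])
  then have "((\<lambda>x. D cnj2 (x, org) (0, v)) has_derivative (\<lambda>u. br u v)) (at org)"
    by (simp add: D2_cnj2)
  then show ?thesis
    by (rule has_derivative_transform_within_open[OF _ open_ivt_dom org_ivt(1)]) (simp add: Ad_pt)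
qed

lemma Ad_curve_derivative:
  assumes \<gamma>: "\<And>t. \<gamma> t \<in> fst \<kappa>" "\<gamma> 0 = \<one>"
    and z: "((\<lambda>t::real. crd (\<gamma> t)) has_vector_derivative z) (at 0)"
  shows "((\<lambda>t. Ad G \<kappa> (\<gamma> t) v) has_vector_derivative br z v) (at 0)"
proof -
  have "((\<lambda>t. Ad G \<kappa> (pt (crd (\<gamma> t))) v) has_derivative (\<lambda>h. br (h *\<^sub>R z) v)) (at 0)"
    using has_derivative_compose[OF z[unfolded has_vector_derivative_def], of "\<lambda>x. Ad G \<kappa> (pt x) v"]
      D_Ad_pt[of v] \<gamma>(2) by simp
  then show ?thesis
    by (simp add: has_vector_derivative_def \<gamma> br_simps)
qed

end


section \<open>Symmetric bilinear forms\<close>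

definition symmetric_form :: "('a::real_vector \<Rightarrow> 'a \<Rightarrow> real) \<Rightarrow> bool" where
  "symmetric_form g \<longleftrightarrow> bilinear g \<and> (\<forall>x y. g x y = g y x)"

definition pos_def_on :: "'a::real_vector set \<Rightarrow> ('a \<Rightarrow> 'a \<Rightarrow> real) \<Rightarrow> bool" where
  "pos_def_on P g \<longleftrightarrow> (\<forall>x\<in>P. x \<noteq> 0 \<longrightarrow> 0 < g x x)"

lemma symmetric_formD: "symmetric_form g \<Longrightarrow> bilinear g" "symmetric_form g \<Longrightarrow> g x y = g y x"
  by (auto simp: symmetric_form_def)

lemma bilinear_linear: "bilinear g \<Longrightarrow> linear (g x)" "bilinear g \<Longrightarrow> linear (\<lambda>x. g x y)"
  by (auto simp: bilinear_def)

lemmas bilinear_simps = bilinear_ladd bilinear_radd bilinear_lsub bilinear_rsub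
  bilinear_lmul bilinear_rmul bilinear_lneg bilinear_rneg bilinear_lzero bilinear_rzero

lemma bilinear_sum_left: "bilinear g \<Longrightarrow> g (\<Sum>i\<in>I. f i) y = (\<Sum>i\<in>I. g (f i) y)"
  using linear_sum[OF bilinear_linear(2)] .

lemma bilinear_sum_right: "bilinear g \<Longrightarrow> g y (\<Sum>i\<in>I. f i) = (\<Sum>i\<in>I. g y (f i))"
  using linear_sum[OF bilinear_linear(1)] .

lemma onbD:
  assumes "orthonormal_basis_on P g E"
  shows "E \<subseteq> P" "span E = P" "x \<in> E \<Longrightarrow> y \<in> E \<Longrightarrow> g x y = (if x = y then 1 else 0)"
  using assms by (auto simp: orthonormal_basis_on_def)

lemma onb_independent:
  assumes g: "bilinear g" and E: "orthonormal_basis_on P g E"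
  shows "independent E"
proof
  assume "dependent E"
  then obtain e where e: "e \<in> E" "e \<in> span (E - {e})" by (auto simp: dependent_def)
  have "subspace {x. g x e = 0}"
    by (auto simp: subspace_def bilinear_simps[OF g])
  then have "span (E - {e}) \<subseteq> {x. g x e = 0}"
    using onbD(3)[OF E] e(1) by (intro span_minimal) auto
  with e onbD(3)[OF E, of e e] show False by auto
qed

lemma onb_finite:
  fixes g :: "'a::euclidean_space \<Rightarrow> 'a \<Rightarrow> real"
  shows "bilinear g \<Longrightarrow> orthonormal_basis_on P g E \<Longrightarrow> finite E"
  using onb_independent independent_imp_finite by blast

lemma onb_expansion:
  fixes g :: "'a::euclidean_space \<Rightarrow> 'a \<Rightarrow> real"
  assumes g: "bilinear g" and E: "orthonormal_basis_on P g E" and x: "x \<in> P"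
  shows "x = (\<Sum>e\<in>E. g x e *\<^sub>R e)"
proof -
  have fin: "finite E" using onb_finite[OF g E] .
  have lin: "linear (\<lambda>x. \<Sum>e\<in>E. g x e *\<^sub>R e)"
    by (auto simp: linear_iff bilinear_simps[OF g] scaleR_add_left sum.distrib scaleR_sum_right)
  have "subspace {x. x = (\<Sum>e\<in>E. g x e *\<^sub>R e)}"
    using linear_0[OF lin] linear_add[OF lin] linear_scale[OF lin] by (simp add: subspace_def)
  moreover have "E \<subseteq> {x. x = (\<Sum>e\<in>E. g x e *\<^sub>R e)}"
  proof
    fix f assume f: "f \<in> E"
    have "(\<Sum>e\<in>E. g f e *\<^sub>R e) = (\<Sum>e\<in>E. if e = f then f else 0)"
      using onbD(3)[OF E f] by (intro sum.cong) auto
    then show "f \<in> {x. x = (\<Sum>e\<in>E. g x e *\<^sub>R e)}" using fin f by simp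
  qed
  ultimately have "span E \<subseteq> {x. x = (\<Sum>e\<in>E. g x e *\<^sub>R e)}" by (intro span_minimal)
  then show ?thesis using x onbD(2)[OF E] by blast
qed

lemma onb_parseval:
  fixes g :: "'a::euclidean_space \<Rightarrow> 'a \<Rightarrow> real"
  assumes g: "bilinear g" and E: "orthonormal_basis_on P g E" and x: "x \<in> P"
  shows "g x y = (\<Sum>e\<in>E. g x e * g e y)"
  by (subst onb_expansion[OF g E x]) (simp add: bilinear_sum_left[OF g] bilinear_simps[OF g])

text \<open>Expanding \<open>L e\<close> in \<open>F\<close> and exchanging the sums, the vectors \<open>g f e *\<^sub>R e\<close> recombine to \<open>f\<close>.\<close>

lemma trace_change_basis:
  fixes g g' :: "'a::euclidean_space \<Rightarrow> 'a \<Rightarrow> real"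
  assumes g: "symmetric_form g" and E: "orthonormal_basis_on P g E"
    and g': "symmetric_form g'" and F: "orthonormal_basis_on P g' F"
    and L: "linear L" "\<And>x. x \<in> P \<Longrightarrow> L x \<in> P"
  shows "(\<Sum>e\<in>E. g (L e) e) = (\<Sum>f\<in>F. g' (L f) f)"
proof -
  note bg = symmetric_formD(1)[OF g] and bg' = symmetric_formD(1)[OF g']
  have "(\<Sum>e\<in>E. g (L e) e) = (\<Sum>e\<in>E. \<Sum>f\<in>F. g' (L e) f * g f e)"
  proof (rule sum.cong[OF refl])
    fix e assume "e \<in> E"
    then have "L e \<in> P" using L(2) onbD(1)[OF E] by auto
    from arg_cong[OF onb_expansion[OF bg' F this], of "\<lambda>y. g y e"]
    show "g (L e) e = (\<Sum>f\<in>F. g' (L e) f * g f e)"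
      by (simp add: bilinear_sum_left[OF bg] bilinear_simps[OF bg])
  qed
  also have "\<dots> = (\<Sum>f\<in>F. \<Sum>e\<in>E. g' (L e) f * g f e)" by (rule sum.swap)
  also have "\<dots> = (\<Sum>f\<in>F. g' (L f) f)"
  proof (rule sum.cong[OF refl])
    fix f assume "f \<in> F"
    then have "f \<in> P" using onbD(1)[OF F] by auto
    from arg_cong[OF onb_expansion[OF bg E this], of "\<lambda>y. g' (L y) f"]
    show "(\<Sum>e\<in>E. g' (L e) f * g f e) = g' (L f) f"
      by (simp add: linear_sum[OF L(1)] linear_scale[OF L(1)] bilinear_sum_left[OF bg']
          bilinear_simps[OF bg'] mult.commute)
  qed
  finally show ?thesis .
qed

lemma form_trace_change_basis:
  fixes g b :: "'a::euclidean_space \<Rightarrow> 'a \<Rightarrow> real"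
  assumes g: "symmetric_form g" and E: "orthonormal_basis_on P g E"
    and F: "orthonormal_basis_on P g F" and b: "bilinear b"
  shows "(\<Sum>e\<in>E. b e e) = (\<Sum>f\<in>F. b f f)"
proof -
  note bg = symmetric_formD(1)[OF g]
  have "(\<Sum>e\<in>E. b e e) = (\<Sum>e\<in>E. \<Sum>f\<in>F. g e f * b f e)"
  proof (rule sum.cong[OF refl])
    fix e assume "e \<in> E"
    then have "e \<in> P" using onbD(1)[OF E] by auto
    from arg_cong[OF onb_expansion[OF bg F this], of "\<lambda>y. b y e"]
    show "b e e = (\<Sum>f\<in>F. g e f * b f e)"
      by (simp add: bilinear_sum_left[OF b] bilinear_simps[OF b])
  qed
  also have "\<dots> = (\<Sum>f\<in>F. \<Sum>e\<in>E. g e f * b f e)" by (rule sum.swap)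
  also have "\<dots> = (\<Sum>f\<in>F. b f f)"
  proof (rule sum.cong[OF refl])
    fix f assume "f \<in> F"
    then have "f \<in> P" using onbD(1)[OF F] by auto
    from arg_cong[OF onb_expansion[OF bg E this], of "\<lambda>y. b f y"]
    show "(\<Sum>e\<in>E. g e f * b f e) = b f f"
      by (simp add: bilinear_sum_right[OF b] bilinear_simps[OF b] symmetric_formD(2)[OF g, of f])
  qed
  finally show ?thesis .
qed

lemma symmetric_form_inner: "symmetric_form (\<lambda>x y::'a::euclidean_space. x \<bullet> y)"
  by (auto simp: symmetric_form_def inner_commute bilinear_conv_bounded_bilinear bounded_bilinear_inner)

lemma onb_Basis: "orthonormal_basis_on UNIV (\<lambda>x y::'a::euclidean_space. x \<bullet> y) Basis"
  by (auto simp: orthonormal_basis_on_def inner_Basis)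

lemma linear_trace_onb:
  assumes "symmetric_form g" "orthonormal_basis_on UNIV g E" "linear L"
  shows "linear_trace L = (\<Sum>e\<in>E. g (L e) e)"
  unfolding linear_trace_def
  using trace_change_basis[OF symmetric_form_inner onb_Basis assms] by auto

lemma linear_trace_cyclic:
  fixes f h :: "'a::euclidean_space \<Rightarrow> 'a"
  assumes f: "linear f" and h: "linear h"
  shows "linear_trace (\<lambda>x. f (h x)) = linear_trace (\<lambda>x. h (f x))"
proof -
  have 1: "linear_trace (\<lambda>x. f (h x)) = (\<Sum>b\<in>Basis. \<Sum>c\<in>Basis. (h b \<bullet> c) * (f c \<bullet> b))"
    if f: "linear f" and h: "linear h" for f h :: "'a \<Rightarrow> 'a"
  proof -
    have "f (h b) \<bullet> b = (\<Sum>c\<in>Basis. (h b \<bullet> c) * (f c \<bullet> b))" for b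
      using linear_expansion[OF f, of "h b"] by (simp add: inner_sum_left)
    then show ?thesis by (simp add: linear_trace_def)
  qed
  show ?thesis
    unfolding 1[OF f h] 1[OF h f] by (subst sum.swap) (simp add: mult.commute)
qed

lemma bilinear_continuous:
  fixes b :: "'a::euclidean_space \<Rightarrow> 'a \<Rightarrow> real"
  assumes "bilinear b" shows "continuous_on S (\<lambda>x. b x x)"
  using assms unfolding bilinear_conv_bounded_bilinear
  by (rule bounded_bilinear.continuous_on) (auto intro: continuous_intros)

text \<open>If \<open>\<mu>\<close> is the maximum of the Rayleigh quotient \<open>b x x / g x x\<close>, attained at \<open>m\<close>, then
  \<open>\<mu> g - b\<close> is positive semidefinite and vanishes on \<open>m\<close>, so \<open>m\<close> is in its radical.\<close>

lemma ex_maximal_eigenvector: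
  fixes g b :: "'a::euclidean_space \<Rightarrow> 'a \<Rightarrow> real"
  assumes P: "subspace P" "P \<noteq> {0}" and g: "symmetric_form g" "pos_def_on P g"
    and b: "symmetric_form b"
  obtains e \<mu> where "e \<in> P" "g e e = 1" "\<And>x. x \<in> P \<Longrightarrow> b e x = \<mu> * g e x"
proof -
  note bg = symmetric_formD(1)[OF g(1)] and bb = symmetric_formD(1)[OF b]
  define S where "S = P \<inter> sphere 0 1"
  have comp: "compact S" unfolding S_def
    by (intro closed_Int_compact closed_subspace P compact_sphere)
  obtain x0 where x0: "x0 \<in> P" "x0 \<noteq> 0" using P subspace_0 by blast
  then have "(1 / norm x0) *\<^sub>R x0 \<in> S" using P by (auto simp: S_def subspace_scale)
  then have ne: "S \<noteq> {}" by auto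
  have pos: "g x x > 0" if "x \<in> P" "x \<noteq> 0" for x using g(2) that by (auto simp: pos_def_on_def)
  then have cont: "continuous_on S (\<lambda>x. b x x / g x x)"
    by (intro continuous_intros bilinear_continuous bb bg) (force simp: S_def)
  obtain m where m: "m \<in> S" "\<And>x. x \<in> S \<Longrightarrow> b x x / g x x \<le> b m m / g m m"
    using continuous_attains_sup[OF comp ne cont] by blast
  have mP: "m \<in> P" "m \<noteq> 0" using m(1) by (auto simp: S_def)
  define \<mu> where "\<mu> = b m m / g m m"
  define q where "q x y = \<mu> * g x y - b x y" for x y
  have q: "bilinear q" unfolding q_def
    by (auto simp: bilinear_def linear_iff bilinear_simps[OF bg] bilinear_simps[OF bb] algebra_simps)
  have qs: "q x y = q y x" for x y
    using symmetric_formD(2)[OF g(1)] symmetric_formD(2)[OF b] by (simp add: q_def)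
  have q0: "q x x \<ge> 0" if x: "x \<in> P" for x
  proof (cases "x = 0")
    case True then show ?thesis by (simp add: bilinear_simps[OF q])
  next
    case False
    define y where "y = (1 / norm x) *\<^sub>R x"
    have "y \<in> S" using False x P by (auto simp: S_def y_def subspace_scale)
    then have "b y y / g y y \<le> \<mu>" using m(2) by (simp add: \<mu>_def)
    moreover have "b y y / g y y = b x x / g x x" using False
      by (simp add: y_def bilinear_simps[OF bb] bilinear_simps[OF bg])
    ultimately show ?thesis using pos[OF x False] by (simp add: q_def divide_simps mult.commute)
  qed
  have qm: "q m m = 0" using pos[OF mP] by (simp add: q_def \<mu>_def)
  have ortho: "q m y = 0" if y: "y \<in> P" for y
  proof (rule ccontr)
    assume ne: "q m y \<noteq> 0"
    (* the minimiser of 2 t q(m,y) + t^2 (1 + q(y,y)); the 1 keeps the denominator positive *)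
    define t where "t = - q m y / (1 + q y y)"
    have pos1: "1 + q y y > 0" using q0[OF y] by simp
    have "m + t *\<^sub>R y \<in> P" using mP y P by (simp add: subspace_add subspace_scale)
    then have "0 \<le> q (m + t *\<^sub>R y) (m + t *\<^sub>R y)" by (rule q0)
    also have "\<dots> = 2 * t * q m y + t * t * q y y"
      by (simp add: bilinear_simps[OF q] qm qs[of y m] algebra_simps)
    also have "\<dots> \<le> 2 * t * q m y + t * t * (1 + q y y)" by (simp add: algebra_simps)
    also have "t * t * (1 + q y y) = - t * q m y" using pos1 by (simp add: t_def)
    also have "2 * t * q m y + - t * q m y = - (q m y)\<^sup>2 / (1 + q y y)"
      by (simp add: t_def power2_eq_square)
    also have "\<dots> < 0" using ne pos1 by simp
    finally show False by simp
  qed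
  show ?thesis
  proof
    define s where "s = sqrt (g m m)"
    have s: "s > 0" "s * s = g m m" using pos[OF mP] by (auto simp: s_def)
    show "(1 / s) *\<^sub>R m \<in> P" using mP P by (simp add: subspace_scale)
    show "g ((1 / s) *\<^sub>R m) ((1 / s) *\<^sub>R m) = 1"
      using s by (simp add: bilinear_simps[OF bg] s(2)[symmetric])
    fix x assume "x \<in> P"
    from ortho[OF this] show "b ((1 / s) *\<^sub>R m) x = \<mu> * g ((1 / s) *\<^sub>R m) x"
      by (simp add: q_def bilinear_simps[OF bg] bilinear_simps[OF bb])
  qed
qed

text \<open>The form \<open>b\<close> maps the \<open>g\<close>-orthogonal complement of an eigenvector to functionals that vanish on
  that eigenvector, so the dimension can be lowered.\<close>

theorem simultaneous_diagonalization:
  fixes g b :: "'a::euclidean_space \<Rightarrow> 'a \<Rightarrow> real"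
  assumes "subspace P" and g: "symmetric_form g" "pos_def_on P g" and b: "symmetric_form b"
  shows "\<exists>E \<mu>. orthonormal_basis_on P g E \<and> (\<forall>e\<in>E. \<forall>x\<in>P. b e x = \<mu> e * g e x)"
  using assms(1) g(2)
proof (induction "dim P" arbitrary: P rule: less_induct)
  case less
  note bg = symmetric_formD(1)[OF g(1)]
  show ?case
  proof (cases "P = {0}")
    case True
    then have "orthonormal_basis_on P g {}" by (simp add: orthonormal_basis_on_def)
    then show ?thesis by blast
  next
    case False
    obtain e \<mu> where e: "e \<in> P" "g e e = 1" "\<And>x. x \<in> P \<Longrightarrow> b e x = \<mu> * g e x"
      using ex_maximal_eigenvector[OF less.prems(1) False g(1) less.prems(2) b] by blast
    define R where "R = {x \<in> P. g e x = 0}"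
    have R: "subspace R" using less.prems(1)
      by (auto simp: R_def subspace_def bilinear_simps[OF bg])
    have "e \<notin> R" using e(2) by (simp add: R_def)
    then have "R \<subset> P" using e(1) by (auto simp: R_def)
    then have "dim R < dim P"
      using R less.prems(1) dim_psubset by (metis span_eq_iff)
    moreover have "pos_def_on R g" using less.prems(2) by (auto simp: R_def pos_def_on_def)
    ultimately obtain E \<nu> where E: "orthonormal_basis_on R g E"
      "\<And>f x. f \<in> E \<Longrightarrow> x \<in> R \<Longrightarrow> b f x = \<nu> f * g f x"
      using less.hyps R by blast
    have eE: "e \<notin> E" using onbD(1)[OF E(1)] e(2) by (auto simp: R_def)
    have split: "x - g e x *\<^sub>R e \<in> R" if "x \<in> P" for x
      using that e less.prems(1)
      by (auto simp: R_def subspace_diff subspace_scale bilinear_simps[OF bg])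
    have "orthonormal_basis_on P g (insert e E)"
      unfolding orthonormal_basis_on_def
    proof (intro conjI ballI)
      show "insert e E \<subseteq> P" using e(1) onbD(1)[OF E(1)] by (auto simp: R_def)
      then have "span (insert e E) \<subseteq> P" using less.prems(1) by (rule span_minimal)
      moreover have "P \<subseteq> span (insert e E)"
      proof
        fix x assume "x \<in> P"
        from split[OF this] have "x - g e x *\<^sub>R e \<in> span E" using onbD(2)[OF E(1)] by simp
        then show "x \<in> span (insert e E)" unfolding span_insert by blast
      qed
      ultimately show "span (insert e E) = P" by blast
      have ortho: "g e f = 0" "g f e = 0" if "f \<in> E" for f
        using that onbD(1)[OF E(1)] symmetric_formD(2)[OF g(1), of f e] by (auto simp: R_def)
      fix x y assume "x \<in> insert e E" "y \<in> insert e E"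
      then consider "x = e" "y = e" | "x = e" "y \<in> E" | "x \<in> E" "y = e" | "x \<in> E" "y \<in> E"
        by blast
      then show "g x y = (if x = y then 1 else 0)"
      proof cases
        case 1 then show ?thesis using e(2) by simp
      next
        case 2 then show ?thesis using ortho eE by auto
      next
        case 3 then show ?thesis using ortho eE by auto
      next
        case 4 then show ?thesis using onbD(3)[OF E(1)] by simp
      qed
    qed
    moreover have "\<forall>f\<in>insert e E. \<forall>x\<in>P. b f x = (\<nu>(e := \<mu>)) f * g f x"
    proof (intro ballI)
      fix f x assume f: "f \<in> insert e E" and x: "x \<in> P"
      show "b f x = (\<nu>(e := \<mu>)) f * g f x"
      proof (cases "f = e")
        case True then show ?thesis using e(3)[OF x] by simp
      next
        case False
        then have f: "f \<in> E" using f by simp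
        then have fR: "f \<in> P" "g f e = 0"
          using onbD(1)[OF E(1)] symmetric_formD(2)[OF g(1)] by (auto simp: R_def)
        have "b f e = 0" using e(3)[OF fR(1)] fR(2) symmetric_formD(2)[OF g(1)] symmetric_formD(2)[OF b]
          by simp
        then have "b f x = b f (x - g e x *\<^sub>R e)"
          by (simp add: bilinear_simps[OF symmetric_formD(1)[OF b]])
        also have "\<dots> = \<nu> f * g f (x - g e x *\<^sub>R e)" by (rule E(2)[OF f split[OF x]])
        also have "\<dots> = \<nu> f * g f x" using fR(2) by (simp add: bilinear_simps[OF bg])
        finally show ?thesis using False by simp
      qed
    qed
    ultimately show ?thesis by blast
  qed
qed

corollary ex_orthonormal_basis:
  fixes g :: "'a::euclidean_space \<Rightarrow> 'a \<Rightarrow> real"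
  assumes "subspace P" "symmetric_form g" "pos_def_on P g"
  shows "\<exists>E. orthonormal_basis_on P g E"
  using simultaneous_diagonalization[OF assms assms(2)] by blast


section \<open>Invariant inner products of bounded groups\<close>

text \<open>The square of the Hilbert-Schmidt norm with respect to the Euclidean inner product.\<close>

definition hs_sq :: "('a::euclidean_space \<Rightarrow> 'a \<Rightarrow> real) \<Rightarrow> real" where
  "hs_sq S = (\<Sum>b\<in>Basis. \<Sum>c\<in>Basis. (S b c)\<^sup>2)"

lemma hs_nonneg: "hs_sq S \<ge> 0"
  unfolding hs_sq_def by (intro sum_nonneg) auto

lemma hs_entry: "b \<in> Basis \<Longrightarrow> c \<in> Basis \<Longrightarrow> (S b c)\<^sup>2 \<le> hs_sq S"
  unfolding hs_sq_def
  by (rule order_trans[OF member_le_sum[of c Basis "\<lambda>c. (S b c)\<^sup>2"]])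
    (auto intro!: member_le_sum[of b Basis "\<lambda>b. \<Sum>c\<in>Basis. (S b c)\<^sup>2"] sum_nonneg)

lemma bilinear_expansion:
  fixes S :: "'a::euclidean_space \<Rightarrow> 'a \<Rightarrow> real"
  assumes "bilinear S"
  shows "S x y = (\<Sum>b\<in>Basis. \<Sum>c\<in>Basis. (x \<bullet> b) * (y \<bullet> c) * S b c)"
proof -
  have "S x y = (\<Sum>b\<in>Basis. (x \<bullet> b) * S b y)"
    using linear_expansion[OF bilinear_linear(2)[OF assms], of x y] by simp
  moreover have "S b y = (\<Sum>c\<in>Basis. (y \<bullet> c) * S b c)" for b
    using linear_expansion[OF bilinear_linear(1)[OF assms], of b y] by simp
  ultimately show ?thesis by (simp add: sum_distrib_left mult_ac)
qed

lemma hs_bound: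
  fixes S :: "'a::euclidean_space \<Rightarrow> 'a \<Rightarrow> real"
  assumes "bilinear S"
  shows "\<bar>S x y\<bar> \<le> (DIM('a))\<^sup>2 * sqrt (hs_sq S) * norm x * norm y"
proof -
  have "\<bar>S x y\<bar> \<le> (\<Sum>b\<in>(Basis::'a set). \<Sum>c\<in>(Basis::'a set). norm x * norm y * sqrt (hs_sq S))"
    unfolding bilinear_expansion[OF assms, of x y]
  proof (intro order_trans[OF sum_abs] sum_mono)
    fix b c :: 'a assume bc: "b \<in> Basis" "c \<in> Basis"
    have "\<bar>S b c\<bar> \<le> sqrt (hs_sq S)" using hs_entry[OF bc, of S] by (simp add: real_le_rsqrt)
    then show "\<bar>(x \<bullet> b) * (y \<bullet> c) * S b c\<bar> \<le> norm x * norm y * sqrt (hs_sq S)"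
      unfolding abs_mult using bc by (intro mult_mono) (auto simp: Basis_le_norm)
  qed
  then show ?thesis by (simp add: power2_eq_square mult_ac)
qed

text \<open>The set \<open>K\<close> is convex, invariant under \<open>X\<close>, and by its lower bound contains only positive
  forms. The invariant function \<open>\<Phi>\<close> is the supremum of \<open>hs_sq\<close> over the orbit. By the parallelogram law
  \<open>\<Phi>\<close> is uniformly convex: boundedness of \<open>X\<close> makes \<open>hs_sq\<close> comparable along orbits, with the
  constant \<open>C\<close>. Hence minimising sequences of \<open>\<Phi>\<close> on \<open>K\<close> converge, and the minimiser is unique and
  therefore fixed by \<open>X\<close>.\<close>

theorem bounded_group_invariant_inner_product:
  fixes X :: "('a::euclidean_space \<Rightarrow> 'a) set"
  assumes lin: "\<And>f. f \<in> X \<Longrightarrow> linear f"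
    and comp: "\<And>f h. f \<in> X \<Longrightarrow> h \<in> X \<Longrightarrow> (\<lambda>x. f (h x)) \<in> X"
    and inv: "\<And>f. f \<in> X \<Longrightarrow> \<exists>h\<in>X. \<forall>x. h (f x) = x \<and> f (h x) = x"
    and ne: "X \<noteq> {}"
    and M: "M > 0" and bound: "\<And>f x. f \<in> X \<Longrightarrow> norm (f x) \<le> M * norm x"
  shows "\<exists>Q. symmetric_form Q \<and> pos_def_on UNIV Q \<and> (\<forall>f\<in>X. \<forall>x y. Q (f x) (f y) = Q x y)"
proof -
  define act where "act f S = (\<lambda>x y. S (f x) (f y) :: real)" for f :: "'a \<Rightarrow> 'a" and S
  define K where "K = {Q. symmetric_form Q \<and> (\<forall>f\<in>X. \<forall>v. (norm v)\<^sup>2 \<le> M\<^sup>2 * Q (f v) (f v))}"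
  define \<Phi> where "\<Phi> Q = (SUP f\<in>X. hs_sq (act f Q))" for Q
  define C where "C = (DIM('a))\<^sup>2 * ((DIM('a))\<^sup>2 * M * M)\<^sup>2"
  have C: "C > 0" using M by (simp add: C_def)
  have bact: "bilinear (act f S)" if "f \<in> X" "bilinear S" for f S
    using lin[OF that(1)] bilinear_linear[OF that(2)]
    by (auto simp: bilinear_def act_def intro: linear_compose[unfolded o_def])
  have hs_act: "hs_sq (act f S) \<le> C * hs_sq S" if f: "f \<in> X" and S: "bilinear S" for f S
  proof -
    have "hs_sq (act f S) \<le> (\<Sum>b\<in>(Basis::'a set). \<Sum>c\<in>(Basis::'a set). ((DIM('a))\<^sup>2 * M * M)\<^sup>2 * hs_sq S)"
      unfolding hs_sq_def[of "act f S"]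
    proof (intro sum_mono)
      fix b c :: 'a assume bc: "b \<in> Basis" "c \<in> Basis"
      have "\<bar>S (f b) (f c)\<bar> \<le> (DIM('a))\<^sup>2 * sqrt (hs_sq S) * norm (f b) * norm (f c)"
        by (rule hs_bound[OF S])
      also have "\<dots> \<le> (DIM('a))\<^sup>2 * sqrt (hs_sq S) * M * M"
        using bound[OF f, of b] bound[OF f, of c] bc M by (intro mult_mono) (auto simp: hs_nonneg)
      finally have "\<bar>S (f b) (f c)\<bar>\<^sup>2 \<le> ((DIM('a))\<^sup>2 * sqrt (hs_sq S) * M * M)\<^sup>2"
        by (intro power_mono) auto
      also have "\<dots> = ((DIM('a))\<^sup>2 * M * M)\<^sup>2 * hs_sq S"
        by (simp add: power_mult_distrib hs_nonneg)
      finally show "(act f S b c)\<^sup>2 \<le> ((DIM('a))\<^sup>2 * M * M)\<^sup>2 * hs_sq S" by (simp add: act_def)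
    qed
    then show ?thesis by (simp add: C_def power2_eq_square mult_ac)
  qed
  have bdd: "bdd_above ((\<lambda>f. hs_sq (act f S)) ` X)" if "bilinear S" for S
    using hs_act[OF _ that] by (intro bdd_aboveI2)
  have \<Phi>_upper: "hs_sq (act f S) \<le> \<Phi> S" if "f \<in> X" "bilinear S" for f S
    unfolding \<Phi>_def using bdd[OF that(2)] that(1) by (intro cSUP_upper)
  have \<Phi>_least: "\<Phi> S \<le> B" if "\<And>f. f \<in> X \<Longrightarrow> hs_sq (act f S) \<le> B" for S B
    unfolding \<Phi>_def using ne that by (intro cSUP_least)
  have \<Phi>_nonneg: "0 \<le> \<Phi> S" if "bilinear S" for S
  proof -
    obtain f where "f \<in> X" using ne by blast
    from \<Phi>_upper[OF this that] hs_nonneg[of "act f S"] show ?thesis by linarith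
  qed
  have KD: "bilinear Q" "Q x y = Q y x" if "Q \<in> K" for Q x y
    using that by (auto simp: K_def symmetric_form_def)
  have K_act: "act f Q \<in> K" "\<Phi> (act f Q) \<le> \<Phi> Q" if f: "f \<in> X" and Q: "Q \<in> K" for f Q
  proof -
    have eq: "act h (act f Q) = act (\<lambda>x. f (h x)) Q" for h by (simp add: act_def)
    have "(norm v)\<^sup>2 \<le> M\<^sup>2 * act f Q (h v) (h v)" if "h \<in> X" for h v
      using Q comp[OF f that] by (auto simp: K_def act_def)
    then show "act f Q \<in> K" using bact[OF f KD(1)[OF Q]] KD(2)[OF Q]
      by (auto simp: K_def symmetric_form_def act_def)
    show "\<Phi> (act f Q) \<le> \<Phi> Q"
      by (rule \<Phi>_least) (metis eq \<Phi>_upper comp f KD(1)[OF Q])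
  qed
  have inner_K: "(\<lambda>x y. x \<bullet> y) \<in> K"
  proof -
    have "(norm v)\<^sup>2 \<le> M\<^sup>2 * (f v \<bullet> f v)" if f: "f \<in> X" for f v
    proof -
      obtain h where "h \<in> X" "h (f v) = v" using inv[OF f] by blast
      then have "norm v \<le> M * norm (f v)" using bound[of h "f v"] by simp
      then have "(norm v)\<^sup>2 \<le> (M * norm (f v))\<^sup>2" by (intro power_mono) auto
      then show ?thesis by (simp add: power_mult_distrib power2_norm_eq_inner)
    qed
    then show ?thesis using symmetric_form_inner by (simp add: K_def)
  qed
  define \<mu> where "\<mu> = Inf (\<Phi> ` K)"
  have bddK: "bdd_below (\<Phi> ` K)" by (rule bdd_belowI2[of _ 0]) (rule \<Phi>_nonneg[OF KD(1)])
  have \<mu>_le: "\<mu> \<le> \<Phi> Q" if "Q \<in> K" for Q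
    unfolding \<mu>_def using bddK that by (intro cINF_lower)
  have convex: "hs_sq (\<lambda>x y. P x y - Q x y) \<le> 2 * C * (\<Phi> P + \<Phi> Q - 2 * \<mu>)"
    if P: "P \<in> K" and Q: "Q \<in> K" for P Q
  proof -
    define R where "R = (\<lambda>x y. (P x y + Q x y) / 2)"
    define S where "S = (\<lambda>x y. P x y - Q x y)"
    note b = bilinear_simps[OF KD(1)[OF P]] bilinear_simps[OF KD(1)[OF Q]]
    have R: "bilinear R" and S: "bilinear S"
      by (auto simp: bilinear_def linear_iff R_def S_def b algebra_simps add_divide_distrib)
    have "(norm v)\<^sup>2 \<le> M\<^sup>2 * R (f v) (f v)" if "f \<in> X" for f v
    proof -
      have "(norm v)\<^sup>2 \<le> M\<^sup>2 * P (f v) (f v)" "(norm v)\<^sup>2 \<le> M\<^sup>2 * Q (f v) (f v)"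
        using P Q that by (auto simp: K_def)
      then show ?thesis by (simp add: R_def algebra_simps)
    qed
    then have "R \<in> K" using R KD(2)[OF P] KD(2)[OF Q] by (simp add: K_def symmetric_form_def R_def)
    then have "\<mu> \<le> \<Phi> R" by (rule \<mu>_le)
    also have "\<Phi> R \<le> (\<Phi> P + \<Phi> Q) / 2 - hs_sq S / (4 * C)"
    proof (rule \<Phi>_least)
      fix f assume f: "f \<in> X"
      obtain h where h: "h \<in> X" "\<And>x. f (h x) = x" using inv[OF f] by blast
      have "act h (act f S) = S" by (simp add: act_def h(2))
      then have "hs_sq S \<le> C * hs_sq (act f S)" using hs_act[OF h(1) bact[OF f S]] by simp
      then have 1: "hs_sq S / (4 * C) \<le> hs_sq (act f S) / 4" using C by (simp add: divide_simps mult.commute)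
      have pt: "(act f R b c)\<^sup>2 = ((act f P b c)\<^sup>2 + (act f Q b c)\<^sup>2) / 2 - (act f S b c)\<^sup>2 / 4" for b c
        by (simp add: act_def R_def S_def power2_eq_square field_simps)
      have "hs_sq (act f R) = (hs_sq (act f P) + hs_sq (act f Q)) / 2 - hs_sq (act f S) / 4"
        unfolding hs_sq_def pt
        by (simp add: sum.distrib sum_subtractf sum_divide_distrib add_divide_distrib)
      then show "hs_sq (act f R) \<le> (\<Phi> P + \<Phi> Q) / 2 - hs_sq S / (4 * C)"
        using 1 \<Phi>_upper[OF f KD(1)[OF P]] \<Phi>_upper[OF f KD(1)[OF Q]] by argo
    qed
    finally have "hs_sq S / (4 * C) \<le> (\<Phi> P + \<Phi> Q - 2 * \<mu>) / 2" by argo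
    then show ?thesis using C unfolding S_def[symmetric] by (simp add: field_simps)
  qed
  have "\<exists>Q\<in>K. \<Phi> Q < \<mu> + inverse (real (Suc n))" for n
  proof -
    have "Inf (\<Phi> ` K) < \<mu> + inverse (real (Suc n))" by (simp add: \<mu>_def)
    then show ?thesis using cInf_lessD[of "\<Phi> ` K"] inner_K by blast
  qed
  then obtain q where qK: "\<And>n. q n \<in> K" and q\<Phi>: "\<And>n. \<Phi> (q n) < \<mu> + inverse (real (Suc n))"
    by metis
  have "convergent (\<lambda>n. q n b c)" if bc: "b \<in> Basis" "c \<in> Basis" for b c
  proof (rule real_Cauchy_convergent, rule CauchyI)
    fix e :: real assume e: "e > 0"
    obtain N where N: "inverse (real (Suc N)) < e\<^sup>2 / (4 * C)"
      using reals_Archimedean[of "e\<^sup>2 / (4 * C)"] e C by auto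
    show "\<exists>N. \<forall>m\<ge>N. \<forall>n\<ge>N. norm (q m b c - q n b c) < e"
    proof (intro exI allI impI)
      fix m n assume mn: "m \<ge> N" "n \<ge> N"
      have "inverse (real (Suc m)) \<le> inverse (real (Suc N))" "inverse (real (Suc n)) \<le> inverse (real (Suc N))"
        using mn by (auto intro!: le_imp_inverse_le)
      then have "\<Phi> (q m) + \<Phi> (q n) - 2 * \<mu> < 2 * (e\<^sup>2 / (4 * C))"
        using q\<Phi>[of m] q\<Phi>[of n] N by argo
      then have "2 * C * (\<Phi> (q m) + \<Phi> (q n) - 2 * \<mu>) < 2 * C * (2 * (e\<^sup>2 / (4 * C)))"
        using C by (intro mult_strict_left_mono) auto
      then have "hs_sq (\<lambda>x y. q m x y - q n x y) < e\<^sup>2"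
        using convex[OF qK qK, of m n] C by simp
      then have "(q m b c - q n b c)\<^sup>2 < e\<^sup>2"
        using hs_entry[OF bc, of "\<lambda>x y. q m x y - q n x y"] by linarith
      then show "norm (q m b c - q n b c) < e"
        using e abs_square_less_1 power2_less_imp_less[of "\<bar>q m b c - q n b c\<bar>" e] by simp
    qed
  qed
  then have lim0: "(\<lambda>n. q n b c) \<longlonglongrightarrow> lim (\<lambda>n. q n b c)" if "b \<in> Basis" "c \<in> Basis" for b c
    using that convergent_LIMSEQ_iff by blast
  define Q where "Q x y = (\<Sum>b\<in>Basis. \<Sum>c\<in>Basis. (x \<bullet> b) * (y \<bullet> c) * lim (\<lambda>n. q n b c))" for x y
  have lim: "(\<lambda>n. q n x y) \<longlonglongrightarrow> Q x y" for x y
    unfolding Q_def bilinear_expansion[OF KD(1)[OF qK], of _ x y]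
    by (intro tendsto_sum tendsto_mult tendsto_const lim0)
  have Q: "bilinear Q"
    by (auto simp: bilinear_def linear_iff Q_def inner_add_left inner_scaleR_left sum_distrib_left
        algebra_simps sum.distrib)
  have Qs: "Q x y = Q y x" for x y
    using LIMSEQ_unique[OF lim[of x y]] lim[of y x] KD(2)[OF qK] by simp
  have QK: "Q \<in> K"
  proof -
    have "(norm v)\<^sup>2 \<le> M\<^sup>2 * Q (f v) (f v)" if f: "f \<in> X" for f v
    proof (rule LIMSEQ_le_const)
      show "(\<lambda>n. M\<^sup>2 * q n (f v) (f v)) \<longlonglongrightarrow> M\<^sup>2 * Q (f v) (f v)"
        by (intro tendsto_mult tendsto_const lim)
      show "\<exists>N. \<forall>n\<ge>N. (norm v)\<^sup>2 \<le> M\<^sup>2 * q n (f v) (f v)"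
        using qK f by (auto simp: K_def)
    qed
    then show ?thesis using Q Qs by (simp add: K_def symmetric_form_def)
  qed
  have Q\<Phi>: "\<Phi> Q \<le> \<mu>"
  proof (rule \<Phi>_least)
    fix f assume f: "f \<in> X"
    show "hs_sq (act f Q) \<le> \<mu>"
    proof (rule LIMSEQ_le)
      show "(\<lambda>n. hs_sq (act f (q n))) \<longlonglongrightarrow> hs_sq (act f Q)"
        unfolding hs_sq_def act_def by (intro tendsto_sum tendsto_power lim)
      have "(\<lambda>n. \<mu> + inverse (real (Suc n))) \<longlonglongrightarrow> \<mu> + 0"
        by (intro tendsto_add tendsto_const LIMSEQ_inverse_real_of_nat)
      then show "(\<lambda>n. \<mu> + inverse (real (Suc n))) \<longlonglongrightarrow> \<mu>" by simp
      show "\<exists>N. \<forall>n\<ge>N. hs_sq (act f (q n)) \<le> \<mu> + inverse (real (Suc n))"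
        using \<Phi>_upper[OF f KD(1)[OF qK]] q\<Phi> by (meson less_imp_le order_trans)
    qed
  qed
  have "Q (f x) (f y) = Q x y" if f: "f \<in> X" for f x y
  proof -
    define S where "S = (\<lambda>x y. act f Q x y - Q x y)"
    note b = bilinear_simps[OF bact[OF f Q]] bilinear_simps[OF Q]
    have S: "bilinear S"
      by (auto simp: bilinear_def linear_iff S_def b algebra_simps)
    have "hs_sq S \<le> 2 * C * (\<Phi> (act f Q) + \<Phi> Q - 2 * \<mu>)"
      unfolding S_def by (rule convex[OF K_act(1)[OF f QK] QK])
    also have "\<dots> \<le> 0" using C K_act(2)[OF f QK] Q\<Phi> by (intro mult_nonneg_nonpos) auto
    finally have "hs_sq S = 0" using hs_nonneg[of S] by simp
    then have "S x y = 0" using hs_bound[OF S, of x y] by simp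
    then show ?thesis by (simp add: S_def act_def)
  qed
  moreover have "pos_def_on UNIV Q"
  proof -
    obtain f where f: "f \<in> X" using ne by blast
    obtain h where h: "\<And>x. f (h x) = x" "h \<in> X" using inv[OF f] by blast
    have "0 < Q x x" if "x \<noteq> 0" for x
    proof -
      have "h x \<noteq> 0" using h(1)[of x] linear_0[OF lin[OF f]] that by auto
      moreover have "(norm (h x))\<^sup>2 \<le> M\<^sup>2 * Q (f (h x)) (f (h x))" using QK f by (auto simp: K_def)
      ultimately have "0 < M\<^sup>2 * Q x x" using h(1) by (smt (verit) norm_eq_zero zero_less_power2)
      then show ?thesis using M by (simp add: zero_less_mult_iff)
    qed
    then show ?thesis by (simp add: pos_def_on_def)
  qed
  ultimately show ?thesis using Q Qs by (auto simp: symmetric_form_def)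
qed


section \<open>The Killing form of a compact semisimple group\<close>

text \<open>A linear map with kernel \<open>S\<close> vanishes along the curve, hence on its velocity.\<close>

lemma has_vector_derivative_in_subspace:
  fixes f :: "real \<Rightarrow> 'a::euclidean_space"
  assumes S: "subspace S" and f: "\<And>t. f t \<in> S" and d: "(f has_vector_derivative d) (at 0)"
  shows "d \<in> S"
proof -
  note b = symmetric_formD(1)[OF symmetric_form_inner]
  obtain E where E: "orthonormal_basis_on S (\<lambda>x y. x \<bullet> y) E"
    using ex_orthonormal_basis[OF S symmetric_form_inner] by (auto simp: pos_def_on_def)
  define L where "L x = (\<Sum>e\<in>E. (x \<bullet> e) *\<^sub>R e) - x" for x
  have "linear L"
    by (auto simp: L_def linear_iff inner_add_left scaleR_add_left sum.distrib scaleR_sum_right scaleR_diff_right)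
  then have bl: "bounded_linear L" by (rule linear_conv_bounded_linear[THEN iffD1])
  have "L (f t) = 0" for t
    using onb_expansion[OF b E f[of t]] by (simp add: L_def)
  then have "((\<lambda>t. 0) has_vector_derivative L d) (at (0::real))"
    using bounded_linear.has_vector_derivative[OF bl d] by simp
  then have "L d = 0" using vector_derivative_unique_at has_vector_derivative_const by blast
  then have "d = (\<Sum>e\<in>E. (d \<bullet> e) *\<^sub>R e)" by (simp add: L_def)
  also have "\<dots> \<in> S" using S onbD(1)[OF E] by (intro subspace_sum subspace_scale) auto
  finally show ?thesis .
qed

lemma linear_trace_add: "linear_trace (\<lambda>x. f x + g x) = linear_trace f + linear_trace g"
  by (simp add: linear_trace_def inner_add_left sum.distrib)

lemma linear_trace_scale: "linear_trace (\<lambda>x. c *\<^sub>R f x) = c * linear_trace f"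
  by (simp add: linear_trace_def sum_distrib_left)

context lie_chart
begin

lemma Ad_locally_bounded:
  obtains V B where "open V" "org \<in> V" "V \<subseteq> U" "B > 0"
    "\<And>x v. x \<in> V \<Longrightarrow> norm (Ad G \<kappa> (pt x) v) \<le> B * norm v"
proof -
  have "\<forall>\<^sub>F x in nhds org. norm (Ad G \<kappa> (pt x) b) < 2" if "b \<in> Basis" for b
  proof -
    have "((\<lambda>x. Ad G \<kappa> (pt x) b) \<longlongrightarrow> Ad G \<kappa> (pt org) b) (at org)"
      using has_derivative_continuous[OF D_Ad_pt] by (simp add: continuous_at)
    then have "((\<lambda>x. Ad G \<kappa> (pt x) b) \<longlongrightarrow> b) (nhds org)"
      using tendsto_at_iff_tendsto_nhds[of "\<lambda>x. Ad G \<kappa> (pt x) b" org] by (simp add: Ad_one)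
    then have "((\<lambda>x. norm (Ad G \<kappa> (pt x) b)) \<longlongrightarrow> 1) (nhds org)"
      using tendsto_norm that by fastforce
    then show ?thesis by (rule order_tendstoD) simp
  qed
  then have "\<forall>\<^sub>F x in nhds org. \<forall>b\<in>Basis. norm (Ad G \<kappa> (pt x) b) < 2"
    by (intro eventually_ball_finite) auto
  then obtain V where V: "open V" "org \<in> V" "\<And>x b. x \<in> V \<Longrightarrow> b \<in> Basis \<Longrightarrow> norm (Ad G \<kappa> (pt x) b) < 2"
    unfolding eventually_nhds by blast
  show ?thesis
  proof
    show "open (V \<inter> U)" "org \<in> V \<inter> U" "V \<inter> U \<subseteq> U" using V open_U org_U by auto
    show "0 < 2 * real DIM('a)" by simp
    fix x v assume x: "x \<in> V \<inter> U"
    have "norm (Ad G \<kappa> (pt x) v) = norm (\<Sum>b\<in>Basis. (v \<bullet> b) *\<^sub>R Ad G \<kappa> (pt x) b)"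
      using linear_expansion[OF linear_Ad[of "pt x"], of v] x by simp
    also have "\<dots> \<le> (\<Sum>b\<in>(Basis::'a set). norm v * 2)"
    proof (rule sum_norm_le)
      fix b :: 'a assume b: "b \<in> Basis"
      show "norm ((v \<bullet> b) *\<^sub>R Ad G \<kappa> (pt x) b) \<le> norm v * 2"
        using V(3)[of x b] x b Basis_le_norm[OF b, of v] by (auto intro!: mult_mono)
    qed
    finally show "norm (Ad G \<kappa> (pt x) v) \<le> 2 * real DIM('a) * norm v" by (simp add: mult_ac)
  qed
qed

text \<open>\<open>Ad\<close> is bounded near the identity, finitely many left translates of that neighbourhood cover the
  group, and \<open>Ad\<close> is multiplicative.\<close>

lemma Ad_bounded:
  assumes "compact_space T"
  obtains M where "M > 0" "\<And>a v. a \<in> carrier G \<Longrightarrow> norm (Ad G \<kappa> a v) \<le> M * norm v"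
proof -
  obtain V B where V: "open V" "org \<in> V" "V \<subseteq> U" and B: "B > 0"
    "\<And>x v. x \<in> V \<Longrightarrow> norm (Ad G \<kappa> (pt x) v) \<le> B * norm v"
    using Ad_locally_bounded by blast
  define N where "N = {a \<in> fst \<kappa>. crd a \<in> V}"
  have N: "openin T N" unfolding N_def by (rule openin_crd_vimage[OF V(1)])
  define tr where "tr g = {a \<in> topspace T. inv g \<otimes> a \<in> N}" for g
  have op: "openin T (tr g)" if g: "g \<in> carrier G" for g
  proof -
    have "continuous_map T (prod_topology T T) (\<lambda>a. (inv g, a))"
      using g topspace_eq by (intro continuous_map_pairedI) auto
    from continuous_map_compose[OF this continuous_mult]
    have "continuous_map T T (\<lambda>a. inv g \<otimes> a)" by (simp add: o_def)
    then show ?thesis unfolding tr_def using N by (rule openin_continuous_map_preimage)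
  qed
  have mem: "g \<in> tr g" if "g \<in> carrier G" for g
    using that V(2) one_dom l_inv[OF that] unfolding tr_def topspace_eq N_def by simp
  have "compactin T (carrier G)" using assms by (simp add: compact_space_def topspace_eq)
  then obtain \<F> where \<F>: "finite \<F>" "\<F> \<subseteq> tr ` carrier G" "carrier G \<subseteq> \<Union>\<F>"
    using compactinD[of T "carrier G" "tr ` carrier G"] op mem by blast
  then obtain F where F: "finite F" "F \<subseteq> carrier G" "\<F> = tr ` F"
    using finite_subset_image by metis
  have "\<exists>K>0. \<forall>v. norm (Ad G \<kappa> g v) \<le> K * norm v" if "g \<in> carrier G" for g
    using linear_bounded_pos[OF linear_Ad[OF that]] by metis
  then obtain K where K: "\<And>g. g \<in> carrier G \<Longrightarrow> K g > 0"
    "\<And>g v. g \<in> carrier G \<Longrightarrow> norm (Ad G \<kappa> g v) \<le> K g * norm v" by metis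
  show ?thesis
  proof
    have pos: "0 \<le> K g * B" if "g \<in> F" for g using K(1)[of g] that F(2) B(1) by (auto intro!: mult_nonneg_nonneg less_imp_le)
    then have "0 \<le> (\<Sum>g\<in>F. K g * B)" by (intro sum_nonneg)
    then show "0 < 1 + (\<Sum>g\<in>F. K g * B)" by linarith
    fix a v assume a: "a \<in> carrier G"
    then obtain g where g: "g \<in> F" "a \<in> tr g" using \<F>(3) F(3) by blast
    then have gc: "g \<in> carrier G" and n: "inv g \<otimes> a \<in> N" using F(2) by (auto simp: tr_def)
    have "a = g \<otimes> (inv g \<otimes> a)" using a gc by (simp add: m_assoc[symmetric])
    then have "Ad G \<kappa> a v = Ad G \<kappa> g (Ad G \<kappa> (inv g \<otimes> a) v)"
      using Ad_mult[of g "inv g \<otimes> a" v] a gc by simp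
    then have "norm (Ad G \<kappa> a v) \<le> K g * norm (Ad G \<kappa> (inv g \<otimes> a) v)"
      using K(2)[OF gc] by simp
    also have "\<dots> \<le> K g * (B * norm v)"
      using B(2)[of "crd (inv g \<otimes> a)" v] n K(1)[OF gc] by (intro mult_left_mono) (auto simp: N_def)
    also have "\<dots> = (K g * B) * norm v" by simp
    also have "\<dots> \<le> (1 + (\<Sum>g\<in>F. K g * B)) * norm v"
    proof (rule mult_right_mono)
      have "K g * B \<le> (\<Sum>g\<in>F. K g * B)" using g(1) F(1) pos by (intro member_le_sum) auto
      then show "K g * B \<le> 1 + (\<Sum>g\<in>F. K g * B)" by simp
    qed simp
    finally show "norm (Ad G \<kappa> a v) \<le> (1 + (\<Sum>g\<in>F. K g * B)) * norm v" .
  qed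
qed

lemma ex_Ad_invariant_inner_product:
  assumes "compact_space T"
  obtains Q where "symmetric_form Q" "pos_def_on UNIV Q"
    "\<And>a x y. a \<in> carrier G \<Longrightarrow> Q (Ad G \<kappa> a x) (Ad G \<kappa> a y) = Q x y"
proof -
  obtain M where M: "M > 0" "\<And>a v. a \<in> carrier G \<Longrightarrow> norm (Ad G \<kappa> a v) \<le> M * norm v"
    using Ad_bounded[OF assms] by blast
  have "\<exists>Q. symmetric_form Q \<and> pos_def_on UNIV Q \<and>
    (\<forall>f\<in>Ad G \<kappa> ` carrier G. \<forall>x y. Q (f x) (f y) = Q x y)"
  proof (rule bounded_group_invariant_inner_product[OF _ _ _ _ M(1)])
    fix f h assume "f \<in> Ad G \<kappa> ` carrier G" "h \<in> Ad G \<kappa> ` carrier G"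
    then obtain a b where "a \<in> carrier G" "b \<in> carrier G" "f = Ad G \<kappa> a" "h = Ad G \<kappa> b" by blast
    then show "(\<lambda>x. f (h x)) \<in> Ad G \<kappa> ` carrier G"
      by (intro image_eqI[of _ _ "a \<otimes> b"]) (auto simp: Ad_mult)
  next
    fix f assume "f \<in> Ad G \<kappa> ` carrier G"
    then obtain a where a: "a \<in> carrier G" "f = Ad G \<kappa> a" by blast
    then show "\<exists>h\<in>Ad G \<kappa> ` carrier G. \<forall>x. h (f x) = x \<and> f (h x) = x"
      by (intro bexI[of _ "Ad G \<kappa> (inv a)"]) (auto simp: Ad_inv)
  qed (use linear_Ad M(2) in auto)
  then show ?thesis using that by blast
qed

lemma ex_curve:
  obtains \<gamma> where "\<And>t::real. \<gamma> t \<in> fst \<kappa>" "\<gamma> 0 = \<one>"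
    "((\<lambda>t. crd (\<gamma> t)) has_vector_derivative z) (at 0)"
proof
  (* a straight line in the chart, made constant where it leaves the chart *)
  define \<gamma> where "\<gamma> t = (if org + t *\<^sub>R z \<in> U then pt (org + t *\<^sub>R z) else \<one>)" for t :: real
  show "\<gamma> t \<in> fst \<kappa>" for t using one_dom by (simp add: \<gamma>_def)
  show "\<gamma> 0 = \<one>" using org_U by (simp add: \<gamma>_def)
  have 1: "((\<lambda>t. org + t *\<^sub>R z) has_vector_derivative z) (at 0)"
    by (auto intro!: derivative_eq_intros simp: has_vector_derivative_def)
  have "open {t. org + t *\<^sub>R z \<in> U}"
    using open_vimage[OF open_U, of "\<lambda>t. org + t *\<^sub>R z"] by (simp add: vimage_def continuous_intros)
  then show "((\<lambda>t. crd (\<gamma> t)) has_vector_derivative z) (at 0)"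
    by (rule has_vector_derivative_transform_within_open[OF 1]) (auto simp: \<gamma>_def org_U)
qed

text \<open>Differentiate the constant function \<open>t \<mapsto> b (Ad (\<gamma> t) x) (Ad (\<gamma> t) y)\<close> at \<open>0\<close>.\<close>

lemma skew_of_invariant:
  assumes b: "bilinear (b :: 'a \<Rightarrow> 'a \<Rightarrow> real)"
    and \<gamma>: "\<And>t. \<gamma> t \<in> fst \<kappa>" "\<gamma> 0 = \<one>"
    and z: "((\<lambda>t::real. crd (\<gamma> t)) has_vector_derivative z) (at 0)"
    and i: "\<And>t. b (Ad G \<kappa> (\<gamma> t) x) (Ad G \<kappa> (\<gamma> t) y) = b x y"
  shows "b (br z x) y + b x (br z y) = 0"
proof -
  have "bounded_bilinear b" using b by (simp add: bilinear_conv_bounded_bilinear)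
  from bounded_bilinear.has_vector_derivative[OF this Ad_curve_derivative[OF \<gamma> z, of x] Ad_curve_derivative[OF \<gamma> z, of y]]
  have "((\<lambda>t::real. b x y) has_vector_derivative b x (br z y) + b (br z x) y) (at 0)"
    by (simp add: i \<gamma>(2) Ad_one)
  then have "b x (br z y) + b (br z x) y = 0"
    using vector_derivative_unique_at has_vector_derivative_const by blast
  then show ?thesis by simp
qed

lemma ad_skew:
  assumes b: "bilinear (b :: 'a \<Rightarrow> 'a \<Rightarrow> real)"
    and i: "\<And>a x y. a \<in> carrier G \<Longrightarrow> b (Ad G \<kappa> a x) (Ad G \<kappa> a y) = b x y"
  shows "b (br z x) y = - b x (br z y)"
proof -
  obtain \<gamma> where \<gamma>: "\<And>t::real. \<gamma> t \<in> fst \<kappa>" "\<gamma> 0 = \<one>" "((\<lambda>t. crd (\<gamma> t)) has_vector_derivative z) (at 0)"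
    using ex_curve[of z] by blast
  have "b (br z x) y + b x (br z y) = 0"
    by (rule skew_of_invariant[OF b \<gamma>]) (simp add: i dom_carrier[OF \<gamma>(1)])
  then show ?thesis by simp
qed

abbreviation kf :: "'a \<Rightarrow> 'a \<Rightarrow> real" where "kf \<equiv> killing_form G \<kappa>"

lemma kf_commute: "kf x y = kf y x"
  unfolding killing_form_def by (rule linear_trace_cyclic[OF linear_br_right linear_br_right])

lemma bilinear_kf: "bilinear kf"
proof -
  have "linear (\<lambda>x. kf x y)" for y
    by (rule linearI) (simp_all add: killing_form_def br_simps linear_trace_add linear_trace_scale)
  then show ?thesis unfolding bilinear_def by (metis (no_types, lifting) ext kf_commute)
qed

lemma kf_Ad: assumes a: "a \<in> carrier G" shows "kf (Ad G \<kappa> a x) (Ad G \<kappa> a y) = kf x y"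
proof -
  let ?A = "Ad G \<kappa> a" and ?B = "Ad G \<kappa> (inv a)"
  have br: "br (?A u) w = ?A (br u (?B w))" for u w
    by (simp add: Ad_bracket[OF a] Ad_inv[OF a])
  have lB: "linear (\<lambda>w. br x (br y (?B w)))"
    using linear_compose[OF linear_compose[OF linear_Ad[of "inv a"] linear_br_right[of y]] linear_br_right[of x]] a
    by (simp add: o_def)
  have "kf (?A x) (?A y) = linear_trace (\<lambda>w. ?A (br x (br y (?B w))))"
    by (simp add: killing_form_def br Ad_inv[OF a])
  also have "\<dots> = linear_trace (\<lambda>w. br x (br y (?B (?A w))))"
    by (rule linear_trace_cyclic[OF linear_Ad[OF a] lB])
  finally show ?thesis by (simp add: Ad_inv[OF a] killing_form_def)
qed

lemma kf_ad: "kf (br z x) y = - kf x (br z y)"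
  by (rule ad_skew[OF bilinear_kf kf_Ad])

text \<open>For an invariant inner product \<open>Q\<close> the map \<open>ad x\<close> is skew, so \<open>kf x x\<close> is the negative of the sum
  of the squared \<open>Q\<close>-lengths of \<open>br x e\<close>. If it vanishes, \<open>x\<close> is central, and the centre is an abelian
  ideal.\<close>

lemma kf_negative:
  assumes "compact_space T" "semisimple G \<kappa>" "x \<noteq> 0"
  shows "kf x x < 0"
proof -
  obtain Q where Q: "symmetric_form Q" "pos_def_on UNIV Q"
    "\<And>a x y. a \<in> carrier G \<Longrightarrow> Q (Ad G \<kappa> a x) (Ad G \<kappa> a y) = Q x y"
    using ex_Ad_invariant_inner_product[OF assms(1)] by blast
  note bQ = symmetric_formD(1)[OF Q(1)]
  obtain E where E: "orthonormal_basis_on UNIV Q E"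
    using ex_orthonormal_basis[OF subspace_UNIV Q(1,2)] by blast
  have "linear (\<lambda>w. br x (br x w))"
    using linear_compose[OF linear_br_right[of x] linear_br_right[of x]] by (simp add: o_def)
  then have "kf x x = (\<Sum>e\<in>E. Q (br x (br x e)) e)"
    unfolding killing_form_def by (rule linear_trace_onb[OF Q(1) E])
  also have "\<dots> = - (\<Sum>e\<in>E. Q (br x e) (br x e))"
    by (simp add: ad_skew[OF bQ Q(3)] sum_negf)
  finally have k: "kf x x = - (\<Sum>e\<in>E. Q (br x e) (br x e))" .
  have nn: "Q y y \<ge> 0" for y
    using Q(2) by (cases "y = 0") (auto simp: pos_def_on_def bilinear_simps[OF bQ] intro: less_imp_le)
  have "(\<Sum>e\<in>E. Q (br x e) (br x e)) \<noteq> 0"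
  proof
    assume "(\<Sum>e\<in>E. Q (br x e) (br x e)) = 0"
    then have "\<forall>e\<in>E. Q (br x e) (br x e) = 0"
      using onb_finite[OF bQ E] nn by (simp add: sum_nonneg_eq_0_iff)
    then have e0: "\<forall>e\<in>E. br x e = 0" using Q(2) by (force simp: pos_def_on_def)
    have "subspace {w. br x w = 0}" by (auto simp: subspace_def br_simps)
    then have "span E \<subseteq> {w. br x w = 0}" using e0 by (intro span_minimal) auto
    then have x: "\<forall>w. br x w = 0" using onbD(2)[OF E] by auto
    define Z where "Z = {x. \<forall>w. br x w = 0}"
    have sub: "subspace Z" by (auto simp: subspace_def Z_def br_simps)
    have "br w y = 0" if "y \<in> Z" for w y using that br_skew[of w y] by (simp add: Z_def)
    then have "lie_ideal G \<kappa> Z" using sub by (auto simp: lie_ideal_def subspace_0)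
    moreover have "lie_solvable G \<kappa> Z"
    proof -
      have "{br x y |x y. x \<in> Z \<and> y \<in> Z} = {0}"
      proof (intro equalityI subsetI)
        fix w :: 'a assume "w \<in> {0}"
        then have "w = br 0 0" by simp
        then show "w \<in> {br x y |x y. x \<in> Z \<and> y \<in> Z}" using subspace_0[OF sub] by blast
      qed (auto simp: Z_def)
      then have "(derived_algebra G \<kappa> ^^ 1) Z = {0}" by (simp add: derived_algebra_def)
      then show ?thesis unfolding lie_solvable_def by blast
    qed
    ultimately have "Z = {0}" using assms(2) by (simp add: semisimple_def)
    with x assms(3) show False by (auto simp: Z_def)
  qed
  moreover have "(\<Sum>e\<in>E. Q (br x e) (br x e)) \<ge> 0" by (intro sum_nonneg nn)
  ultimately show ?thesis using k by linarith
qed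

end

section \<open>The isotropy algebra and its complement\<close>

locale compact_homogeneous = lie_chart G T A \<kappa>
  for G :: "('g, 'm) monoid_scheme" (structure)
    and T :: "'g topology" and A :: "('g, 'a::euclidean_space) chart set"
    and \<kappa> :: "('g, 'a) chart" +
  fixes H :: "'g set"
  assumes compact: "compact_space T" and semisimple: "semisimple G \<kappa>" and H: "subgroup H G"
begin

abbreviation hh :: "'a set" where "hh \<equiv> lie_subalgebra_of G \<kappa> H"
abbreviation pp :: "'a set" where "pp \<equiv> isotropy_complement G \<kappa> H"
abbreviation pr :: "'a \<Rightarrow> 'a" where "pr \<equiv> isotropy_proj G \<kappa> H"
definition B :: "'a \<Rightarrow> 'a \<Rightarrow> real" where "B x y = - kf x y"

lemma B_form: "symmetric_form B"
  using kf_commute by (auto simp: symmetric_form_def B_def bilinear_def linear_iff bilinear_simps[OF bilinear_kf])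

lemmas B_bilinear = symmetric_formD(1)[OF B_form] and B_commute = symmetric_formD(2)[OF B_form]

lemma B_pos: "pos_def_on UNIV B"
  using kf_negative[OF compact semisimple] by (simp add: pos_def_on_def B_def)

lemma B_ad: "B (br z x) y = - B x (br z y)"
  by (simp add: B_def kf_ad)

lemma H_carrier: "a \<in> H \<Longrightarrow> a \<in> carrier G"
  using subgroup.mem_carrier[OF H] .

text \<open>Only the germ of the curve matters: where it leaves the chart it may be replaced by the identity.\<close>

lemma hhI:
  assumes \<gamma>: "\<And>t::real. \<gamma> t \<in> H" "\<gamma> 0 = \<one>" and ev: "\<forall>\<^sub>F t in nhds 0. \<gamma> t \<in> fst \<kappa> \<and> crd (\<gamma> t) = f t"
    and v: "(f has_vector_derivative v) (at 0)"
  shows "v \<in> hh"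
proof -
  define \<gamma>' where "\<gamma>' t = (if \<gamma> t \<in> fst \<kappa> then \<gamma> t else \<one>)" for t
  have "\<gamma>' t \<in> H \<inter> fst \<kappa>" for t using \<gamma>(1) one_dom subgroup.one_closed[OF H] by (simp add: \<gamma>'_def)
  moreover have "\<gamma>' 0 = \<one>" using \<gamma>(2) by (simp add: \<gamma>'_def)
  moreover obtain S where S: "open S" "0 \<in> S" "\<And>t. t \<in> S \<Longrightarrow> \<gamma> t \<in> fst \<kappa> \<and> crd (\<gamma> t) = f t"
    using ev unfolding eventually_nhds by blast
  have "((\<lambda>t. crd (\<gamma>' t)) has_vector_derivative v) (at 0)"
    by (rule has_vector_derivative_transform_within_open[OF v S(1,2)]) (simp add: S(3) \<gamma>'_def)
  ultimately show ?thesis unfolding lie_subalgebra_of_def by blast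
qed

lemma hhE:
  assumes "v \<in> hh"
  obtains \<gamma> where "\<And>t::real. \<gamma> t \<in> H" "\<And>t. \<gamma> t \<in> fst \<kappa>" "\<gamma> 0 = \<one>"
    "((\<lambda>t. crd (\<gamma> t)) has_vector_derivative v) (at 0)"
  using assms unfolding lie_subalgebra_of_def by blast

lemma curve_eventually:
  assumes "((\<lambda>t::real. crd (\<gamma> t)) has_vector_derivative v) (at 0)" "\<gamma> 0 = \<one>" "open S" "org \<in> S"
  shows "\<forall>\<^sub>F t in nhds 0. crd (\<gamma> t) \<in> S"
proof -
  have "((\<lambda>t. crd (\<gamma> t)) \<longlongrightarrow> crd (\<gamma> 0)) (at 0)"
    using has_vector_derivative_continuous[OF assms(1)] by (simp add: continuous_at)
  then have "((\<lambda>t. crd (\<gamma> t)) \<longlongrightarrow> org) (nhds 0)"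
    using tendsto_at_iff_tendsto_nhds[of "\<lambda>t. crd (\<gamma> t)" 0] assms(2) by simp
  then show ?thesis using assms(3,4) by (rule topological_tendstoD)
qed

text \<open>Velocities add under products of curves, since the derivative of the multiplication at the identity
  is addition.\<close>

lemma subspace_hh: "subspace hh"
proof -
  have "0 \<in> hh"
    by (rule hhI[of "\<lambda>t. \<one>" "\<lambda>t. org"]) (auto simp: subgroup.one_closed[OF H] one_dom)
  moreover have "u + v \<in> hh" if u: "u \<in> hh" and v: "v \<in> hh" for u v
  proof -
    obtain \<gamma> where \<gamma>: "\<And>t::real. \<gamma> t \<in> H" "\<And>t. \<gamma> t \<in> fst \<kappa>" "\<gamma> 0 = \<one>"
      "((\<lambda>t. crd (\<gamma> t)) has_vector_derivative u) (at 0)" using hhE[OF u] by blast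
    obtain \<delta> where \<delta>: "\<And>t::real. \<delta> t \<in> H" "\<And>t. \<delta> t \<in> fst \<kappa>" "\<delta> 0 = \<one>"
      "((\<lambda>t. crd (\<delta> t)) has_vector_derivative v) (at 0)" using hhE[OF v] by blast
    have d: "((\<lambda>t. (crd (\<gamma> t), crd (\<delta> t))) has_vector_derivative (u, v)) (at 0)"
      by (intro has_vector_derivative_Pair \<gamma> \<delta>)
    show ?thesis
    proof (rule hhI[of "\<lambda>t. \<gamma> t \<otimes> \<delta> t" "\<lambda>t. mul (crd (\<gamma> t), crd (\<delta> t))"])
      show "\<gamma> t \<otimes> \<delta> t \<in> H" for t using subgroup.m_closed[OF H] \<gamma>(1) \<delta>(1) by blast
      show "\<gamma> 0 \<otimes> \<delta> 0 = \<one>" by (simp add: \<gamma> \<delta>)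
      have "((\<lambda>t. (crd (\<gamma> t), crd (\<delta> t))) \<longlongrightarrow> (org, org)) (nhds 0)"
        using has_vector_derivative_continuous[OF d]
          tendsto_at_iff_tendsto_nhds[of "\<lambda>t. (crd (\<gamma> t), crd (\<delta> t))" 0] \<gamma>(3) \<delta>(3)
        by (simp add: continuous_at)
      then have "\<forall>\<^sub>F t in nhds 0. (crd (\<gamma> t), crd (\<delta> t)) \<in> mul_dom"
        using open_mul_dom org2 by (rule topological_tendstoD)
      then show "\<forall>\<^sub>F t in nhds 0. \<gamma> t \<otimes> \<delta> t \<in> fst \<kappa> \<and> crd (\<gamma> t \<otimes> \<delta> t) = mul (crd (\<gamma> t), crd (\<delta> t))"
        by eventually_elim (simp add: mul_dom_def mul_def \<gamma>(2) \<delta>(2))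
      have "(mul has_derivative D mul (org, org)) (at (crd (\<gamma> 0), crd (\<delta> 0)))"
        using smooth_on_has_derivative[OF smooth_mul org2] by (simp add: \<gamma> \<delta>)
      from has_derivative_compose[OF d[unfolded has_vector_derivative_def] this]
      show "((\<lambda>t. mul (crd (\<gamma> t), crd (\<delta> t))) has_vector_derivative u + v) (at 0)"
        by (simp add: has_vector_derivative_def D_mul scaleR_add_right)
    qed
  qed
  moreover have "c *\<^sub>R u \<in> hh" if u: "u \<in> hh" for c u
  proof -
    obtain \<gamma> where \<gamma>: "\<And>t::real. \<gamma> t \<in> H" "\<And>t. \<gamma> t \<in> fst \<kappa>" "\<gamma> 0 = \<one>"
      "((\<lambda>t. crd (\<gamma> t)) has_vector_derivative u) (at 0)" using hhE[OF u] by blast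
    show ?thesis
    proof (rule hhI[of "\<lambda>t. \<gamma> (c * t)" "\<lambda>t. crd (\<gamma> (c * t))"])
      have "((\<lambda>t. c * t) has_derivative (\<lambda>t. c * t)) (at 0)" by (auto intro!: derivative_eq_intros)
      moreover have "((\<lambda>t. crd (\<gamma> t)) has_derivative (\<lambda>h. h *\<^sub>R u)) (at (c * 0))"
        using \<gamma>(4) by (simp add: has_vector_derivative_def)
      ultimately have "((\<lambda>t. crd (\<gamma> (c * t))) has_derivative (\<lambda>h. (c * h) *\<^sub>R u)) (at 0)"
        by (rule has_derivative_compose)
      then show "((\<lambda>t. crd (\<gamma> (c * t))) has_vector_derivative c *\<^sub>R u) (at 0)"
        by (simp add: has_vector_derivative_def mult.commute)
    qed (use \<gamma> in auto)
  qed
  ultimately show ?thesis by (simp add: subspace_def)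
qed

lemma hh_Ad: assumes a: "a \<in> H" and v: "v \<in> hh" shows "Ad G \<kappa> a v \<in> hh"
proof -
  note ac = H_carrier[OF a]
  obtain \<gamma> where \<gamma>: "\<And>t::real. \<gamma> t \<in> H" "\<And>t. \<gamma> t \<in> fst \<kappa>" "\<gamma> 0 = \<one>"
    "((\<lambda>t. crd (\<gamma> t)) has_vector_derivative v) (at 0)" using hhE[OF v] by blast
  obtain S where S: "smooth_on S (cnj a)" "org \<in> S" "S \<subseteq> U"
    "\<And>y. y \<in> S \<Longrightarrow> a \<otimes> pt y \<otimes> inv a \<in> fst \<kappa>" using smooth_cnj[OF ac] by blast
  show ?thesis
  proof (rule hhI[of "\<lambda>t. a \<otimes> \<gamma> t \<otimes> inv a" "\<lambda>t. cnj a (crd (\<gamma> t))"])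
    show "a \<otimes> \<gamma> t \<otimes> inv a \<in> H" for t
      using a \<gamma>(1) subgroup.m_closed[OF H] subgroup.m_inv_closed[OF H] by blast
    show "a \<otimes> \<gamma> 0 \<otimes> inv a = \<one>" using ac \<gamma>(3) by simp
    show "\<forall>\<^sub>F t in nhds 0. a \<otimes> \<gamma> t \<otimes> inv a \<in> fst \<kappa> \<and> crd (a \<otimes> \<gamma> t \<otimes> inv a) = cnj a (crd (\<gamma> t))"
      using curve_eventually[OF \<gamma>(4,3) smooth_onD_open[OF S(1)] S(2)]
      by eventually_elim (use S(4) \<gamma>(2) in \<open>force simp: cnj_def\<close>)
    have "(cnj a has_derivative D (cnj a) org) (at (crd (\<gamma> 0)))"
      using smooth_on_has_derivative[OF S(1,2)] by (simp add: \<gamma>)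
    from has_derivative_compose[OF \<gamma>(4)[unfolded has_vector_derivative_def] this]
    show "((\<lambda>t. cnj a (crd (\<gamma> t))) has_vector_derivative Ad G \<kappa> a v) (at 0)"
      using linear_scale[OF linear_Ad[OF ac]] by (simp add: has_vector_derivative_def Ad_cnj)
  qed
qed

text \<open>\<open>br z w\<close> is the velocity of the curve \<open>t \<mapsto> Ad (\<gamma> t) w\<close>, which stays in the subspace \<open>hh\<close>.\<close>

lemma hh_bracket: assumes z: "z \<in> hh" and w: "w \<in> hh" shows "br z w \<in> hh"
proof -
  obtain \<gamma> where \<gamma>: "\<And>t::real. \<gamma> t \<in> H" "\<And>t. \<gamma> t \<in> fst \<kappa>" "\<gamma> 0 = \<one>"
    "((\<lambda>t. crd (\<gamma> t)) has_vector_derivative z) (at 0)" using hhE[OF z] by blast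
  show ?thesis
    by (rule has_vector_derivative_in_subspace[OF subspace_hh _ Ad_curve_derivative[OF \<gamma>(2-4), of w]])
      (rule hh_Ad[OF \<gamma>(1) w])
qed

lemma pp_iff: "x \<in> pp \<longleftrightarrow> (\<forall>y\<in>hh. B x y = 0)"
  by (simp add: isotropy_complement_def B_def)

lemma subspace_pp: "subspace pp"
  by (auto simp: subspace_def pp_iff bilinear_simps[OF B_bilinear])

lemma pp_hh_zero: assumes "x \<in> pp" "x \<in> hh" shows "x = 0"
  using assms B_pos by (force simp: pp_iff pos_def_on_def)

lemma ex_decomposition: "\<exists>y. y \<in> pp \<and> x - y \<in> hh"
proof -
  obtain E where E: "orthonormal_basis_on hh B E"
    using ex_orthonormal_basis[OF subspace_hh B_form] B_pos by (auto simp: pos_def_on_def)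
  define w where "w = (\<Sum>e\<in>E. B x e *\<^sub>R e)"
  have w: "w \<in> hh" unfolding w_def
    using subspace_hh onbD(1)[OF E] by (intro subspace_sum subspace_scale) auto
  have "B (x - w) y = 0" if y: "y \<in> hh" for y
  proof -
    have "B x y = B y x" by (rule B_commute)
    also have "\<dots> = (\<Sum>e\<in>E. B y e * B e x)" by (rule onb_parseval[OF B_bilinear E y])
    also have "\<dots> = B w y"
      by (simp add: w_def bilinear_sum_left[OF B_bilinear] bilinear_simps[OF B_bilinear] B_commute[of y] B_commute[of _ x] mult.commute)
    finally show ?thesis by (simp add: bilinear_simps[OF B_bilinear])
  qed
  then show ?thesis using w by (intro exI[of _ "x - w"]) (simp add: pp_iff)
qed

lemma decomposition_unique:
  assumes "y \<in> pp" "x - y \<in> hh" "y' \<in> pp" "x - y' \<in> hh" shows "y = y'"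
proof -
  have "y - y' \<in> pp" using subspace_diff[OF subspace_pp] assms by blast
  moreover have "(x - y') - (x - y) \<in> hh" using subspace_diff[OF subspace_hh] assms by blast
  ultimately show ?thesis using pp_hh_zero[of "y - y'"] by simp
qed

lemma pr_mem: "pr x \<in> pp" "x - pr x \<in> hh"
proof -
  have "\<exists>!y. y \<in> pp \<and> x - y \<in> hh" using ex_decomposition decomposition_unique by blast
  from theI'[OF this] show "pr x \<in> pp" "x - pr x \<in> hh" by (auto simp: isotropy_proj_def)
qed

lemma pr_eqI: "y \<in> pp \<Longrightarrow> x - y \<in> hh \<Longrightarrow> pr x = y"
  using decomposition_unique pr_mem by blast

lemma pr_pp [simp]: "x \<in> pp \<Longrightarrow> pr x = x"
  by (rule pr_eqI) (auto simp: subspace_0[OF subspace_hh])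

lemma pr_hh [simp]: "x \<in> hh \<Longrightarrow> pr x = 0"
  by (rule pr_eqI) (auto simp: subspace_0[OF subspace_pp])

lemma pr_pr [simp]: "pr (pr x) = pr x" by (rule pr_pp[OF pr_mem(1)])

lemma linear_pr: "linear pr"
proof (rule linearI)
  show "pr (x + y) = pr x + pr y" for x y
    using subspace_add[OF subspace_hh pr_mem(2)[of x] pr_mem(2)[of y]]
    by (intro pr_eqI subspace_add[OF subspace_pp] pr_mem(1)) (simp add: algebra_simps)
  show "pr (c *\<^sub>R x) = c *\<^sub>R pr x" for c x
    using subspace_scale[OF subspace_hh pr_mem(2)[of x], of c]
    by (intro pr_eqI subspace_scale[OF subspace_pp] pr_mem(1)) (simp add: algebra_simps)
qed

lemmas pr_simps = linear_add[OF linear_pr] linear_diff[OF linear_pr] linear_scale[OF linear_pr]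
  linear_neg[OF linear_pr] linear_0[OF linear_pr]

lemma hh_pp_bracket: "z \<in> hh \<Longrightarrow> x \<in> pp \<Longrightarrow> br z x \<in> pp"
  by (simp add: pp_iff B_ad hh_bracket)

lemma pp_Ad: assumes a: "a \<in> H" and x: "x \<in> pp" shows "Ad G \<kappa> a x \<in> pp"
  unfolding pp_iff
proof
  fix y assume y: "y \<in> hh"
  have ac: "a \<in> carrier G" "inv a \<in> H" using H_carrier[OF a] subgroup.m_inv_closed[OF H a] by auto
  have "B (Ad G \<kappa> a x) y = B (Ad G \<kappa> a x) (Ad G \<kappa> a (Ad G \<kappa> (inv a) y))" using ac by (simp add: Ad_inv)
  also have "\<dots> = B x (Ad G \<kappa> (inv a) y)" by (simp add: B_def kf_Ad[OF ac(1)])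
  also have "\<dots> = 0" using x hh_Ad[OF ac(2) y] by (simp add: pp_iff)
  finally show "B (Ad G \<kappa> a x) y = 0" .
qed

end


section \<open>The Maurer-Cartan structure equation\<close>

context lie_chart
begin

text \<open>The quotient \<open>x\<^sup>-\<^sup>1 y\<close> in the chart; its derivative in \<open>y\<close> along the diagonal is the
  Maurer-Cartan form.\<close>

definition quo :: "'a \<times> 'a \<Rightarrow> 'a" where "quo p = crd (inv (pt (fst p)) \<otimes> pt (snd p))"
definition quo_dom :: "('a \<times> 'a) set" where
  "quo_dom = {p \<in> ivt_dom \<times> UNIV. (ivt (fst p), snd p) \<in> mul_dom}"

lemma quo_eq: "p \<in> quo_dom \<Longrightarrow> mul (ivt (fst p), snd p) = quo p"
  by (auto simp: quo_dom_def quo_def mul_def ivt_domD)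

lemma open_quo_base: "open (ivt_dom \<times> (UNIV :: 'a set))"
  by (intro open_Times open_ivt_dom) simp

lemma smooth_quo_arg: "smooth_on (ivt_dom \<times> UNIV) (\<lambda>p. (ivt (fst p), snd p :: 'a))"
  by (intro smooth_on_Pair smooth_on_linear[OF open_quo_base bounded_linear_snd]
      smooth_on_compose[OF smooth_on_linear[OF open_quo_base bounded_linear_fst] smooth_ivt]) auto

lemma open_quo_dom: "open quo_dom"
  unfolding quo_dom_def by (rule smooth_on_vimage_open[OF smooth_quo_arg open_mul_dom])

lemma smooth_quo_arg': "smooth_on quo_dom (\<lambda>p. (ivt (fst p), snd p))"
  by (rule smooth_on_subset[OF smooth_quo_arg open_quo_dom]) (auto simp: quo_dom_def)

lemma smooth_quo: "smooth_on quo_dom quo"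
  by (rule smooth_on_cong[OF smooth_on_compose[OF smooth_quo_arg' smooth_mul]])
    (auto simp: quo_dom_def quo_eq)

lemma quo_domD: "(a, b) \<in> quo_dom \<Longrightarrow> a \<in> ivt_dom" "(a, b) \<in> quo_dom \<Longrightarrow> a \<in> U"
  "(a, b) \<in> quo_dom \<Longrightarrow> b \<in> U"
  "(a, b) \<in> quo_dom \<Longrightarrow> quo (a, b) \<in> U" "(a, b) \<in> quo_dom \<Longrightarrow> pt (quo (a, b)) = inv (pt a) \<otimes> pt b"
  by (auto simp: quo_dom_def quo_def mul_dom_def ivt_domD)

lemma quo_diag: "y \<in> ivt_dom \<Longrightarrow> (y, y) \<in> quo_dom" "y \<in> ivt_dom \<Longrightarrow> quo (y, y) = org"
  by (auto simp: quo_dom_def quo_def mul_dom_def ivt_domD one_dom)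

lemma quo_org: "y \<in> U \<Longrightarrow> quo (org, y) = y"
  by (simp add: quo_def)

lemma D2_quo_org: "D2 quo (org, org) (0, u) (v, 0) = - beta v u"
proof -
  have o: "(org, org) \<in> quo_dom" using quo_diag org_ivt by blast
  let ?f = "\<lambda>p. (ivt (fst p), snd p)"
  have sf: "smooth_on quo_dom (\<lambda>p. ivt (fst p))"
    by (rule smooth_on_compose[OF smooth_on_linear[OF open_quo_dom bounded_linear_fst] smooth_ivt])
      (auto simp: quo_dom_def)
  have ss: "smooth_on quo_dom (snd :: 'a \<times> 'a \<Rightarrow> 'a)" by (rule smooth_on_linear[OF open_quo_dom bounded_linear_snd])
  have Di: "D (\<lambda>p. ivt (fst p)) (org, org) w = - fst w" for w :: "'a \<times> 'a"
    using D_compose[OF smooth_on_linear[OF open_quo_dom bounded_linear_fst] smooth_ivt o] org_ivt(1)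
    by (simp add: D_bounded_linear bounded_linear_fst D_ivt)
  have Df: "D ?f (org, org) w = (- fst w, snd w)" for w
    using D_Pair[OF smooth_on_differentiable[OF sf o] smooth_on_differentiable[OF ss o], of w]
    by (simp add: Di D_bounded_linear bounded_linear_snd)
  have fst_quo_dom: "fst ` quo_dom \<subseteq> ivt_dom" by (auto simp: quo_dom_def)
  have D2i: "D2 (\<lambda>p. ivt (fst p)) (org, org) (0, u) (v, 0) = 0"
    using D2_compose[OF smooth_on_linear[OF open_quo_dom bounded_linear_fst] smooth_ivt o, of "(0, u)" "(v, 0)"]
      linear_0[OF linear_D2_left[OF smooth_ivt org_ivt(1)]] linear_0[OF smooth_on_linear_D[OF smooth_ivt org_ivt(1)]]
      fst_quo_dom
    by (simp add: D_bounded_linear D2_bounded_linear bounded_linear_fst)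
  have D2f: "D2 ?f (org, org) (0, u) (v, 0) = 0"
    unfolding D2_Pair[OF sf ss o] D2i by (simp add: D2_bounded_linear bounded_linear_snd zero_prod_def)
  have "D2 quo (org, org) (0, u) (v, 0) = D2 (\<lambda>p. mul (?f p)) (org, org) (0, u) (v, 0)"
    by (subst D2_cong[OF open_quo_dom o, of quo "\<lambda>p. mul (?f p)"]) (simp_all add: quo_eq)
  also have "\<dots> = D2 mul (org, org) (0, u) (- v, 0) + D mul (org, org) 0"
    by (subst D2_compose[OF smooth_quo_arg' smooth_mul o])
      (auto simp: Df D2f org_ivt quo_dom_def)
  also have "\<dots> = beta (- v) u"
    by (simp add: beta_def linear_0[OF smooth_on_linear_D[OF smooth_mul org2]])
  finally show ?thesis by (simp add: linear_neg[OF linear_beta(2)])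
qed

text \<open>Left invariance says that \<open>quo\<close> does not change when both arguments are translated by the
  inverse of \<open>y\<close>. So on the diagonal its mixed second derivative is that at the identity, evaluated
  on the translated vectors.\<close>

lemma D2_quo:
  assumes y: "y \<in> ivt_dom"
  shows "D2 quo (y, y) (0, u) (v, 0) = - beta (D quo (y, y) (0, v)) (D quo (y, y) (0, u))"
proof -
  define \<phi> where "\<phi> b = quo (y, b)" for b
  define S where "S = {b \<in> UNIV. (y, b) \<in> quo_dom}"
  have sP: "smooth_on UNIV (\<lambda>b. (y, b))" by (intro smooth_on_Pair smooth_on_const smooth_on_ident) auto
  have S: "open S" unfolding S_def by (rule smooth_on_vimage_open[OF sP open_quo_dom])
  have s\<phi>: "smooth_on S \<phi>" unfolding \<phi>_def
    by (rule smooth_on_compose[OF smooth_on_subset[OF sP S] smooth_quo]) (auto simp: S_def)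
  have yS: "y \<in> S" using quo_diag[OF y] by (simp add: S_def)
  have D\<phi>: "D \<phi> y w = D quo (y, y) (0, w)" for w
    unfolding \<phi>_def by (rule D_second[OF smooth_quo quo_diag(1)[OF y]])
  have \<phi>y: "\<phi> y = org" by (simp add: \<phi>_def quo_diag y)
  define \<Psi> where "\<Psi> p = (\<phi> (fst p), \<phi> (snd p))" for p
  have SS: "open (S \<times> S)" using S by (simp add: open_Times)
  have s\<Psi>0: "smooth_on (S \<times> S) \<Psi>" unfolding \<Psi>_def
    by (intro smooth_on_Pair smooth_on_compose[OF smooth_on_linear[OF SS bounded_linear_fst] s\<phi>]
        smooth_on_compose[OF smooth_on_linear[OF SS bounded_linear_snd] s\<phi>]) auto
  define W where "W = {p \<in> S \<times> S. \<Psi> p \<in> quo_dom} \<inter> quo_dom"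
  have W: "open W" unfolding W_def
    by (intro open_Int smooth_on_vimage_open[OF s\<Psi>0] open_quo_dom)
  have s\<Psi>: "smooth_on W \<Psi>" by (rule smooth_on_subset[OF s\<Psi>0 W]) (auto simp: W_def)
  have o: "(y, y) \<in> W" using yS quo_diag[OF y] quo_diag[OF org_ivt(1)] by (simp add: W_def \<Psi>_def \<phi>y)
  have eq: "quo p = quo (\<Psi> p)" if "p \<in> W" for p
  proof -
    obtain a b where p: "p = (a, b)" by (cases p)
    have d: "(y, a) \<in> quo_dom" "(y, b) \<in> quo_dom" using that by (auto simp: W_def S_def p)
    have c: "pt y \<in> carrier G" "pt a \<in> carrier G" "pt b \<in> carrier G"
      using quo_domD(2,3)[OF d(1)] quo_domD(3)[OF d(2)] by auto
    have "inv (inv (pt y) \<otimes> pt a) \<otimes> (inv (pt y) \<otimes> pt b) = inv (pt a) \<otimes> (pt y \<otimes> (inv (pt y) \<otimes> pt b))"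
      using c by (simp add: inv_mult_group m_assoc)
    also have "pt y \<otimes> (inv (pt y) \<otimes> pt b) = pt b" using c by (simp add: m_assoc[symmetric])
    finally show ?thesis
      using quo_domD(5)[OF d(1)] quo_domD(5)[OF d(2)] by (simp add: p \<Psi>_def \<phi>_def quo_def[of "(quo _, _)"] quo_def[of "(a, b)"])
  qed
  have D\<Psi>: "D \<Psi> (y, y) w = (D \<phi> y (fst w), D \<phi> y (snd w))" for w
    unfolding \<Psi>_def using D_prod_map[OF s\<phi>, of "(y, y)"] yS by simp
  have D2\<Psi>: "D2 \<Psi> (y, y) (0, u) (v, 0) = 0"
    unfolding \<Psi>_def using D2_prod_map[OF s\<phi>, of "(y, y)"] yS by simp
  have oo: "(org, org) \<in> quo_dom" using quo_diag org_ivt by blast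
  have "D2 quo (y, y) (0, u) (v, 0) = D2 (\<lambda>p. quo (\<Psi> p)) (y, y) (0, u) (v, 0)"
    by (subst D2_cong[OF W o, of quo "\<lambda>p. quo (\<Psi> p)"]) (simp_all add: eq)
  also have "\<dots> = D2 quo (org, org) (0, D \<phi> y u) (D \<phi> y v, 0) + D quo (org, org) 0"
    by (subst D2_compose[OF s\<Psi> smooth_quo o])
      (auto simp: W_def D\<Psi> D2\<Psi> \<Psi>_def \<phi>y linear_0[OF smooth_on_linear_D[OF s\<phi> yS]])
  finally show ?thesis
    by (simp add: D2_quo_org D\<phi> linear_0[OF smooth_on_linear_D[OF smooth_quo oo]])
qed

abbreviation th :: "'a \<Rightarrow> 'a \<Rightarrow> 'a" where "th \<equiv> maurer_cartan G \<kappa>"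
definition th_dom :: "'a set" where "th_dom = {x \<in> UNIV. org + x \<in> ivt_dom}"
abbreviation dth :: "'a \<Rightarrow> 'a \<Rightarrow> 'a \<Rightarrow> 'a" where "dth x v u \<equiv> D (\<lambda>y. th y v) x u"

lemma smooth_shift: "open S \<Longrightarrow> smooth_on S (\<lambda>x. org + x)"
  by (intro smooth_on_add smooth_on_const smooth_on_ident)

lemma open_th_dom: "open th_dom"
  unfolding th_dom_def by (rule smooth_on_vimage_open[OF smooth_shift open_ivt_dom]) simp

lemma zero_th_dom: "0 \<in> th_dom" by (simp add: th_dom_def org_ivt)

lemma th_eq: assumes "x \<in> th_dom" shows "th x u = D quo (org + x, org + x) (0, u)"
proof -
  have y: "(org + x, org + x) \<in> quo_dom" using quo_diag(1) assms by (simp add: th_dom_def)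
  have 1: "((\<lambda>y. (org + x, org + y)) has_derivative (\<lambda>u. (0, u))) (at x)"
    by (auto intro!: derivative_eq_intros)
  from D_eqI[OF has_derivative_compose[OF 1 smooth_on_has_derivative[OF smooth_quo y]]]
  show ?thesis by (simp add: maurer_cartan_def quo_def)
qed

lemma smooth_diag: "smooth_on th_dom (\<lambda>x. (org + x, org + x))"
  by (intro smooth_on_Pair smooth_shift open_th_dom)

lemma smooth_th: "smooth_on th_dom (\<lambda>x. th x u)"
  by (rule smooth_on_cong[OF smooth_on_compose[OF smooth_diag smooth_on_D[OF smooth_quo, of "(0, u)"]]])
    (auto simp: th_dom_def quo_diag th_eq)

lemma linear_th: "x \<in> th_dom \<Longrightarrow> linear (th x)"
proof -
  assume x: "x \<in> th_dom"
  then have y: "(org + x, org + x) \<in> quo_dom" using quo_diag(1) by (simp add: th_dom_def)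
  have "linear (\<lambda>u. (0 :: 'a, u :: 'a))" by (auto intro!: linearI)
  from linear_compose[OF this smooth_on_linear_D[OF smooth_quo y]]
  moreover have "th x = (\<lambda>u. D quo (org + x, org + x) (0, u))" using th_eq[OF x] by blast
  ultimately show ?thesis by (simp add: o_def)
qed

lemma th_0: "th 0 u = u"
proof -
  have o: "(org, org) \<in> quo_dom" using quo_diag org_ivt by blast
  have "th 0 u = D (\<lambda>y. quo (org, y)) org u"
    using D_second[OF smooth_quo o] zero_th_dom by (simp add: th_eq)
  also have "\<dots> = D (\<lambda>y. y) org u"
    using D_cong[OF open_U org_U, of "\<lambda>y. quo (org, y)" "\<lambda>y. y"] quo_org by auto
  finally show ?thesis by simp
qed

text \<open>The derivative of \<open>th x u\<close> in the direction \<open>v\<close> moves both arguments of \<open>quo\<close>. The part that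
  differentiates twice in the second argument is symmetric in \<open>u\<close> and \<open>v\<close>; the mixed part is given
  by \<open>D2_quo\<close>.\<close>

theorem structure_equation:
  assumes x: "x \<in> th_dom"
  shows "dth x u v - dth x v u = br (th x u) (th x v)"
proof -
  let ?y = "org + x"
  have y: "?y \<in> ivt_dom" using x by (simp add: th_dom_def)
  have yq: "(?y, ?y) \<in> quo_dom" using quo_diag(1)[OF y] .
  have d: "dth x u v = D2 quo (?y, ?y) (0, u) (v, 0) + D2 quo (?y, ?y) (0, u) (0, v)" for u v
  proof -
    have Dd: "D (\<lambda>x. (org + x, org + x)) x v = (v, v)"
      by (rule fun_cong[OF D_eqI]) (auto intro!: derivative_eq_intros)
    have "dth x u v = D (\<lambda>x. D quo (org + x, org + x) (0, u)) x v"
      using D_cong[OF open_th_dom x, of "\<lambda>y. th y u"] th_eq by simp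
    also have "\<dots> = D2 quo (?y, ?y) (0, u) (v, v)"
      using D_compose[OF smooth_diag smooth_on_D[OF smooth_quo, of "(0, u)"] x] yq
      by (simp add: D2_def Dd)
    also have "(v, v) = (v, 0) + (0, v)" by simp
    finally show ?thesis
      using linear_add[OF linear_D2_right[OF smooth_quo yq]] by metis
  qed
  have "dth x u v - dth x v u = D2 quo (?y, ?y) (0, u) (v, 0) - D2 quo (?y, ?y) (0, v) (u, 0)"
    using D2_commute[OF smooth_quo yq, of "(0, u)" "(0, v)"] by (simp add: d)
  also have "\<dots> = beta (th x u) (th x v) - beta (th x v) (th x u)"
    by (simp add: D2_quo[OF y] th_eq[OF x])
  finally show ?thesis by (simp add: bracket_beta)
qed

lemma th_line: "x \<in> th_dom \<Longrightarrow> ((\<lambda>t. th (x + t *\<^sub>R u) v) has_vector_derivative dth x v u) (at 0)"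
  using has_vector_derivative_along_line[OF smooth_th, of x 0 u v] by simp

lemma dth_line: "((\<lambda>t. dth (t *\<^sub>R u) w v) has_vector_derivative D2 (\<lambda>y. th y w) 0 v u) (at 0)"
  using has_vector_derivative_along_line[OF smooth_on_D[OF smooth_th], of 0 0 u w v] zero_th_dom
  by (simp add: D2_def)

end


section \<open>The curvature of an invariant metric\<close>

text \<open>At a zero of \<open>n\<close> continuity of \<open>c\<close> suffices for the product rule, because \<open>(c t - c 0) n t\<close>
  is of smaller order than \<open>t\<close>.\<close>

lemma has_vector_derivative_scaleR_vanishing:
  fixes c :: "real \<Rightarrow> real" and n :: "real \<Rightarrow> 'a::real_normed_vector"
  assumes c: "(c \<longlongrightarrow> c 0) (at 0)" and n: "(n has_vector_derivative n') (at 0)" and n0: "n 0 = 0"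
  shows "((\<lambda>t. c t *\<^sub>R n t) has_vector_derivative c 0 *\<^sub>R n') (at 0)"
proof -
  have 1: "((\<lambda>t. (n t - t *\<^sub>R n') /\<^sub>R \<bar>t\<bar>) \<longlongrightarrow> 0) (at 0)"
    using n by (simp add: has_vector_derivative_def has_derivative_def n0)
  have 2: "((\<lambda>t. (c t - c 0) *\<^sub>R ((t / \<bar>t\<bar>) *\<^sub>R n')) \<longlongrightarrow> 0) (at 0)"
  proof (rule Lim_null_comparison)
    show "\<forall>\<^sub>F t in at 0. norm ((c t - c 0) *\<^sub>R ((t / \<bar>t\<bar>) *\<^sub>R n')) \<le> \<bar>c t - c 0\<bar> * norm n'"
    proof (rule always_eventually, rule allI)
      fix t :: real
      show "norm ((c t - c 0) *\<^sub>R ((t / \<bar>t\<bar>) *\<^sub>R n')) \<le> \<bar>c t - c 0\<bar> * norm n'"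
        by (cases "t = 0") (auto simp: abs_mult)
    qed
    have "((\<lambda>t. c t - c 0) \<longlongrightarrow> 0) (at 0)" using c by (simp add: LIM_zero)
    then show "((\<lambda>t. \<bar>c t - c 0\<bar> * norm n') \<longlongrightarrow> 0) (at 0)"
      by (intro tendsto_mult_left_zero tendsto_rabs_zero)
  qed
  have "((\<lambda>t. c t *\<^sub>R ((n t - t *\<^sub>R n') /\<^sub>R \<bar>t\<bar>) + (c t - c 0) *\<^sub>R ((t / \<bar>t\<bar>) *\<^sub>R n')) \<longlongrightarrow> c 0 *\<^sub>R 0 + 0) (at 0)"
    by (intro tendsto_add tendsto_scaleR c 1 2)
  moreover have "c t *\<^sub>R ((n t - t *\<^sub>R n') /\<^sub>R \<bar>t\<bar>) + (c t - c 0) *\<^sub>R ((t / \<bar>t\<bar>) *\<^sub>R n') =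
      (c t *\<^sub>R n t - t *\<^sub>R (c 0 *\<^sub>R n')) /\<^sub>R \<bar>t\<bar>" for t
    by (simp add: algebra_simps divide_inverse scaleR_diff_left)
  ultimately have "((\<lambda>t. (c t *\<^sub>R n t - t *\<^sub>R (c 0 *\<^sub>R n')) /\<^sub>R \<bar>t\<bar>) \<longlongrightarrow> 0) (at 0)" by simp
  moreover have "bounded_linear (\<lambda>x. x *\<^sub>R (c 0 *\<^sub>R n'))" by (rule bounded_linear_scaleR_left)
  ultimately show ?thesis
    unfolding has_vector_derivative_def has_derivative_def by (simp add: n0)
qed

text \<open>The equation reads \<open>G + N G = F\<close> with a linear map \<open>N\<close> depending on \<open>t\<close> that vanishes at \<open>0\<close>. As
  \<open>G\<close> is bounded, \<open>N G\<close> tends to \<open>0\<close>, so \<open>G\<close> is continuous at \<open>0\<close>, and then \<open>N G\<close> is differentiable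
  there by the previous lemma. The inverse of \<open>1 + N\<close> is never differentiated.\<close>

lemma perturbed_identity_derivative:
  fixes G F :: "real \<Rightarrow> 'a::euclidean_space" and n :: "'a \<Rightarrow> real \<Rightarrow> 'a"
  assumes g: "bilinear (g :: 'a \<Rightarrow> 'a \<Rightarrow> real)"
    and eq: "\<forall>\<^sub>F t in nhds 0. G t + (\<Sum>e\<in>E. g (G t) e *\<^sub>R n e t) = F t"
    and bd: "\<forall>\<^sub>F t in nhds 0. norm (G t) \<le> 2 * norm (F t)"
    and n: "\<And>e. e \<in> E \<Longrightarrow> (n e has_vector_derivative n' e) (at 0)" "\<And>e. n e 0 = 0"
    and F: "(F has_vector_derivative F') (at 0)"
  shows "(G has_vector_derivative F' - (\<Sum>e\<in>E. g (G 0) e *\<^sub>R n' e)) (at 0)"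
proof -
  have G0: "G 0 = F 0" using eventually_nhds_x_imp_x[OF eq] by (simp add: n)
  have Fc: "(F \<longlongrightarrow> F 0) (at 0)"
    using has_vector_derivative_continuous[OF F] by (simp add: continuous_at)
  have nc: "(n e \<longlongrightarrow> 0) (at 0)" if "e \<in> E" for e
    using has_vector_derivative_continuous[OF n(1)[OF that]] by (simp add: continuous_at n)
  have bl: "bounded_linear (\<lambda>x. g x e)" for e
    using bilinear_linear(2)[OF g] by (simp add: linear_conv_bounded_linear)
  have eq': "\<forall>\<^sub>F t in at 0. G t = F t - (\<Sum>e\<in>E. g (G t) e *\<^sub>R n e t)"
    using eq unfolding eventually_nhds_conv_at by (auto elim: eventually_mono simp: algebra_simps)
  have small: "((\<lambda>t. \<Sum>e\<in>E. g (G t) e *\<^sub>R n e t) \<longlongrightarrow> 0) (at 0)"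
  proof (rule tendsto_null_sum)
    fix e assume e: "e \<in> E"
    obtain K where K: "K > 0" "\<And>x. norm (g x e) \<le> norm x * K"
      using bounded_linear.pos_bounded[OF bl[of e]] by blast
    show "((\<lambda>t. g (G t) e *\<^sub>R n e t) \<longlongrightarrow> 0) (at 0)"
    proof (rule Lim_null_comparison)
      show "\<forall>\<^sub>F t in at 0. norm (g (G t) e *\<^sub>R n e t) \<le> (2 * norm (F t) * K) * norm (n e t)"
        using bd unfolding eventually_nhds_conv_at
      proof (elim conjE eventually_mono)
        fix t assume "norm (G t) \<le> 2 * norm (F t)"
        then have "norm (g (G t) e) \<le> 2 * norm (F t) * K"
          using K(2)[of "G t"] K(1) by (meson less_imp_le mult_right_mono order_trans)
        then show "norm (g (G t) e *\<^sub>R n e t) \<le> (2 * norm (F t) * K) * norm (n e t)"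
          by (simp add: mult_right_mono)
      qed
      have "((\<lambda>t. (2 * norm (F t) * K) * norm (n e t)) \<longlongrightarrow> (2 * norm (F 0) * K) * norm (0::'a)) (at 0)"
        by (intro tendsto_mult tendsto_const tendsto_norm Fc nc e)
      then show "((\<lambda>t. (2 * norm (F t) * K) * norm (n e t)) \<longlongrightarrow> 0) (at 0)" by simp
    qed
  qed
  have "((\<lambda>t. F t - (\<Sum>e\<in>E. g (G t) e *\<^sub>R n e t)) \<longlongrightarrow> F 0 - 0) (at 0)"
    by (intro tendsto_diff Fc small)
  then have Gc: "(G \<longlongrightarrow> G 0) (at 0)"
    using tendsto_cong[OF eq'] by (simp add: G0)
  have "((\<lambda>t. F t - (\<Sum>e\<in>E. g (G t) e *\<^sub>R n e t)) has_vector_derivative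
      F' - (\<Sum>e\<in>E. g (G 0) e *\<^sub>R n' e)) (at 0)"
    by (intro has_vector_derivative_diff F has_vector_derivative_sum has_vector_derivative_scaleR_vanishing
        bounded_linear.tendsto[OF bl Gc] n)
  moreover have "\<forall>\<^sub>F t in nhds 0. F t - (\<Sum>e\<in>E. g (G t) e *\<^sub>R n e t) = G t"
    using eq by eventually_elim (simp add: algebra_simps)
  then obtain S where "open S" "0 \<in> S" "\<And>t. t \<in> S \<Longrightarrow> F t - (\<Sum>e\<in>E. g (G t) e *\<^sub>R n e t) = G t"
    unfolding eventually_nhds by blast
  ultimately show ?thesis by (rule has_vector_derivative_transform_within_open)
qed

locale invariant_metric = compact_homogeneous G T A \<kappa> H
  for G :: "('g, 'm) monoid_scheme" (structure)
    and T :: "'g topology" and A :: "('g, 'a::euclidean_space) chart set"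
    and \<kappa> :: "('g, 'a) chart" and H :: "'g set" +
  fixes g :: "'a \<Rightarrow> 'a \<Rightarrow> real"
  assumes g: "g \<in> invariant_inner_products G \<kappa> H"
begin

lemma g_pr: "g x y = g (pr x) (pr y)"
  using g by (auto simp: invariant_inner_products_def)

lemma g_pp: "inner_product_on pp g"
  using g by (auto simp: invariant_inner_products_def)

lemma g_commute: "g x y = g y x"
  using g_pp g_pr[of x y] g_pr[of y x] pr_mem(1) by (simp add: inner_product_on_def)

lemma g_bilinear: "bilinear g"
proof -
  have "linear (\<lambda>x. g x y)" for y
  proof (rule linearI)
    fix u v :: 'a and c :: real
    show "g (u + v) y = g u y + g v y"
      using g_pp pr_mem(1) g_pr[of "u + v" y] g_pr[of u y] g_pr[of v y]
      by (simp add: inner_product_on_def pr_simps)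
    show "g (c *\<^sub>R u) y = c *\<^sub>R g u y"
      using g_pp pr_mem(1) g_pr[of "c *\<^sub>R u" y] g_pr[of u y]
      by (simp add: inner_product_on_def pr_simps)
  qed
  moreover from this have "linear (g y)" for y
    using g_commute by (metis (no_types, lifting) ext)
  ultimately show ?thesis by (simp add: bilinear_def)
qed

lemma g_form: "symmetric_form g"
  using g_bilinear g_commute by (simp add: symmetric_form_def)

lemma g_pos: "pos_def_on pp g"
  using g_pp by (simp add: inner_product_on_def pos_def_on_def)

lemmas g_simps = bilinear_simps[OF g_bilinear]

lemma g_pr_left [simp]: "g (pr x) y = g x y" and g_pr_right [simp]: "g x (pr y) = g x y"
  using g_pr[of "pr x" y] g_pr[of x "pr y"] g_pr[of x y] by simp_all

lemma g_hh: "z \<in> hh \<Longrightarrow> g z y = 0" "z \<in> hh \<Longrightarrow> g y z = 0"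
  using g_pr[of z y] g_pr[of y z] by (simp_all add: g_simps)

text \<open>Invariance is differentiated along curves in \<open>H\<close>. On components in \<open>hh\<close> both
  sides vanish, because \<open>hh\<close> is a subalgebra on which \<open>g\<close> is zero.\<close>

lemma g_ad_hh: assumes z: "z \<in> hh" shows "g (br z x) y = - g x (br z y)"
proof -
  have pp: "g (br z x) y + g x (br z y) = 0" if x: "x \<in> pp" and y: "y \<in> pp" for x y
  proof -
    obtain \<gamma> where \<gamma>: "\<And>t::real. \<gamma> t \<in> H" "\<And>t. \<gamma> t \<in> fst \<kappa>" "\<gamma> 0 = \<one>"
      "((\<lambda>t. crd (\<gamma> t)) has_vector_derivative z) (at 0)" using hhE[OF z] by blast
    show ?thesis
      by (rule skew_of_invariant[OF g_bilinear \<gamma>(2-4)])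
        (use g \<gamma>(1) x y in \<open>auto simp: invariant_inner_products_def\<close>)
  qed
  have "g (br z x) y = g (br z (pr x)) (pr y)" for x y
  proof -
    have "br z (x - pr x) \<in> hh" by (rule hh_bracket[OF z pr_mem(2)])
    from g_hh(1)[OF this, of y] show ?thesis by (simp add: br_simps g_simps)
  qed
  then show ?thesis using pp[of "pr x" "pr y"] pr_mem(1) g_commute by (metis add_eq_0_iff2)
qed

definition onb :: "'a set" where "onb = (SOME E. orthonormal_basis_on pp g E)"

lemma onb: "orthonormal_basis_on pp g onb"
  unfolding onb_def by (rule someI_ex) (rule ex_orthonormal_basis[OF subspace_pp g_form g_pos])

definition lam :: "'a \<Rightarrow> 'a \<Rightarrow> 'a \<Rightarrow> real" where
  "lam x y z = (g (br x y) z + g (br z x) y + g (br z y) x) / 2"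

text \<open>On \<open>pp\<close>, this is the Nomizu map of the Levi-Civita connection: the map with values in \<open>pp\<close> that is
  skew with respect to \<open>g\<close> and satisfies \<open>Lam x y - Lam y x = pr (br x y)\<close>.\<close>

definition Lam :: "'a \<Rightarrow> 'a \<Rightarrow> 'a" where "Lam x y = (\<Sum>e\<in>onb. lam x y e *\<^sub>R e)"

lemma Lam_pp: "Lam x y \<in> pp"
  unfolding Lam_def using subspace_pp onbD(1)[OF onb] by (intro subspace_sum subspace_scale) auto

lemma g_Lam: assumes "z \<in> pp" shows "g (Lam x y) z = lam x y z"
proof -
  have "linear (lam x y)" by (auto simp: lam_def linear_iff g_simps br_simps algebra_simps add_divide_distrib)
  then have "lam x y z = (\<Sum>e\<in>onb. g z e * lam x y e)"
    by (subst onb_expansion[OF g_bilinear onb assms]) (simp add: linear_sum linear_scale)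
  then show ?thesis
    by (simp add: Lam_def bilinear_sum_left[OF g_bilinear] g_simps g_commute[of z] mult.commute)
qed

lemma bilinear_Lam: "bilinear Lam"
proof -
  have "linear (\<lambda>x. lam x y e)" "linear (\<lambda>x. lam y x e)" for y e
    by (auto simp: lam_def linear_iff g_simps br_simps algebra_simps add_divide_distrib)
  then have "linear (\<lambda>x. lam x y e *\<^sub>R e)" "linear (\<lambda>x. lam y x e *\<^sub>R e)" for y e
    by (auto simp: linear_iff scaleR_add_left)
  then show ?thesis unfolding bilinear_def Lam_def by (auto intro!: linear_compose_sum)
qed

lemma bilinear_br: "bilinear br"
  by (simp add: bilinear_def linear_br_left linear_br_right)

text \<open>Split \<open>a\<close>, \<open>b\<close>, \<open>c\<close> into their components in \<open>pp\<close> and \<open>hh\<close>. The \<open>pp\<close>-components give \<open>lam\<close>; the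
  terms with an \<open>hh\<close>-component vanish, cancel or double by \<open>g_ad_hh\<close>.\<close>

lemma koszul_algebra:
  "g (br a b) c + g b (br c a) + g a (br c b) = 2 * g (Lam (pr a) (pr b) + br (a - pr a) (pr b)) c"
proof -
  define X Y Z where "X = pr a" "Y = pr b" "Z = pr c"
  define P Q R where "P = a - pr a" "Q = b - pr b" "R = c - pr c"
  have m: "X \<in> pp" "Y \<in> pp" "Z \<in> pp" "P \<in> hh" "Q \<in> hh" "R \<in> hh"
    using pr_mem by (auto simp: X_Y_Z_def P_Q_R_def)
  have abc: "a = X + P" "b = Y + Q" "c = Z + R" by (auto simp: X_Y_Z_def P_Q_R_def)
  have gh: "g w u = 0" "g u w = 0" if "w \<in> {P, Q, R, br P Q, br R P, br R Q}" for u w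
    using that m hh_bracket by (auto intro: g_hh)
  have "g (br a b) c = g (br X Y) Z + g (br P Y) Z - g (br Q X) Z"
    unfolding abc using br_skew[of X Q] by (simp add: g_simps br_simps gh)
  moreover have "g b (br c a) = g Y (br Z X) + g Y (br R X) - g Y (br P Z)"
    unfolding abc using br_skew[of Z P] by (simp add: g_simps br_simps gh)
  moreover have "g a (br c b) = g X (br Z Y) + g X (br R Y) - g X (br Q Z)"
    unfolding abc using br_skew[of Z Q] by (simp add: g_simps br_simps gh)
  moreover have "g Y (br R X) = - g X (br R Y)" using g_ad_hh[OF m(6), of X Y] g_commute by simp
  moreover have "g Y (br P Z) = - g (br P Y) Z" using g_ad_hh[OF m(4), of Y Z] by simp
  moreover have "g X (br Q Z) = - g (br Q X) Z" using g_ad_hh[OF m(5), of X Z] by simp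
  moreover have "g (Lam X Y + br P Y) c = lam X Y Z + g (br P Y) Z"
    using g_Lam[OF m(3)] gh(2)[of R] by (simp add: abc g_simps)
  ultimately show ?thesis
    unfolding P_Q_R_def(1)[symmetric] unfolding X_Y_Z_def[symmetric]
    by (simp add: lam_def g_commute[of "br Z X"] g_commute[of "br Z Y"])
qed

abbreviation met :: "'a \<Rightarrow> 'a \<Rightarrow> 'a \<Rightarrow> real" where "met \<equiv> coset_metric G \<kappa> g"

text \<open>The bound by \<open>1 / 2\<close> makes \<open>\<lambda>z. pr (th x z)\<close> invertible on \<open>pp\<close>: at these points the projected
  Maurer-Cartan form is a frame.\<close>

definition frame_dom :: "'a set" where
  "frame_dom = {x \<in> th_dom. \<forall>z\<in>pp. norm (pr (th x z) - z) \<le> norm z / 2}"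

lemma eventually_frame_dom: "\<forall>\<^sub>F x in nhds 0. x \<in> frame_dom"
proof -
  have "\<forall>\<^sub>F x in nhds 0. norm (pr (th x b) - pr b) < 1 / (2 * DIM('a))" if "b \<in> Basis" for b
  proof -
    have bl: "bounded_linear pr" using linear_pr by (simp add: linear_conv_bounded_linear)
    have "isCont (\<lambda>x. th x b) 0"
      using smooth_on_continuous[OF smooth_th] open_th_dom zero_th_dom
      by (simp add: continuous_on_eq_continuous_at)
    then have "((\<lambda>x. th x b) \<longlongrightarrow> b) (nhds 0)"
      using tendsto_at_iff_tendsto_nhds[of "\<lambda>x. th x b" 0] by (simp add: continuous_at th_0)
    then have "((\<lambda>x. norm (pr (th x b) - pr b)) \<longlongrightarrow> norm (pr b - pr b)) (nhds 0)"
      by (intro tendsto_norm tendsto_diff bounded_linear.tendsto[OF bl] tendsto_const)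
    then show ?thesis by (rule order_tendstoD) simp
  qed
  then have "\<forall>\<^sub>F x in nhds 0. \<forall>b\<in>Basis. norm (pr (th x b) - pr b) < 1 / (2 * DIM('a))"
    by (intro eventually_ball_finite) auto
  moreover have "\<forall>\<^sub>F x in nhds 0. x \<in> th_dom"
    using open_th_dom zero_th_dom by (rule eventually_nhds_in_open)
  ultimately show ?thesis
  proof eventually_elim
    fix x assume b: "\<forall>b\<in>Basis. norm (pr (th x b) - pr b) < 1 / (2 * DIM('a))" and x: "x \<in> th_dom"
    have "norm (pr (th x z) - z) \<le> norm z / 2" if z: "z \<in> pp" for z
    proof -
      have lin: "linear (\<lambda>z. pr (th x z) - pr z)"
        using linear_compose_sub[OF linear_compose[OF linear_th[OF x] linear_pr] linear_pr] by (simp add: o_def)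
      have "norm (pr (th x z) - z) = norm (\<Sum>b\<in>Basis. (z \<bullet> b) *\<^sub>R (pr (th x b) - pr b))"
        using linear_expansion[OF lin, of z] z by simp
      also have "\<dots> \<le> (\<Sum>b\<in>(Basis::'a set). norm z * (1 / (2 * DIM('a))))"
      proof (rule sum_norm_le)
        fix c :: 'a assume c: "c \<in> Basis"
        show "norm ((z \<bullet> c) *\<^sub>R (pr (th x c) - pr c)) \<le> norm z * (1 / (2 * DIM('a)))"
          unfolding norm_scaleR using b c Basis_le_norm[OF c, of z] by (intro mult_mono) (auto intro: less_imp_le)
      qed
      also have "\<dots> = norm z / 2" by simp
      finally show ?thesis .
    qed
    then show "x \<in> frame_dom" using x by (simp add: frame_dom_def)
  qed
qed

text \<open>Extended by the identity on \<open>hh\<close>, the frame is an injective endomorphism of the whole Lie algebra,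
  hence surjective.\<close>

lemma frame_dom_surj:
  assumes x: "x \<in> frame_dom" and w: "w \<in> pp" obtains z where "z \<in> pp" "pr (th x z) = w"
proof -
  have xd: "x \<in> th_dom" using x by (simp add: frame_dom_def)
  define \<Phi> where "\<Phi> z = pr (th x (pr z)) + (z - pr z)" for z
  have "linear \<Phi>"
    unfolding \<Phi>_def using linear_th[OF xd] linear_pr
    by (auto simp: linear_iff algebra_simps)
  moreover have "inj \<Phi>"
  proof (subst linear_injective_0[OF \<open>linear \<Phi>\<close>], intro allI impI)
    fix z assume z: "\<Phi> z = 0"
    have "pr (\<Phi> z) = pr (th x (pr z))" by (simp add: \<Phi>_def pr_simps)
    then have 0: "pr (th x (pr z)) = 0" using z by (simp add: pr_simps)
    then have "z = pr z" using z by (simp add: \<Phi>_def)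
    moreover have "norm (pr (th x (pr z)) - pr z) \<le> norm (pr z) / 2"
      using x pr_mem(1) by (simp add: frame_dom_def)
    then have "pr z = 0" by (simp add: 0)
    ultimately show "z = 0" by simp
  qed
  ultimately have "surj \<Phi>" by (rule linear_inj_imp_surj)
  then obtain z where z: "\<Phi> z = w" by (metis surjD)
  have "pr (\<Phi> z) = pr (th x (pr z))" by (simp add: \<Phi>_def pr_simps)
  then have "pr (th x (pr z)) = w" using z w by simp
  then show ?thesis using that[of "pr z"] pr_mem(1) by blast
qed

lemma frame_dom_inj:
  assumes x: "x \<in> frame_dom" and z: "z \<in> pp" "pr (th x z) = 0" shows "z = 0"
proof -
  have "norm (pr (th x z) - z) \<le> norm z / 2" using x z(1) by (simp add: frame_dom_def)
  then show ?thesis by (simp add: z)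
qed

text \<open>The covariant derivative of the constant field \<open>v\<close> along \<open>u\<close>, expressed in the frame: the derivative
  of \<open>v\<close> in the frame, the Nomizu map, and the rotation by the component of the Maurer-Cartan form in
  the isotropy algebra.\<close>

definition frame_conn :: "'a \<Rightarrow> 'a \<Rightarrow> 'a \<Rightarrow> 'a" where
  "frame_conn x u v = pr (dth x v u) + Lam (pr (th x u)) (pr (th x v)) + br (th x u - pr (th x u)) (pr (th x v))"

lemma frame_conn_pp: "frame_conn x u v \<in> pp"
  unfolding frame_conn_def using pr_mem Lam_pp hh_pp_bracket by (intro subspace_add[OF subspace_pp]) auto

lemma dir_deriv_met:
  assumes x: "x \<in> th_dom"
  shows "dir_deriv (\<lambda>y. met y v w) x u = g (th x v) (dth x w u) + g (dth x v u) (th x w)"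
proof -
  have "bounded_bilinear g" using g_bilinear by (simp add: bilinear_conv_bounded_bilinear)
  from bounded_bilinear.has_vector_derivative[OF this th_line[OF x, of u v] th_line[OF x, of u w]]
  show ?thesis unfolding dir_deriv_def coset_metric_def by (simp add: vector_derivative_at)
qed

text \<open>The structure equation exchanges the two arguments of \<open>dth\<close> at the price of brackets, which are
  collected by \<open>koszul_algebra\<close>.\<close>

lemma koszul:
  assumes x: "x \<in> th_dom"
  shows "dir_deriv (\<lambda>y. met y v w) x u + dir_deriv (\<lambda>y. met y u w) x v - dir_deriv (\<lambda>y. met y u v) x w
    = 2 * g (frame_conn x u v) (th x w)"
proof -
  have s: "dth x b a = dth x a b + br (th x b) (th x a)" for a b
    using structure_equation[OF x, of b a] by (simp add: algebra_simps)
  have 1: "dth x u v = dth x v u + br (th x u) (th x v)" using s[of u v] .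
  have 2: "dth x w u = dth x u w + br (th x w) (th x u)" using s[of w u] .
  have 3: "dth x w v = dth x v w + br (th x w) (th x v)" using s[of w v] .
  have "dir_deriv (\<lambda>y. met y v w) x u + dir_deriv (\<lambda>y. met y u w) x v - dir_deriv (\<lambda>y. met y u v) x w
    = 2 * g (dth x v u) (th x w) + (g (br (th x u) (th x v)) (th x w)
      + g (th x v) (br (th x w) (th x u)) + g (th x u) (br (th x w) (th x v)))"
    unfolding dir_deriv_met[OF x] 1 2 3
    by (simp add: g_simps g_commute[of "dth x u w"] g_commute[of "dth x v w"])
  also have "\<dots> = 2 * g (frame_conn x u v) (th x w)"
    unfolding koszul_algebra frame_conn_def by (simp add: g_simps)
  finally show ?thesis .
qed

lemma christoffel_eq:
  assumes x: "x \<in> frame_dom"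
  shows "christoffel pp met x u v \<in> pp" "pr (th x (christoffel pp met x u v)) = frame_conn x u v"
proof -
  have xd: "x \<in> th_dom" using x by (simp add: frame_dom_def)
  obtain z where z: "z \<in> pp" "pr (th x z) = frame_conn x u v" using frame_dom_surj[OF x frame_conn_pp] .
  have uniq: "z' = z" if z': "z' \<in> pp" "\<forall>w\<in>pp. g (th x z') (th x w) = g (th x z) (th x w)" for z'
  proof -
    have d: "z' - z \<in> pp" using z' z subspace_diff[OF subspace_pp] by blast
    define C where "C = th x (z' - z)"
    have "C = th x z' - th x z" by (simp add: C_def linear_diff[OF linear_th[OF xd]])
    then have "g C C = g (th x z') C - g (th x z) C" by (metis bilinear_lsub g_bilinear)
    also have "\<dots> = 0" using z'(2) d by (simp add: C_def)
    finally have "g (pr (th x (z' - z))) (pr (th x (z' - z))) = 0" by (simp add: C_def)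
    then have "pr (th x (z' - z)) = 0" using g_pos pr_mem(1) by (force simp: pos_def_on_def simp del: g_pr_left g_pr_right)
    then show ?thesis using frame_dom_inj[OF x d] by simp
  qed
  have "christoffel pp met x u v = z"
    unfolding christoffel_def koszul[OF xd]
  proof (rule the_equality)
    have "g (th x z) y = g (frame_conn x u v) y" for y
      using g_pr_left[of "th x z" y] unfolding z(2) by simp
    then show "z \<in> pp \<and> (\<forall>w\<in>pp. 2 * met x z w = 2 * g (frame_conn x u v) (th x w))"
      using z(1) by (simp add: coset_metric_def)
    fix z' assume "z' \<in> pp \<and> (\<forall>w\<in>pp. 2 * met x z' w = 2 * g (frame_conn x u v) (th x w))"
    then show "z' = z"
      using uniq \<open>\<And>y. g (th x z) y = g (frame_conn x u v) y\<close> by (simp add: coset_metric_def)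
  qed
  then show "christoffel pp met x u v \<in> pp" "pr (th x (christoffel pp met x u v)) = frame_conn x u v"
    using z by auto
qed

lemma zero_frame_dom: "0 \<in> frame_dom"
  using eventually_nhds_x_imp_x[OF eventually_frame_dom] .

lemma christoffel_0:
  assumes "u \<in> pp" "v \<in> pp" shows "christoffel pp met 0 u v = pr (dth 0 v u) + Lam u v"
  using christoffel_eq[OF zero_frame_dom, of u v] assms by (simp add: th_0 frame_conn_def br_simps)

text \<open>In the frame the Christoffel map is a solution of \<open>christoffel_eq\<close>, a perturbation of the identity
  because the frame at \<open>0\<close> is the identity of \<open>pp\<close>. The last term is the derivative of the frame.\<close>

lemma dir_deriv_christoffel:
  assumes u: "u \<in> pp" and v: "v \<in> pp" and w: "w \<in> pp"
  shows "dir_deriv (\<lambda>y. christoffel pp met y v w) 0 u =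
    pr (D2 (\<lambda>y. th y w) 0 v u) + Lam (pr (dth 0 v u)) w + Lam v (pr (dth 0 w u))
      + br (dth 0 v u - pr (dth 0 v u)) w - pr (dth 0 (christoffel pp met 0 v w) u)"
proof -
  define Gm where "Gm t = christoffel pp met (t *\<^sub>R u) v w" for t
  define F where "F t = frame_conn (t *\<^sub>R u) v w" for t
  define n where "n e t = pr (th (t *\<^sub>R u) (pr e)) - pr e" for e t
  have bl: "bounded_linear pr" using linear_pr by (simp add: linear_conv_bounded_linear)
  have bL: "bounded_bilinear Lam" and bB: "bounded_bilinear br"
    using bilinear_Lam bilinear_br by (simp_all add: bilinear_conv_bounded_bilinear)
  have ev: "\<forall>\<^sub>F t in nhds (0::real). t *\<^sub>R u \<in> frame_dom"
  proof -
    have "((\<lambda>t::real. t *\<^sub>R u) \<longlongrightarrow> 0 *\<^sub>R u) (nhds 0)"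
      by (intro tendsto_scaleR filterlim_ident tendsto_const)
    then have "filterlim (\<lambda>t::real. t *\<^sub>R u) (nhds 0) (nhds 0)" by simp
    then show ?thesis using eventually_frame_dom unfolding filterlim_iff by blast
  qed
  have th': "((\<lambda>t. th (t *\<^sub>R u) b) has_vector_derivative dth 0 b u) (at 0)" for b
    using th_line[OF zero_th_dom, of u b] by simp
  have phi': "((\<lambda>t. pr (th (t *\<^sub>R u) b)) has_vector_derivative pr (dth 0 b u)) (at 0)" for b
    by (rule bounded_linear.has_vector_derivative[OF bl th'])
  have F': "(F has_vector_derivative pr (D2 (\<lambda>y. th y w) 0 v u)
      + (Lam v (pr (dth 0 w u)) + Lam (pr (dth 0 v u)) w)
      + (br (v - pr v) (pr (dth 0 w u)) + br (dth 0 v u - pr (dth 0 v u)) w)) (at 0)"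
  proof -
    have 1: "((\<lambda>t. pr (dth (t *\<^sub>R u) w v)) has_vector_derivative pr (D2 (\<lambda>y. th y w) 0 v u)) (at 0)"
      by (rule bounded_linear.has_vector_derivative[OF bl dth_line])
    have 2: "((\<lambda>t. Lam (pr (th (t *\<^sub>R u) v)) (pr (th (t *\<^sub>R u) w))) has_vector_derivative
        Lam v (pr (dth 0 w u)) + Lam (pr (dth 0 v u)) w) (at 0)"
      using bounded_bilinear.has_vector_derivative[OF bL phi'[of v] phi'[of w]] v w by (simp add: th_0)
    have 3: "((\<lambda>t. br (th (t *\<^sub>R u) v - pr (th (t *\<^sub>R u) v)) (pr (th (t *\<^sub>R u) w))) has_vector_derivative
        br (v - pr v) (pr (dth 0 w u)) + br (dth 0 v u - pr (dth 0 v u)) w) (at 0)"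
      using bounded_bilinear.has_vector_derivative[OF bB has_vector_derivative_diff[OF th'[of v] phi'[of v]] phi'[of w]] v w
      by (simp add: th_0)
    show ?thesis unfolding F_def frame_conn_def by (intro has_vector_derivative_add 1 2 3)
  qed
  have "(Gm has_vector_derivative (pr (D2 (\<lambda>y. th y w) 0 v u)
      + (Lam v (pr (dth 0 w u)) + Lam (pr (dth 0 v u)) w)
      + (br (v - pr v) (pr (dth 0 w u)) + br (dth 0 v u - pr (dth 0 v u)) w))
      - (\<Sum>e\<in>onb. g (Gm 0) e *\<^sub>R pr (dth 0 (pr e) u))) (at 0)"
  proof (rule perturbed_identity_derivative[OF g_bilinear, where n = n])
    show "\<forall>\<^sub>F t in nhds 0. Gm t + (\<Sum>e\<in>onb. g (Gm t) e *\<^sub>R n e t) = F t"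
      using ev
    proof eventually_elim
      fix t assume t: "t *\<^sub>R u \<in> frame_dom"
      then have td: "t *\<^sub>R u \<in> th_dom" by (simp add: frame_dom_def)
      have Gp: "Gm t \<in> pp" using christoffel_eq(1)[OF t] by (simp add: Gm_def)
      have lin: "linear (\<lambda>z. pr (th (t *\<^sub>R u) (pr z)) - pr z)"
        using linear_compose_sub[OF linear_compose[OF linear_compose[OF linear_pr linear_th[OF td]] linear_pr] linear_pr]
        by (simp add: o_def)
      have "(\<Sum>e\<in>onb. g (Gm t) e *\<^sub>R n e t) = pr (th (t *\<^sub>R u) (pr (Gm t))) - pr (Gm t)"
        unfolding n_def
        by (subst (2 3) onb_expansion[OF g_bilinear onb Gp])
          (simp only: linear_sum[OF lin] linear_scale[OF lin])
      then show "Gm t + (\<Sum>e\<in>onb. g (Gm t) e *\<^sub>R n e t) = F t"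
        using christoffel_eq(2)[OF t] Gp by (simp add: Gm_def F_def)
    qed
    show "\<forall>\<^sub>F t in nhds 0. norm (Gm t) \<le> 2 * norm (F t)"
      using ev
    proof eventually_elim
      fix t assume t: "t *\<^sub>R u \<in> frame_dom"
      have Gp: "Gm t \<in> pp" using christoffel_eq(1)[OF t] by (simp add: Gm_def)
      have "norm (F t - Gm t) \<le> norm (Gm t) / 2"
        using t Gp christoffel_eq(2)[OF t, of v w] by (auto simp: frame_dom_def F_def Gm_def)
      moreover have "norm (Gm t) \<le> norm (F t) + norm (F t - Gm t)"
        by (metis add.commute diff_add_cancel norm_minus_commute norm_triangle_ineq)
      ultimately show "norm (Gm t) \<le> 2 * norm (F t)" by linarith
    qed
    show "(n e has_vector_derivative pr (dth 0 (pr e) u)) (at 0)" for e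
      unfolding n_def using has_vector_derivative_diff_const[of "\<lambda>t. pr (th (t *\<^sub>R u) (pr e))"] phi' by blast
    show "n e 0 = 0" for e by (simp add: n_def th_0)
  qed (rule F')
  moreover have "(\<Sum>e\<in>onb. g (Gm 0) e *\<^sub>R pr (dth 0 (pr e) u)) = pr (dth 0 (Gm 0) u)"
  proof -
    have Gp: "Gm 0 \<in> pp" using christoffel_eq(1)[OF zero_frame_dom] by (simp add: Gm_def)
    have lin: "linear (\<lambda>z. pr (dth 0 (pr z) u))"
    proof -
      have 1: "linear (\<lambda>z. dth 0 z u)"
      proof (rule linearI)
        fix a b :: 'a and c :: real
        have "((\<lambda>t. th (t *\<^sub>R u) a + th (t *\<^sub>R u) b) has_vector_derivative dth 0 a u + dth 0 b u) (at 0)"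
          by (intro has_vector_derivative_add th')
        moreover have "\<forall>\<^sub>F t in nhds 0. t *\<^sub>R u \<in> th_dom" using ev by eventually_elim (simp add: frame_dom_def)
        then obtain S where S: "open S" "0 \<in> S" "\<And>t. t \<in> S \<Longrightarrow> t *\<^sub>R u \<in> th_dom"
          unfolding eventually_nhds by blast
        ultimately have "((\<lambda>t. th (t *\<^sub>R u) (a + b)) has_vector_derivative dth 0 a u + dth 0 b u) (at 0)"
          by (auto intro: has_vector_derivative_transform_within_open[OF _ S(1,2)] simp: linear_add[OF linear_th])
        then show "dth 0 (a + b) u = dth 0 a u + dth 0 b u"
          using th'[of "a + b"] vector_derivative_unique_at by blast
        have "((\<lambda>t. c *\<^sub>R th (t *\<^sub>R u) a) has_vector_derivative c *\<^sub>R dth 0 a u) (at 0)"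
          by (rule bounded_linear.has_vector_derivative[OF bounded_linear_scaleR_right th'])
        then have "((\<lambda>t. th (t *\<^sub>R u) (c *\<^sub>R a)) has_vector_derivative c *\<^sub>R dth 0 a u) (at 0)"
          using S(3) by (auto intro: has_vector_derivative_transform_within_open[OF _ S(1,2)] simp: linear_scale[OF linear_th])
        then show "dth 0 (c *\<^sub>R a) u = c *\<^sub>R dth 0 a u"
          using th'[of "c *\<^sub>R a"] vector_derivative_unique_at by blast
      qed
      show ?thesis
        using linear_compose[OF linear_compose[OF linear_pr 1] linear_pr] by (simp add: o_def)
    qed
    have "pr (dth 0 (Gm 0) u) = pr (dth 0 (pr (Gm 0)) u)" using Gp by simp
    also have "\<dots> = (\<Sum>e\<in>onb. g (Gm 0) e *\<^sub>R pr (dth 0 (pr e) u))"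
      by (subst onb_expansion[OF g_bilinear onb Gp])
        (simp only: linear_sum[OF lin] linear_scale[OF lin])
    finally show ?thesis ..
  qed
  ultimately show ?thesis
    using v unfolding dir_deriv_def Gm_def by (simp add: vector_derivative_at br_simps algebra_simps)
qed

text \<open>Nomizu's formula. In the antisymmetrisation the second derivatives of the Maurer-Cartan form cancel
  by symmetry, and its first derivatives survive only as \<open>dth 0 v u - dth 0 u v\<close>, which is \<open>- br u v\<close> by
  the structure equation.\<close>

theorem riemann_curvature_0:
  assumes u: "u \<in> pp" and v: "v \<in> pp" and w: "w \<in> pp"
  shows "riemann_curvature pp met 0 u v w =
    Lam u (Lam v w) - Lam v (Lam u w) - Lam (pr (br u v)) w - br (br u v - pr (br u v)) w"
proof -
  note L = bilinear_simps[OF bilinear_Lam]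
  have S: "dth 0 v u = dth 0 u v - br u v"
    using structure_equation[OF zero_th_dom, of u v] by (simp add: th_0 algebra_simps)
  have c: "christoffel pp met 0 a b \<in> pp" for a b by (rule christoffel_eq(1)[OF zero_frame_dom])
  have D2: "D2 (\<lambda>y. th y w) 0 v u = D2 (\<lambda>y. th y w) 0 u v"
    by (rule D2_commute[OF smooth_th zero_th_dom])
  have Gvw: "christoffel pp met 0 u (christoffel pp met 0 v w) =
      pr (dth 0 (christoffel pp met 0 v w) u) + (Lam u (pr (dth 0 w v)) + Lam u (Lam v w))"
    unfolding christoffel_0[OF u c] using christoffel_0[OF v w] by (simp add: L)
  have Guw: "christoffel pp met 0 v (christoffel pp met 0 u w) =
      pr (dth 0 (christoffel pp met 0 u w) v) + (Lam v (pr (dth 0 w u)) + Lam v (Lam u w))"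
    unfolding christoffel_0[OF v c] using christoffel_0[OF u w] by (simp add: L)
  have "riemann_curvature pp met 0 u v w =
    Lam (pr (dth 0 v u) - pr (dth 0 u v)) w + br ((dth 0 v u - pr (dth 0 v u)) - (dth 0 u v - pr (dth 0 u v))) w
    + Lam u (Lam v w) - Lam v (Lam u w)"
    unfolding riemann_curvature_def dir_deriv_christoffel[OF u v w] dir_deriv_christoffel[OF v u w]
      Gvw Guw D2
    by (simp add: L br_simps)
  also have "\<dots> = Lam u (Lam v w) - Lam v (Lam u w) - Lam (pr (br u v)) w - br (br u v - pr (br u v)) w"
    unfolding S by (simp add: L br_simps pr_simps)
  finally show ?thesis .
qed

end


section \<open>Scalar curvature and the Einstein condition\<close>

text \<open>By skewness and renaming of indices every product of two \<open>c\<close>'s sums to a multiple of one of the two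
  sums on the right.\<close>

lemma triple_sum_identity:
  fixes c :: "'i \<Rightarrow> 'i \<Rightarrow> 'i \<Rightarrow> real"
  assumes skew: "\<And>e f k. c e f k = - c f e k"
  defines "a \<equiv> \<lambda>x y z. (c x y z + c z x y + c z y x) / 2"
  shows "(\<Sum>e\<in>E. \<Sum>f\<in>E. \<Sum>k\<in>E. a e f k * a f e k - c e f k * a k f e) =
    - (\<Sum>e\<in>E. \<Sum>f\<in>E. \<Sum>k\<in>E. c e f k * c e f k) / 4 -
      (\<Sum>e\<in>E. \<Sum>f\<in>E. \<Sum>k\<in>E. c e f k * c e k f) / 2"
proof -
  define Tr where "Tr X = (\<Sum>e\<in>E. \<Sum>f\<in>E. \<Sum>k\<in>E. X e f k)" for X :: "'i \<Rightarrow> 'i \<Rightarrow> 'i \<Rightarrow> real"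
  have s12: "Tr (\<lambda>e f k. X f e k) = Tr X" for X
    unfolding Tr_def by (rule sum.swap)
  have s23: "Tr (\<lambda>e f k. X e k f) = Tr X" for X
    unfolding Tr_def by (intro sum.cong refl sum.swap)
  have s13: "Tr (\<lambda>e f k. X k f e) = Tr X" for X
    using s12[of "\<lambda>e f k. X k f e"] s23[of "\<lambda>e f k. X k e f"] s12[of X] by simp
  have add: "Tr (\<lambda>e f k. X e f k + Y e f k) = Tr X + Tr Y" for X Y
    by (simp add: Tr_def sum.distrib)
  have scale: "Tr (\<lambda>e f k. t * X e f k) = t * Tr X" for t X
    by (simp add: Tr_def sum_distrib_left)
  define S1 where "S1 = Tr (\<lambda>e f k. c e f k * c e f k)"
  define S2 where "S2 = Tr (\<lambda>e f k. c e f k * c e k f)"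
  have S1': "Tr (\<lambda>e f k. c k e f * c k e f) = S1" "Tr (\<lambda>e f k. c k f e * c k f e) = S1"
    using s13[of "\<lambda>e f k. c e f k * c e f k"] s12[of "\<lambda>e f k. c k f e * c k f e"]
    by (simp_all add: S1_def)
  have S2': "Tr (\<lambda>e f k. c k e f * c k f e) = S2"
    using s13[of "\<lambda>e f k. c e k f * c e f k"] by (simp add: S2_def mult.commute)
  have S2'': "Tr (\<lambda>e f k. c f e k * c f k e) = S2"
    using s12[of "\<lambda>e f k. c e f k * c e k f"] by (simp add: S2_def)
  have expand: "a e f k * a f e k - c e f k * a k f e =
      (-3/4) * (c e f k * c e f k) + (1/4) * (c k e f * c k e f) + (1/4) * (c k f e * c k f e)
      + (1/2) * (c k e f * c k f e) + (-1/2) * (c e f k * c e k f) + (-1/2) * (c f e k * c f k e)" for e f k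
    using skew[of f e k] skew[of e k f] skew[of f k e] by (simp add: a_def field_simps)
  have "Tr (\<lambda>e f k. a e f k * a f e k - c e f k * a k f e) = (-3/4) * S1 + (1/4) * S1 + (1/4) * S1
      + (1/2) * S2 + (-1/2) * S2 + (-1/2) * S2"
    unfolding expand add scale S1' S2' S2'' by (simp add: S1_def S2_def)
  then show ?thesis unfolding Tr_def S1_def S2_def by simp
qed

context compact_homogeneous
begin

lemma linear_comp_br: "linear L \<Longrightarrow> linear (\<lambda>x. br y (L x))"
  using linear_compose[OF _ linear_br_right] by (simp add: o_def)

lemma B_pr: "y \<in> pp \<Longrightarrow> B (pr x) y = B x y" "y \<in> pp \<Longrightarrow> B y (pr x) = B y x"
proof -
  assume y: "y \<in> pp"
  have "B y (x - pr x) = 0" using y pr_mem(2) by (simp add: pp_iff)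
  then show "B y (pr x) = B y x" by (simp add: bilinear_simps[OF B_bilinear])
  then show "B (pr x) y = B x y" using B_commute by metis
qed

lemma B_hh: "y \<in> hh \<Longrightarrow> B (x - pr x) y = B x y" "y \<in> hh \<Longrightarrow> B y (x - pr x) = B y x"
proof -
  assume "y \<in> hh"
  then have "B (pr x) y = 0" using pr_mem(1) pp_iff by blast
  then show "B (x - pr x) y = B x y" by (simp add: bilinear_simps[OF B_bilinear])
  then show "B y (x - pr x) = B y x" using B_commute by metis
qed

text \<open>The trace of \<open>ad x \<circ> ad x\<close> is computed on the complement alone: cyclically, its part on the
  isotropy algebra equals the part of its trace on the complement that passes through the isotropy
  algebra.\<close>

lemma B_trace:
  assumes x: "x \<in> pp" and F: "orthonormal_basis_on pp B F"
  shows "B x x = - (\<Sum>f\<in>F. B (br x (br x f)) f) - (\<Sum>f\<in>F. B (br x (br x f - pr (br x f))) f)"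
proof -
  obtain K where K: "orthonormal_basis_on hh B K"
    using ex_orthonormal_basis[OF subspace_hh B_form] B_pos by (auto simp: pos_def_on_def)
  have disj: "K \<inter> F = {}"
  proof -
    have "e = 0" if "e \<in> K" "e \<in> F" for e
      using pp_hh_zero that onbD(1)[OF K] onbD(1)[OF F] by blast
    moreover have "e \<noteq> 0" if "e \<in> K" for e
      using onbD(3)[OF K that that] bilinear_simps[OF B_bilinear] by auto
    ultimately show ?thesis by blast
  qed
  have fin: "finite K" "finite F" using onb_finite[OF B_bilinear] K F by blast+
  have cross: "B e f = 0" "B f e = 0" if "e \<in> K" "f \<in> F" for e f
  proof -
    have "f \<in> pp" "e \<in> hh" using that onbD(1)[OF K] onbD(1)[OF F] by auto
    then show "B f e = 0" using pp_iff by blast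
    then show "B e f = 0" using B_commute[of e f] by simp
  qed
  have KF: "orthonormal_basis_on UNIV B (K \<union> F)"
    unfolding orthonormal_basis_on_def
  proof (intro conjI ballI)
    have "v \<in> span (K \<union> F)" for v
    proof -
      have "pr v \<in> span (K \<union> F)" "v - pr v \<in> span (K \<union> F)"
        using pr_mem[of v] onbD(2)[OF K] onbD(2)[OF F] span_mono[of K "K \<union> F"] span_mono[of F "K \<union> F"] by auto
      then have "pr v + (v - pr v) \<in> span (K \<union> F)" by (rule span_add)
      then show ?thesis by simp
    qed
    then show "span (K \<union> F) = UNIV" by blast
    fix e f assume "e \<in> K \<union> F" "f \<in> K \<union> F"
    then consider "e \<in> K" "f \<in> K" | "e \<in> K" "f \<in> F" | "e \<in> F" "f \<in> K" | "e \<in> F" "f \<in> F"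
      by blast
    then show "B e f = (if e = f then 1 else 0)"
    proof cases
      case 1 then show ?thesis by (rule onbD(3)[OF K])
    next
      case 2
      moreover have "e \<noteq> f" using 2 disj by blast
      ultimately show ?thesis using cross(1) by simp
    next
      case 3
      moreover have "e \<noteq> f" using 3 disj by blast
      ultimately show ?thesis using cross(2) by simp
    next
      case 4 then show ?thesis by (rule onbD(3)[OF F])
    qed
  qed simp
  have "linear (\<lambda>w. br x (br x w))" by (intro linear_comp_br linear_br_right)
  from linear_trace_onb[OF B_form KF this]
  have "- B x x = (\<Sum>e\<in>K. B (br x (br x e)) e) + (\<Sum>f\<in>F. B (br x (br x f)) f)"
    using sum.union_disjoint[OF fin disj, of "\<lambda>e. B (br x (br x e)) e"]
    by (simp add: B_def killing_form_def)
  moreover have "(\<Sum>e\<in>K. B (br x (br x e)) e) = (\<Sum>f\<in>F. B (br x (br x f - pr (br x f))) f)"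
  proof -
    have "(\<Sum>e\<in>K. B (br x (br x e)) e) = (\<Sum>e\<in>K. \<Sum>f\<in>F. - (B (br x e) f * B f (br x e)))"
    proof (rule sum.cong[OF refl])
      fix e assume "e \<in> K"
      then have "br x e \<in> pp"
        using hh_pp_bracket[of e x] onbD(1)[OF K] x subspace_neg[OF subspace_pp] br_skew[of x e] by (metis subsetD)
      from onb_parseval[OF B_bilinear F this, of "br x e"]
      show "B (br x (br x e)) e = (\<Sum>f\<in>F. - (B (br x e) f * B f (br x e)))"
        by (simp add: B_ad sum_negf)
    qed
    also have "\<dots> = (\<Sum>f\<in>F. \<Sum>e\<in>K. - (B (br x e) f * B f (br x e)))" by (rule sum.swap)
    also have "\<dots> = (\<Sum>f\<in>F. B (br x (br x f - pr (br x f))) f)"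
    proof (rule sum.cong[OF refl])
      fix f assume f: "f \<in> F"
      let ?z = "br x f - pr (br x f)"
      have z: "?z \<in> hh" by (rule pr_mem(2))
      have e1: "B f (br x e) = - B e ?z" if "e \<in> K" for e
      proof -
        have eh: "e \<in> hh" using that onbD(1)[OF K] by blast
        have "B f (br x e) = - B (br x f) e" by (simp add: B_ad)
        also have "B (br x f) e = B e (br x f)" by (rule B_commute)
        also have "\<dots> = B e ?z" using B_hh(2)[OF eh, of "br x f"] by simp
        finally show ?thesis .
      qed
      have e2: "B (br x e) f = - B ?z e" if "e \<in> K" for e
        using e1[OF that] B_commute[of f "br x e"] B_commute[of e ?z] by simp
      have "B (br x ?z) f = - B ?z (br x f)" by (rule B_ad)
      also have "\<dots> = - B ?z ?z" using arg_cong[OF B_hh(2)[OF z, of "br x f"], of uminus] by (rule sym)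
      also have "\<dots> = - (\<Sum>e\<in>K. B ?z e * B e ?z)"
        using arg_cong[OF onb_parseval[OF B_bilinear K z, of ?z], of uminus] .
      also have "\<dots> = (\<Sum>e\<in>K. - (B (br x e) f * B f (br x e)))" by (simp add: e1 e2 sum_negf)
      finally show "(\<Sum>e\<in>K. - (B (br x e) f * B f (br x e))) = B (br x ?z) f" ..
    qed
    finally show ?thesis .
  qed
  ultimately show ?thesis by linarith
qed

lemma ex_B_onb: obtains F where "orthonormal_basis_on pp B F"
  using ex_orthonormal_basis[OF subspace_pp B_form] B_pos by (auto simp: pos_def_on_def)

end

context invariant_metric
begin

lemma g_trace_B:
  assumes E: "orthonormal_basis_on pp g E" and F: "orthonormal_basis_on pp B F" and L: "linear L"
  shows "(\<Sum>e\<in>E. g (L e) e) = (\<Sum>f\<in>F. B (L f) f)"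
proof -
  have "linear (\<lambda>x. pr (L x))" using linear_compose[OF L linear_pr] by (simp add: o_def)
  from trace_change_basis[OF g_form E B_form F this pr_mem(1)]
  have "(\<Sum>e\<in>E. g (L e) e) = (\<Sum>f\<in>F. B (pr (L f)) f)" by simp
  also have "\<dots> = (\<Sum>f\<in>F. B (L f) f)"
    using B_pr(1) onbD(1)[OF F] by (intro sum.cong) auto
  finally show ?thesis .
qed

lemma B_trace_g:
  assumes x: "x \<in> pp" and E: "orthonormal_basis_on pp g E"
  shows "B x x = - (\<Sum>e\<in>E. g (br x (pr (br x e))) e) - 2 * (\<Sum>e\<in>E. g (br x (br x e - pr (br x e))) e)"
proof -
  obtain F where F: "orthonormal_basis_on pp B F" using ex_B_onb .
  have l1: "linear (\<lambda>w. br x (br x w))" by (intro linear_comp_br linear_br_right)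
  have l2: "linear (\<lambda>w. br x (br x w - pr (br x w)))"
    using linear_compose[OF linear_br_right[of x] linear_pr]
    by (intro linear_comp_br linear_compose_sub linear_br_right) (simp add: o_def)
  have "(\<Sum>e\<in>E. g (br x (br x e)) e) =
      (\<Sum>e\<in>E. g (br x (pr (br x e))) e) + (\<Sum>e\<in>E. g (br x (br x e - pr (br x e))) e)"
    by (simp add: br_simps g_simps sum.distrib[symmetric])
  then show ?thesis
    using B_trace[OF x F] g_trace_B[OF E F l1] g_trace_B[OF E F l2] by simp
qed

text \<open>\<open>br z\<close> is skew for \<open>B\<close>, and the trace may be computed in a basis that is orthonormal for \<open>B\<close>.\<close>

lemma unimodular:
  assumes E: "orthonormal_basis_on pp g E"
  shows "(\<Sum>e\<in>E. g (br z e) e) = 0"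
proof -
  obtain F where F: "orthonormal_basis_on pp B F" using ex_B_onb .
  have "B (br z f) f = 0" for f using B_ad[of z f f] B_commute[of f "br z f"] by simp
  then show ?thesis using g_trace_B[OF E F linear_br_right] by simp
qed

lemma met_0: "met 0 = g"
  by (auto simp: coset_metric_def th_0 fun_eq_iff)

lemma Ric_eq: "Ric G \<kappa> H g v w = (\<Sum>e\<in>onb. g (riemann_curvature pp met 0 e v w) e)"
  by (simp add: Ric_def ricci_curvature_def met_0 onb_def)

lemma scal_eq: "scal G \<kappa> H g = (\<Sum>f\<in>onb. \<Sum>e\<in>onb. g (riemann_curvature pp met 0 e f f) e)"
  by (simp add: scal_def scalar_curvature_def ricci_curvature_def met_0 onb_def)

lemma onb_pp: "e \<in> onb \<Longrightarrow> e \<in> pp"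
  using onbD(1)[OF onb] by blast

lemma sum_Lam_diag: "(\<Sum>f\<in>onb. Lam f f) = 0"
proof -
  let ?W = "\<Sum>f\<in>onb. Lam f f"
  have W: "?W \<in> pp" by (intro subspace_sum[OF subspace_pp] Lam_pp)
  have "g ?W z = 0" if z: "z \<in> pp" for z
  proof -
    have "g ?W z = (\<Sum>f\<in>onb. g (br z f) f)"
      by (simp add: bilinear_sum_left[OF g_bilinear] g_Lam[OF z] lam_def g_simps)
    then show ?thesis using unimodular[OF onb] by simp
  qed
  then have "g ?W ?W = 0" using W by simp
  then show ?thesis using g_pos W by (force simp: pos_def_on_def)
qed

lemma lam_skew: "lam x y z = - lam x z y"
  using br_skew[of z y] br_skew[of x z] br_skew[of x y] by (simp add: lam_def g_simps field_simps)

text \<open>Of the four terms in Nomizu's formula the first vanishes by \<open>sum_Lam_diag\<close>. The second and third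
  are expressed in structure constants by \<open>triple_sum_identity\<close>. The part of the result that is not
  a sum of squares combines with the fourth term to the trace of the Killing form (\<open>B_trace_g\<close>).\<close>

theorem scal_onb:
  "scal G \<kappa> H g = (\<Sum>e\<in>onb. B e e) / 2 - (\<Sum>e\<in>onb. \<Sum>f\<in>onb. g (br e f) (br e f)) / 4"
proof -
  define c where "c e f k = g (br e f) k" for e f k
  define a where "a x y z = (c x y z + c z x y + c z y x) / 2" for x y z
  have a_lam: "lam x y z = a x y z" for x y z by (simp add: lam_def a_def c_def)
  have skew: "c e f k = - c f e k" for e f k using br_skew[of f e] by (simp add: c_def g_simps)
  have par: "g x y = (\<Sum>k\<in>onb. g x k * g y k)" for x y
  proof -
    have "g x y = (\<Sum>k\<in>onb. g x k * g k y)"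
      using onb_parseval[OF g_bilinear onb pr_mem(1)[of x], of y] by simp
    also have "\<dots> = (\<Sum>k\<in>onb. g x k * g y k)"
      by (intro sum.cong refl arg_cong2[where f = "(*)"] g_commute)
    finally show ?thesis .
  qed
  define hz where "hz e f = br e f - pr (br e f)" for e f
  have hz: "hz e f \<in> hh" for e f unfolding hz_def by (rule pr_mem(2))
  have R: "g (riemann_curvature pp met 0 e f f) e = g (Lam e (Lam f f)) e +
      (\<Sum>k\<in>onb. a e f k * a f e k - c e f k * a k f e) + g (br e (hz f e)) f"
    if e: "e \<in> onb" and f: "f \<in> onb" for e f
  proof -
    have ep: "e \<in> pp" and fp: "f \<in> pp" using e f onb_pp by auto
    have 2: "g (Lam f (Lam e f)) e = - (\<Sum>k\<in>onb. a e f k * a f e k)"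
    proof -
      have "g (Lam f (Lam e f)) e = - g (Lam f e) (Lam e f)"
        using g_Lam[OF ep, of f "Lam e f"] g_Lam[OF Lam_pp[of e f], of f e] lam_skew[of f "Lam e f" e] by simp
      also have "\<dots> = - (\<Sum>k\<in>onb. g (Lam f e) k * g (Lam e f) k)" by (simp only: par[of "Lam f e" "Lam e f"])
      also have "\<dots> = - (\<Sum>k\<in>onb. a e f k * a f e k)"
        using g_Lam[OF onb_pp] by (simp add: a_lam mult.commute)
      finally show ?thesis .
    qed
    have 3: "g (Lam (pr (br e f)) f) e = (\<Sum>k\<in>onb. c e f k * a k f e)"
    proof -
      have "pr (br e f) = (\<Sum>k\<in>onb. c e f k *\<^sub>R k)"
        using onb_expansion[OF g_bilinear onb pr_mem(1)[of "br e f"]] by (simp add: c_def)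
      then have "Lam (pr (br e f)) f = (\<Sum>k\<in>onb. c e f k *\<^sub>R Lam k f)"
        using linear_sum[OF bilinear_linear(2)[OF bilinear_Lam], of "\<lambda>k. c e f k *\<^sub>R k" onb f]
        by (simp add: bilinear_simps[OF bilinear_Lam])
      then show ?thesis
        using g_Lam[OF ep] by (simp add: bilinear_sum_left[OF g_bilinear] g_simps a_lam)
    qed
    have 4: "g (br (hz e f) f) e = - g (br e (hz f e)) f"
    proof -
      have "hz f e = - hz e f" using br_skew[of f e] by (simp add: hz_def pr_simps)
      then have "br e (hz f e) = br (hz e f) e" using br_skew[of e "hz e f"] by (simp add: br_simps)
      then show ?thesis using g_ad_hh[OF hz, of e f f e] g_commute by simp
    qed
    show ?thesis
      unfolding riemann_curvature_0[OF ep fp fp] hz_def[symmetric]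
      by (simp add: g_simps 2 3 4 sum_subtractf)
  qed
  have t1: "(\<Sum>f\<in>onb. \<Sum>e\<in>onb. g (Lam e (Lam f f)) e) = 0"
  proof -
    have "(\<Sum>f\<in>onb. \<Sum>e\<in>onb. g (Lam e (Lam f f)) e) = (\<Sum>e\<in>onb. \<Sum>f\<in>onb. g (Lam e (Lam f f)) e)"
      by (rule sum.swap)
    also have "\<dots> = (\<Sum>e\<in>onb. g (Lam e (\<Sum>f\<in>onb. Lam f f)) e)"
      by (simp add: bilinear_sum_right[OF g_bilinear] bilinear_sum_left[OF g_bilinear]
          linear_sum[OF bilinear_linear(1)[OF bilinear_Lam]])
    finally show ?thesis by (simp add: sum_Lam_diag bilinear_simps[OF bilinear_Lam] g_simps)
  qed
  have Bsum: "(\<Sum>e\<in>onb. B e e) = - (\<Sum>e\<in>onb. \<Sum>f\<in>onb. \<Sum>k\<in>onb. c e f k * c e k f)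
      - 2 * (\<Sum>e\<in>onb. \<Sum>f\<in>onb. g (br e (hz e f)) f)"
  proof -
    have "g (br e (pr (br e f))) f = (\<Sum>k\<in>onb. c e f k * c e k f)" for e f
    proof -
      have "pr (br e f) = (\<Sum>k\<in>onb. c e f k *\<^sub>R k)"
        using onb_expansion[OF g_bilinear onb pr_mem(1)[of "br e f"]] by (simp add: c_def)
      then show ?thesis
        by (simp add: linear_sum[OF linear_br_right] br_simps bilinear_sum_left[OF g_bilinear] g_simps c_def)
    qed
    then show ?thesis
      using B_trace_g[OF onb_pp onb] by (simp add: hz_def sum_subtractf sum_negf sum_distrib_left)
  qed
  have "scal G \<kappa> H g = (\<Sum>f\<in>onb. \<Sum>e\<in>onb. g (Lam e (Lam f f)) e +
      (\<Sum>k\<in>onb. a e f k * a f e k - c e f k * a k f e) + g (br e (hz f e)) f)"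
    unfolding scal_eq by (intro sum.cong refl R)
  also have "\<dots> = (\<Sum>f\<in>onb. \<Sum>e\<in>onb. \<Sum>k\<in>onb. a e f k * a f e k - c e f k * a k f e)
      + (\<Sum>f\<in>onb. \<Sum>e\<in>onb. g (br e (hz f e)) f)"
    using t1 by (simp add: sum.distrib)
  also have "(\<Sum>f\<in>onb. \<Sum>e\<in>onb. \<Sum>k\<in>onb. a e f k * a f e k - c e f k * a k f e) =
      (\<Sum>e\<in>onb. \<Sum>f\<in>onb. \<Sum>k\<in>onb. a e f k * a f e k - c e f k * a k f e)"
    by (rule sum.swap)
  also have "\<dots> = - (\<Sum>e\<in>onb. \<Sum>f\<in>onb. \<Sum>k\<in>onb. c e f k * c e f k) / 4 -
      (\<Sum>e\<in>onb. \<Sum>f\<in>onb. \<Sum>k\<in>onb. c e f k * c e k f) / 2"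
    unfolding a_def by (rule triple_sum_identity[OF skew])
  also have "(\<Sum>f\<in>onb. \<Sum>e\<in>onb. g (br e (hz f e)) f) = - (\<Sum>e\<in>onb. \<Sum>f\<in>onb. g (br e (hz e f)) f)"
  proof -
    have "g (br e (hz f e)) f = - g (br e (hz e f)) f" for e f
    proof -
      have "hz f e = - hz e f" using br_skew[of f e] by (simp add: hz_def pr_simps)
      then show ?thesis by (simp add: br_simps g_simps)
    qed
    then show ?thesis by (subst sum.swap) (simp only: sum_negf)
  qed
  also have "(\<Sum>e\<in>onb. \<Sum>f\<in>onb. \<Sum>k\<in>onb. c e f k * c e f k) = (\<Sum>e\<in>onb. \<Sum>f\<in>onb. g (br e f) (br e f))"
  proof (intro sum.cong refl)
    fix e f
    show "(\<Sum>k\<in>onb. c e f k * c e f k) = g (br e f) (br e f)"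
      using par[of "br e f" "br e f"] by (simp add: c_def)
  qed
  finally show ?thesis unfolding Bsum by argo
qed

theorem scal_formula:
  assumes E: "orthonormal_basis_on pp g E"
  shows "scal G \<kappa> H g = (\<Sum>e\<in>E. B e e) / 2 - (\<Sum>e\<in>E. \<Sum>f\<in>E. g (br e f) (br e f)) / 4"
proof -
  have bl: "bilinear (\<lambda>x y. g (br x f) (br y f))" "bilinear (\<lambda>x y. g (br f x) (br f y))" for f
    by (auto simp: bilinear_def linear_iff br_simps g_simps)
  have "(\<Sum>e\<in>onb. \<Sum>f\<in>onb. g (br e f) (br e f)) = (\<Sum>e\<in>onb. \<Sum>f\<in>E. g (br e f) (br e f))"
    by (intro sum.cong refl form_trace_change_basis[OF g_form onb E bl(2)])
  also have "\<dots> = (\<Sum>f\<in>E. \<Sum>e\<in>onb. g (br e f) (br e f))" by (rule sum.swap)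
  also have "\<dots> = (\<Sum>f\<in>E. \<Sum>e\<in>E. g (br e f) (br e f))"
    by (intro sum.cong refl form_trace_change_basis[OF g_form onb E bl(1)])
  also have "\<dots> = (\<Sum>e\<in>E. \<Sum>f\<in>E. g (br e f) (br e f))" by (rule sum.swap)
  finally show ?thesis
    unfolding scal_onb using form_trace_change_basis[OF g_form onb E B_bilinear] by simp
qed

end

context compact_homogeneous
begin

abbreviation std :: "'a \<Rightarrow> 'a \<Rightarrow> real" where "std \<equiv> standard_metric G \<kappa> H"

lemma std_eq: "std x y = B (pr x) (pr y)"
  by (simp add: standard_metric_def B_def)

lemma std_pp: "y \<in> pp \<Longrightarrow> std x y = B x y" "y \<in> pp \<Longrightarrow> std y x = B y x"
  by (simp_all add: std_eq B_pr)

lemma std_invariant: "std \<in> invariant_inner_products G \<kappa> H"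
proof -
  have "inner_product_on pp std"
    using B_pos subspace_pp
    by (auto simp: inner_product_on_def std_eq B_commute bilinear_simps[OF B_bilinear] pr_simps
        subspace_add subspace_scale pos_def_on_def)
  moreover have "std (Ad G \<kappa> a x) (Ad G \<kappa> a y) = std x y" if "a \<in> H" "x \<in> pp" "y \<in> pp" for a x y
    using that pp_Ad kf_Ad[OF H_carrier] by (simp add: std_eq B_def)
  ultimately show ?thesis by (auto simp: invariant_inner_products_def std_eq)
qed

lemma std_unit_volume: "std \<in> unit_volume_metrics G \<kappa> H"
  using std_invariant by (simp add: unit_volume_metrics_def same_volume_on_def)

lemma std_metric: "invariant_metric G T A \<kappa> H std"
  by unfold_locales (rule std_invariant)

text \<open>For the standard metric \<open>Lam\<close> is half the bracket. Let \<open>P\<close> and \<open>K\<close> be the sums over a basis of the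
  squared lengths of the components of \<open>br v e\<close> in \<open>pp\<close> and \<open>hh\<close>. Nomizu's formula gives
  \<open>Ric v v = P / 4 + K\<close>, and the trace formula for the Killing form gives \<open>std v v = P + 2 K\<close>. The
  Einstein condition eliminates \<open>K\<close>.\<close>

theorem einstein_structure_constants:
  assumes r: "einstein_constant G \<kappa> H std r" and v: "v \<in> pp" and E: "orthonormal_basis_on pp std E"
  shows "(\<Sum>e\<in>E. std (br v e) (br v e)) = (2 - 4 * r) * std v v"
proof -
  interpret S: invariant_metric G T A \<kappa> H std by (rule std_metric)
  let ?E = "S.onb"
  have hp: "B x (y - pr y) = 0" "B (y - pr y) x = 0" if "x \<in> pp" for x y
    using that pr_mem(2) B_commute by (auto simp: pp_iff)
  have Lam: "S.Lam x y = (1/2) *\<^sub>R pr (br x y)" if x: "x \<in> pp" and y: "y \<in> pp" for x y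
  proof -
    let ?d = "S.Lam x y - (1/2) *\<^sub>R pr (br x y)"
    have d: "?d \<in> pp" by (intro subspace_diff[OF subspace_pp] subspace_scale[OF subspace_pp] S.Lam_pp pr_mem(1))
    have "std ?d z = 0" if z: "z \<in> pp" for z
    proof -
      have "B (br z x) y = B (br x y) z"
        using B_ad[of x z y] br_skew[of z x] B_commute[of z] by (simp add: bilinear_simps[OF B_bilinear])
      moreover have "B (br z y) x = - B (br x y) z"
        using B_ad[of y z x] br_skew[of z y] br_skew[of y x] B_commute[of z] by (simp add: bilinear_simps[OF B_bilinear])
      ultimately show ?thesis
        using S.g_Lam[OF z, of x y] x y z by (simp add: S.g_simps S.lam_def std_pp)
    qed
    then have "std ?d ?d = 0" using d by simp
    then have "?d = 0" using S.g_pos d by (force simp: pos_def_on_def)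
    then show ?thesis by simp
  qed
  have hterm: "std (br x (br y z - pr (br y z))) w = - B (br y z - pr (br y z)) (br x w - pr (br x w))"
    if "w \<in> pp" for x y z w
    using that B_ad[of x "br y z - pr (br y z)" w] B_hh(2)[OF pr_mem(2)[of "br y z"], of "br x w"]
    by (simp add: std_pp)
  have pterm: "std (br x (pr (br y z))) w = - std (br y z) (br x w)" if "w \<in> pp" for x y z w
    using that B_ad[of x "pr (br y z)" w] B_pr(2)[OF pr_mem(1)[of "br y z"], of "br x w"]
    by (simp add: std_pp(1)) (simp add: std_eq)
  define P where "P = (\<Sum>e\<in>?E. std (br v e) (br v e))"
  define K where "K = (\<Sum>e\<in>?E. B (br v e - pr (br v e)) (br v e - pr (br v e)))"
  have "Ric G \<kappa> H std v v = P / 4 + K"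
  proof -
    have "std (riemann_curvature pp S.met 0 e v v) e =
        std (br v e) (br v e) / 4 + B (br v e - pr (br v e)) (br v e - pr (br v e))" if e: "e \<in> ?E" for e
    proof -
      have ep: "e \<in> pp" using S.onb_pp[OF e] .
      let ?z = "br v e - pr (br v e)"
      have z: "br e v - pr (br e v) = - ?z" using br_skew[of e v] by (simp add: pr_simps)
      have 0: "S.Lam v v = 0" using Lam[OF v v] by (simp add: pr_simps)
      have 1: "S.Lam v (S.Lam e v) = - (1/4) *\<^sub>R pr (br v (pr (br v e)))"
        using Lam[OF v S.Lam_pp, of e v] Lam[OF ep v] br_skew[of e v] by (simp add: br_simps pr_simps)
      have 2: "S.Lam (pr (br e v)) v = (1/2) *\<^sub>R pr (br v (pr (br v e)))"
      proof -
        have "pr (br (pr (br v e)) v) = - pr (br v (pr (br v e)))"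
          by (subst br_skew) (simp add: pr_simps)
        then show ?thesis
          using Lam[OF pr_mem(1) v, of "br e v"] br_skew[of e v] by (simp add: br_simps pr_simps)
      qed
      have 3: "br (br e v - pr (br e v)) v = br v ?z"
        unfolding z using br_skew[of v ?z] by (simp add: br_simps)
      have "riemann_curvature pp S.met 0 e v v = - (1/4) *\<^sub>R pr (br v (pr (br v e))) - br v ?z"
        unfolding S.riemann_curvature_0[OF ep v v] 0 1 2 3
        by (simp add: bilinear_simps[OF S.bilinear_Lam] scaleR_left.diff[symmetric] algebra_simps
            flip: scaleR_left.add)
      then show ?thesis
        using pterm[OF ep, of v v e] hterm[OF ep, of v v e] by (simp add: S.g_simps)
    qed
    then show ?thesis by (simp add: S.Ric_eq P_def K_def sum.distrib sum_divide_distrib)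
  qed
  moreover have "std v v = P + 2 * K"
    using S.B_trace_g[OF v S.onb] pterm[OF S.onb_pp, of _ v v] hterm[OF S.onb_pp, of _ v v] v
    by (simp add: std_pp P_def K_def sum_negf)
  moreover have "Ric G \<kappa> H std v v = r * std v v"
    using r v by (simp add: einstein_constant_def)
  ultimately have "P = (2 - 4 * r) * std v v" by (simp add: algebra_simps)
  moreover have "bilinear (\<lambda>x y. std (br v x) (br v y))"
    by (auto simp: bilinear_def linear_iff br_simps S.g_simps)
  from form_trace_change_basis[OF S.g_form S.onb E this]
  have "P = (\<Sum>e\<in>E. std (br v e) (br v e))" by (simp add: P_def)
  ultimately show ?thesis by simp
qed

end


section \<open>Local minimality\<close>

text \<open>The remainder in Taylor's formula is \<open>exp t / 2 * x\<^sup>2\<close> with \<open>\<bar>t\<bar> \<le> \<bar>x\<bar>\<close>, and \<open>exp t\<close> is close to \<open>1\<close>.\<close>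

lemma exp_quadratic_bounds:
  fixes \<eta> :: real
  assumes "\<eta> > 0"
  obtains \<delta> where "\<delta> > 0"
    "\<And>x. \<bar>x\<bar> \<le> \<delta> \<Longrightarrow> 1 + x + (1 - \<eta>) / 2 * x\<^sup>2 \<le> exp x"
    "\<And>x. \<bar>x\<bar> \<le> \<delta> \<Longrightarrow> exp x \<le> 1 + x + (1 + \<eta>) / 2 * x\<^sup>2"
proof -
  have "isCont (exp :: real \<Rightarrow> real) 0" by simp
  then obtain d where d: "d > 0" "\<And>t::real. \<bar>t\<bar> < d \<Longrightarrow> \<bar>exp t - 1\<bar> < \<eta>"
    using assms unfolding continuous_at_eps_delta by (auto simp: dist_real_def)
  have *: "1 + x + (1 - \<eta>) / 2 * x\<^sup>2 \<le> exp x \<and> exp x \<le> 1 + x + (1 + \<eta>) / 2 * x\<^sup>2"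
    if x: "\<bar>x\<bar> \<le> d / 2" for x
  proof -
    obtain t where t: "\<bar>t\<bar> \<le> \<bar>x\<bar>" "exp x = (\<Sum>m<2. x ^ m / fact m) + exp t / fact 2 * x ^ 2"
      using Maclaurin_exp_le[of x 2] by blast
    have e: "exp x = 1 + x + exp t / 2 * x\<^sup>2" using t(2) by (simp add: numeral_2_eq_2)
    have "\<bar>exp t - 1\<bar> < \<eta>" using d t(1) x by simp
    then have "(1 - \<eta>) / 2 * x\<^sup>2 \<le> exp t / 2 * x\<^sup>2" "exp t / 2 * x\<^sup>2 \<le> (1 + \<eta>) / 2 * x\<^sup>2"
      by (intro mult_right_mono; simp)+
    then show ?thesis unfolding e by simp
  qed
  show ?thesis using that[of "d / 2"] d(1) * by simp
qed

text \<open>With \<open>Tr\<close> the sum weighted by \<open>w\<close>, all of \<open>Tr (a e)\<close>, \<open>Tr (a f)\<close>, \<open>Tr (a k)\<close> are \<open>L \<Sum> a e = 0\<close>,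
  so the linear terms vanish. In \<open>Tr (a k - a e - a f)\<^sup>2\<close> the squares contribute \<open>3 L \<Sum> (a e)\<^sup>2\<close> and the
  products, estimated by the inequality between the arithmetic and the geometric mean, at most
  \<open>2 L \<Sum> (a e)\<^sup>2\<close>. This explains the factor \<open>5\<close>; the slack \<open>\<eta>\<close> absorbs the higher orders of \<open>exp\<close>.\<close>

lemma weighted_exponential_inequality:
  fixes w :: "'i \<Rightarrow> 'i \<Rightarrow> 'i \<Rightarrow> real" and a :: "'i \<Rightarrow> real"
  assumes w0: "\<And>e f k. e \<in> I \<Longrightarrow> f \<in> I \<Longrightarrow> k \<in> I \<Longrightarrow> 0 \<le> w e f k"
    and w12: "\<And>e f k. e \<in> I \<Longrightarrow> f \<in> I \<Longrightarrow> k \<in> I \<Longrightarrow> w f e k = w e f k"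
    and w23: "\<And>e f k. e \<in> I \<Longrightarrow> f \<in> I \<Longrightarrow> k \<in> I \<Longrightarrow> w e k f = w e f k"
    and L: "\<And>e. e \<in> I \<Longrightarrow> (\<Sum>f\<in>I. \<Sum>k\<in>I. w e f k) = L"
    and a0: "(\<Sum>e\<in>I. a e) = 0"
    and lo: "\<And>e. e \<in> I \<Longrightarrow> 1 + - a e + (1 - \<eta>) / 2 * (- a e)\<^sup>2 \<le> exp (- a e)"
    and up: "\<And>e f k. e \<in> I \<Longrightarrow> f \<in> I \<Longrightarrow> k \<in> I \<Longrightarrow>
      exp (a k - a e - a f) \<le> 1 + (a k - a e - a f) + (1 + \<eta>) / 2 * (a k - a e - a f)\<^sup>2"
    and \<eta>: "0 \<le> 1 + \<eta>" "5 * L * (1 + \<eta>) \<le> 2 * (1 - \<eta>)"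
  shows "real (card I) / 2 - (\<Sum>e\<in>I. \<Sum>f\<in>I. \<Sum>k\<in>I. w e f k) / 4 \<le>
    (\<Sum>e\<in>I. exp (- a e)) / 2 - (\<Sum>e\<in>I. \<Sum>f\<in>I. \<Sum>k\<in>I. w e f k * exp (a k - a e - a f)) / 4"
proof -
  define Tr where "Tr X = (\<Sum>e\<in>I. \<Sum>f\<in>I. \<Sum>k\<in>I. w e f k * X e f k)" for X :: "'i \<Rightarrow> 'i \<Rightarrow> 'i \<Rightarrow> real"
  have add: "Tr (\<lambda>e f k. X e f k + Y e f k) = Tr X + Tr Y" for X Y
    by (simp add: Tr_def sum.distrib distrib_left)
  have scale: "Tr (\<lambda>e f k. t * X e f k) = t * Tr X" for t X
    by (simp add: Tr_def sum_distrib_left mult.left_commute)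
  have mono: "Tr X \<le> Tr Y" if "\<And>e f k. e \<in> I \<Longrightarrow> f \<in> I \<Longrightarrow> k \<in> I \<Longrightarrow> X e f k \<le> Y e f k" for X Y
    unfolding Tr_def by (intro sum_mono mult_left_mono that w0)
  have s12: "Tr (\<lambda>e f k. X f e k) = Tr X" for X
  proof -
    have "Tr (\<lambda>e f k. X f e k) = (\<Sum>f\<in>I. \<Sum>e\<in>I. \<Sum>k\<in>I. w e f k * X f e k)"
      unfolding Tr_def by (rule sum.swap)
    also have "\<dots> = Tr X" unfolding Tr_def by (intro sum.cong refl) (simp add: w12)
    finally show ?thesis .
  qed
  have s23: "Tr (\<lambda>e f k. X e k f) = Tr X" for X
  proof -
    have "Tr (\<lambda>e f k. X e k f) = (\<Sum>e\<in>I. \<Sum>k\<in>I. \<Sum>f\<in>I. w e f k * X e k f)"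
      unfolding Tr_def by (intro sum.cong refl sum.swap)
    also have "\<dots> = Tr X" unfolding Tr_def by (intro sum.cong refl) (simp add: w23)
    finally show ?thesis .
  qed
  have one: "Tr (\<lambda>e f k. h e) = L * (\<Sum>e\<in>I. h e)" for h
    unfolding Tr_def sum_distrib_left
    by (intro sum.cong refl) (simp add: L[symmetric] sum_distrib_right)
  have one': "Tr (\<lambda>e f k. h f) = L * (\<Sum>e\<in>I. h e)" "Tr (\<lambda>e f k. h k) = L * (\<Sum>e\<in>I. h e)" for h
    using s12[of "\<lambda>e f k. h e"] s23[of "\<lambda>e f k. h f"] one by simp_all
  define A where "A = (\<Sum>e\<in>I. (a e)\<^sup>2)"
  define W where "W = Tr (\<lambda>e f k. a e * a f)"
  have A0: "0 \<le> A" unfolding A_def by (intro sum_nonneg) auto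
  have W': "Tr (\<lambda>e f k. a e * a k) = W" "Tr (\<lambda>e f k. a f * a k) = W"
    using s23[of "\<lambda>e f k. a e * a f"] s12[of "\<lambda>e f k. a e * a k"] by (simp_all add: W_def)
  have lin: "Tr (\<lambda>e f k. a k - a e - a f) = 0"
  proof -
    have "Tr (\<lambda>e f k. a k + ((-1) * a e + (-1) * a f)) = 0"
      unfolding add scale one one' by (simp add: a0)
    then show ?thesis by (simp add: algebra_simps)
  qed
  have quad: "Tr (\<lambda>e f k. (a k - a e - a f)\<^sup>2) \<le> 5 * L * A"
  proof -
    have "Tr (\<lambda>e f k. (a k - a e - a f)\<^sup>2) =
      Tr (\<lambda>e f k. (a k)\<^sup>2 + ((a e)\<^sup>2 + ((a f)\<^sup>2 + (2 * (a e * a f) + ((-2) * (a e * a k) + (-2) * (a f * a k))))))"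
      by (rule arg_cong[where f = Tr]) (simp add: fun_eq_iff power2_eq_square algebra_simps)
    also have "\<dots> = 3 * (L * A) - 2 * W"
      unfolding add scale one one' W' by (simp add: W_def A_def)
    finally have 1: "Tr (\<lambda>e f k. (a k - a e - a f)\<^sup>2) = 3 * (L * A) - 2 * W" .
    have "0 \<le> Tr (\<lambda>e f k. (a e)\<^sup>2 + ((a f)\<^sup>2 + 2 * (a e * a f)))"
    proof -
      have "Tr (\<lambda>e f k. 0) \<le> Tr (\<lambda>e f k. (a e)\<^sup>2 + ((a f)\<^sup>2 + 2 * (a e * a f)))"
      proof (rule mono)
        fix e f show "0 \<le> (a e)\<^sup>2 + ((a f)\<^sup>2 + 2 * (a e * a f))"
          using zero_le_power2[of "a e + a f"] by (simp add: power2_eq_square algebra_simps)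
      qed
      then show ?thesis by (simp add: Tr_def)
    qed
    then have "0 \<le> L * A + (L * A + 2 * W)"
      unfolding add scale one one' by (simp add: W_def A_def)
    with 1 show ?thesis by simp
  qed
  have "Tr (\<lambda>e f k. exp (a k - a e - a f)) \<le>
      Tr (\<lambda>e f k. 1 + ((a k - a e - a f) + (1 + \<eta>) / 2 * (a k - a e - a f)\<^sup>2))"
    using up by (intro mono) (simp add: add.assoc)
  also have "\<dots> = Tr (\<lambda>e f k. 1) + (1 + \<eta>) / 2 * Tr (\<lambda>e f k. (a k - a e - a f)\<^sup>2)"
    unfolding add scale lin by simp
  also have "\<dots> \<le> Tr (\<lambda>e f k. 1) + (1 + \<eta>) / 2 * (5 * L * A)"
    using quad \<eta>(1) by (intro add_left_mono mult_left_mono) auto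
  finally have T: "Tr (\<lambda>e f k. exp (a k - a e - a f)) \<le> Tr (\<lambda>e f k. 1) + (1 + \<eta>) / 2 * (5 * L * A)" .
  have "(\<Sum>e\<in>I. 1 + - a e + (1 - \<eta>) / 2 * (- a e)\<^sup>2) \<le> (\<Sum>e\<in>I. exp (- a e))"
    by (intro sum_mono lo)
  then have S: "real (card I) + (1 - \<eta>) / 2 * A \<le> (\<Sum>e\<in>I. exp (- a e))"
    using a0 by (simp add: sum.distrib sum_negf sum_subtractf A_def sum_distrib_left)
  have "5 * L * (1 + \<eta>) * A \<le> 2 * (1 - \<eta>) * A" using \<eta>(2) A0 by (rule mult_right_mono)
  moreover have "(1 + \<eta>) / 2 * (5 * L * A) / 4 = 5 * L * (1 + \<eta>) * A / 8"
    "(1 - \<eta>) / 2 * A / 2 = 2 * (1 - \<eta>) * A / 8" by simp_all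
  ultimately have "(1 + \<eta>) / 2 * (5 * L * A) / 4 \<le> (1 - \<eta>) / 2 * A / 2"
    by (simp only: divide_right_mono zero_le_numeral)
  then have "real (card I) / 2 - Tr (\<lambda>e f k. 1) / 4 \<le>
      (\<Sum>e\<in>I. exp (- a e)) / 2 - Tr (\<lambda>e f k. exp (a k - a e - a f)) / 4"
    using S T by argo
  then show ?thesis by (simp add: Tr_def)
qed

lemma gram_det_diagonal:
  assumes fin: "finite E" and off: "\<And>e f. e \<in> E \<Longrightarrow> f \<in> E \<Longrightarrow> e \<noteq> f \<Longrightarrow> g e f = 0"
  shows "gram_det g E = (\<Prod>e\<in>E. g e e)"
proof -
  have "gram_det g E = (\<Sum>\<sigma>\<in>{id}. of_int (sign \<sigma>) * (\<Prod>e\<in>E. g e (\<sigma> e)))"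
    unfolding gram_det_def
  proof (rule sum.mono_neutral_right)
    show "finite {\<sigma>. \<sigma> permutes E}" using fin by (rule finite_permutations)
    show "{id} \<subseteq> {\<sigma>. \<sigma> permutes E}" by (simp add: permutes_id)
    show "\<forall>\<sigma>\<in>{\<sigma>. \<sigma> permutes E} - {id}. of_int (sign \<sigma>) * (\<Prod>e\<in>E. g e (\<sigma> e)) = 0"
    proof
      fix \<sigma> assume "\<sigma> \<in> {\<sigma>. \<sigma> permutes E} - {id}"
      then have \<sigma>: "\<sigma> permutes E" "\<sigma> \<noteq> id" by auto
      then obtain e where e: "\<sigma> e \<noteq> e" by (auto simp: fun_eq_iff)
      then have "e \<in> E" using \<sigma>(1) by (auto simp: permutes_def)
      moreover have "\<sigma> e \<in> E" using \<sigma>(1) \<open>e \<in> E\<close> by (simp add: permutes_in_image)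
      ultimately have "g e (\<sigma> e) = 0" using off[of e "\<sigma> e"] e by simp
      then show "of_int (sign \<sigma>) * (\<Prod>e\<in>E. g e (\<sigma> e)) = 0"
        using fin \<open>e \<in> E\<close> by auto
    qed
  qed
  then show ?thesis by (simp add: sign_id)
qed

context compact_homogeneous
begin

text \<open>In a basis that diagonalises \<open>y\<close>, equality of the Gram determinants says that the product of the
  eigenvalues is \<open>1\<close>.\<close>

lemma diagonal_unit_volume:
  assumes y: "y \<in> unit_volume_metrics G \<kappa> H"
  obtains E a where "orthonormal_basis_on pp std E" "(\<Sum>e\<in>E. a e) = 0"
    "\<And>e x. e \<in> E \<Longrightarrow> x \<in> pp \<Longrightarrow> y e x = exp (a e) * std e x"
proof -
  interpret S: invariant_metric G T A \<kappa> H std by (rule std_metric)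
  interpret Y: invariant_metric G T A \<kappa> H y
    by unfold_locales (use y in \<open>simp add: unit_volume_metrics_def\<close>)
  obtain E \<mu> where E: "orthonormal_basis_on pp std E"
    and \<mu>: "\<And>e x. e \<in> E \<Longrightarrow> x \<in> pp \<Longrightarrow> y e x = \<mu> e * std e x"
    using simultaneous_diagonalization[OF subspace_pp S.g_form S.g_pos Y.g_form] by blast
  have fin: "finite E" using onb_finite[OF S.g_bilinear E] .
  have Epp: "e \<in> pp" if "e \<in> E" for e using onbD(1)[OF E] that by blast
  have ye: "y e f = (if e = f then \<mu> e else 0)" if "e \<in> E" "f \<in> E" for e f
    using \<mu>[OF that(1) Epp[OF that(2)]] onbD(3)[OF E that] by simp
  have pos: "\<mu> e > 0" if "e \<in> E" for e
  proof -
    have "e \<noteq> 0" using onbD(3)[OF E that that] by (auto simp: S.g_simps)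
    then have "y e e > 0" using Y.g_pos Epp[OF that] by (simp add: pos_def_on_def)
    then show ?thesis using ye[OF that that] by simp
  qed
  have "gram_det y E = gram_det std E"
    using y onbD[OF E] onb_independent[OF S.g_bilinear E]
    by (auto simp: unit_volume_metrics_def same_volume_on_def)
  moreover have "gram_det y E = (\<Prod>e\<in>E. y e e)"
    by (rule gram_det_diagonal[OF fin]) (simp add: ye)
  moreover have "gram_det std E = (\<Prod>e\<in>E. std e e)"
    by (rule gram_det_diagonal[OF fin]) (simp add: onbD(3)[OF E])
  moreover have "(\<Prod>e\<in>E. y e e) = (\<Prod>e\<in>E. \<mu> e)"
    by (intro prod.cong refl) (simp add: ye)
  moreover have "(\<Prod>e\<in>E. std e e) = 1"
    by (intro prod.neutral ballI) (simp add: onbD(3)[OF E])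
  ultimately have prod1: "(\<Prod>e\<in>E. \<mu> e) = 1" by simp
  show ?thesis
  proof (rule that[of E "\<lambda>e. ln (\<mu> e)"])
    have "(\<Sum>e\<in>E. ln (\<mu> e)) = ln (\<Prod>e\<in>E. \<mu> e)"
      by (rule ln_prod[symmetric]) (auto simp: fin dest: pos)
    then show "(\<Sum>e\<in>E. ln (\<mu> e)) = 0" by (simp add: prod1)
    show "y e x = exp (ln (\<mu> e)) * std e x" if "e \<in> E" "x \<in> pp" for e x
      using \<mu>[OF that] pos[OF that(1)] by simp
  qed (rule E)
qed

text \<open>The basis rescaled by \<open>exp (- a e / 2)\<close> is orthonormal for \<open>y\<close>, so \<open>scal_formula\<close> applies.\<close>

lemma scal_diagonal:
  assumes y: "y \<in> invariant_inner_products G \<kappa> H" and E: "orthonormal_basis_on pp std E"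
    and a: "\<And>e x. e \<in> E \<Longrightarrow> x \<in> pp \<Longrightarrow> y e x = exp (a e) * std e x"
  shows "scal G \<kappa> H y = (\<Sum>e\<in>E. exp (- a e)) / 2 -
    (\<Sum>e\<in>E. \<Sum>f\<in>E. \<Sum>k\<in>E. (std (br e f) k)\<^sup>2 * exp (a k - a e - a f)) / 4"
proof -
  interpret S: invariant_metric G T A \<kappa> H std by (rule std_metric)
  interpret Y: invariant_metric G T A \<kappa> H y by unfold_locales (rule y)
  have fin: "finite E" using onb_finite[OF S.g_bilinear E] .
  have Epp: "e \<in> pp" if "e \<in> E" for e using onbD(1)[OF E] that by blast
  define s where "s e = exp (- a e / 2)" for e
  have ss: "s e * s e = exp (- a e)" for e by (simp add: s_def exp_add[symmetric])
  have spos: "s e \<noteq> 0" for e by (simp add: s_def)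
  define x where "x e = s e *\<^sub>R e" for e
  have ye: "y e f = (if e = f then exp (a e) else 0)" if "e \<in> E" "f \<in> E" for e f
    using a[OF that(1) Epp[OF that(2)]] onbD(3)[OF E that] by simp
  have yx: "y (x e) (x f) = (if e = f then 1 else 0)" if "e \<in> E" "f \<in> E" for e f
  proof (cases "e = f")
    case True
    have "y (x e) (x e) = (s e * s e) * y e e" by (simp add: x_def Y.g_simps)
    also have "\<dots> = 1" using ye[OF that(1) that(1)] by (simp add: ss exp_add[symmetric])
    finally show ?thesis using True by simp
  next
    case False
    then show ?thesis using ye[OF that] by (simp add: x_def Y.g_simps)
  qed
  have inj: "inj_on x E"
    by (rule inj_onI) (metis yx zero_neq_one)
  have X: "orthonormal_basis_on pp y (x ` E)"
    unfolding orthonormal_basis_on_def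
  proof (intro conjI ballI)
    show sub: "x ` E \<subseteq> pp" using Epp subspace_scale[OF subspace_pp] by (auto simp: x_def)
    have "e \<in> span (x ` E)" if "e \<in> E" for e
    proof -
      have "(1 / s e) *\<^sub>R x e \<in> span (x ` E)" using that by (intro span_scale span_base) auto
      then show ?thesis using spos by (simp add: x_def)
    qed
    then have "span E \<subseteq> span (x ` E)" by (intro span_minimal subspace_span) auto
    moreover have "span (x ` E) \<subseteq> pp" using sub by (rule span_minimal) (rule subspace_pp)
    ultimately show "span (x ` E) = pp" using onbD(2)[OF E] by simp
    fix u v assume "u \<in> x ` E" "v \<in> x ` E"
    then obtain e f where "e \<in> E" "f \<in> E" "u = x e" "v = x f" by blast
    then show "y u v = (if u = v then 1 else 0)" using yx inj by (auto simp: inj_on_def)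
  qed
  have yy: "y z z = (\<Sum>k\<in>E. exp (a k) * (std z k)\<^sup>2)" for z
  proof -
    have "y z z = y (pr z) (pr z)" by simp
    also have "\<dots> = y (\<Sum>k\<in>E. std (pr z) k *\<^sub>R k) (pr z)"
      using onb_expansion[OF S.g_bilinear E pr_mem(1)[of z]] by (rule arg_cong)
    also have "\<dots> = (\<Sum>k\<in>E. std z k * y k (pr z))"
      by (simp add: bilinear_sum_left[OF Y.g_bilinear] Y.g_simps)
    also have "\<dots> = (\<Sum>k\<in>E. exp (a k) * (std z k)\<^sup>2)"
    proof (rule sum.cong[OF refl])
      fix k assume "k \<in> E"
      from a[OF this pr_mem(1)[of z]] show "std z k * y k (pr z) = exp (a k) * (std z k)\<^sup>2"
        using S.g_commute[of k z] by (simp add: power2_eq_square)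
    qed
    finally show ?thesis .
  qed
  have "(\<Sum>v\<in>x ` E. B v v) = (\<Sum>e\<in>E. exp (- a e))"
  proof -
    have "B (x e) (x e) = exp (- a e)" if "e \<in> E" for e
    proof -
      have "B e e = 1" using onbD(3)[OF E that that] Epp[OF that] by (simp add: std_pp)
      then have "B (x e) (x e) = s e * s e" by (simp add: x_def bilinear_simps[OF B_bilinear])
      then show ?thesis by (simp add: ss)
    qed
    then show ?thesis by (simp add: sum.reindex[OF inj])
  qed
  moreover have "(\<Sum>u\<in>x ` E. \<Sum>v\<in>x ` E. y (br u v) (br u v)) =
      (\<Sum>e\<in>E. \<Sum>f\<in>E. \<Sum>k\<in>E. (std (br e f) k)\<^sup>2 * exp (a k - a e - a f))"
  proof -
    have "y (br (x e) (x f)) (br (x e) (x f)) =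
        (\<Sum>k\<in>E. (std (br e f) k)\<^sup>2 * exp (a k - a e - a f))" for e f
    proof -
      have "y (br (x e) (x f)) (br (x e) (x f)) = (s e * s e) * (s f * s f) * y (br e f) (br e f)"
        by (simp add: x_def br_simps Y.g_simps)
      also have "\<dots> = (\<Sum>k\<in>E. exp (- a e) * exp (- a f) * (exp (a k) * (std (br e f) k)\<^sup>2))"
        by (simp add: ss yy sum_distrib_left)
      also have "\<dots> = (\<Sum>k\<in>E. (std (br e f) k)\<^sup>2 * exp (a k - a e - a f))"
        by (simp add: exp_diff exp_minus exp_add field_simps)
      finally show ?thesis .
    qed
    then show ?thesis by (simp add: sum.reindex[OF inj])
  qed
  ultimately show ?thesis by (simp add: Y.scal_formula[OF X])
qed

text \<open>In the topology of pointwise convergence, finitely many entries of \<open>y\<close> in a basis control its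
  quadratic form on the unit sphere of \<open>pp\<close>.\<close>

lemma eventually_close:
  assumes \<epsilon>: "\<epsilon> > 0"
  shows "\<forall>\<^sub>F y in nhds std. y \<in> invariant_inner_products G \<kappa> H \<longrightarrow>
    (\<forall>e\<in>pp. std e e = 1 \<longrightarrow> \<bar>y e e - 1\<bar> < \<epsilon>)"
proof -
  interpret S: invariant_metric G T A \<kappa> H std by (rule std_metric)
  let ?F = "S.onb"
  have fin: "finite ?F" using onb_finite[OF S.g_bilinear S.onb] .
  define \<epsilon>' where "\<epsilon>' = \<epsilon> / (1 + real (card ?F) * real (card ?F))"
  have \<epsilon>': "\<epsilon>' > 0" "real (card ?F) * real (card ?F) * \<epsilon>' < \<epsilon>"
    using \<epsilon> by (auto simp: \<epsilon>'_def field_simps add_pos_nonneg)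
  have "\<forall>\<^sub>F y in nhds std. \<bar>y f k - std f k\<bar> < \<epsilon>'" for f k
  proof -
    have "continuous_on UNIV (\<lambda>y::'a \<Rightarrow> 'a \<Rightarrow> real. y f k)"
      using continuous_on_compose[OF continuous_on_product_coordinates[of f]
          continuous_on_subset[OF continuous_on_product_coordinates[of k]]] by (simp add: o_def)
    then have "open ((\<lambda>y. y f k) -` {std f k - \<epsilon>'<..<std f k + \<epsilon>'})"
      by (intro open_vimage) auto
    moreover have "std \<in> (\<lambda>y. y f k) -` {std f k - \<epsilon>'<..<std f k + \<epsilon>'}" using \<epsilon>'(1) by simp
    ultimately have "\<forall>\<^sub>F y in nhds std. y \<in> (\<lambda>y. y f k) -` {std f k - \<epsilon>'<..<std f k + \<epsilon>'}"
      by (rule eventually_nhds_in_open)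
    then show ?thesis by eventually_elim auto
  qed
  then have "\<forall>\<^sub>F y in nhds std. \<forall>f\<in>?F. \<forall>k\<in>?F. \<bar>y f k - std f k\<bar> < \<epsilon>'"
    using fin by (intro eventually_ball_finite ballI) auto
  then show ?thesis
  proof eventually_elim
    fix y assume close: "\<forall>f\<in>?F. \<forall>k\<in>?F. \<bar>y f k - std f k\<bar> < \<epsilon>'"
    show "y \<in> invariant_inner_products G \<kappa> H \<longrightarrow> (\<forall>e\<in>pp. std e e = 1 \<longrightarrow> \<bar>y e e - 1\<bar> < \<epsilon>)"
    proof (intro impI ballI)
      fix e assume y: "y \<in> invariant_inner_products G \<kappa> H" and e: "e \<in> pp" "std e e = 1"
      interpret Y: invariant_metric G T A \<kappa> H y by unfold_locales (rule y)
      define d where "d u v = y u v - std u v" for u v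
      have d: "bilinear d" unfolding d_def
        by (auto simp: bilinear_def linear_iff Y.g_simps S.g_simps algebra_simps)
      have c1: "\<bar>std e f\<bar> \<le> 1" if f: "f \<in> ?F" for f
      proof -
        have "std e f * std f e \<le> (\<Sum>f\<in>?F. std e f * std f e)"
          using f fin S.g_commute by (intro member_le_sum) auto
        also have "\<dots> = 1" using onb_parseval[OF S.g_bilinear S.onb e(1), of e] e(2) by simp
        finally have "(std e f)\<^sup>2 \<le> 1" using S.g_commute[of f e] by (simp add: power2_eq_square)
        then show ?thesis by (simp add: abs_square_le_1)
      qed
      have ex: "e = (\<Sum>f\<in>?F. std e f *\<^sub>R f)" by (rule onb_expansion[OF S.g_bilinear S.onb e(1)])
      have "d e e = d (\<Sum>f\<in>?F. std e f *\<^sub>R f) (\<Sum>f\<in>?F. std e f *\<^sub>R f)"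
        by (rule arg_cong2[where f = d, OF ex ex])
      also have "\<dots> = (\<Sum>f\<in>?F. std e f * d f (\<Sum>k\<in>?F. std e k *\<^sub>R k))"
        by (simp only: bilinear_sum_left[OF d] bilinear_lmul[OF d] real_scaleR_def)
      also have "\<dots> = (\<Sum>f\<in>?F. \<Sum>k\<in>?F. std e f * (std e k * d f k))"
        by (simp only: bilinear_sum_right[OF d] bilinear_rmul[OF d] real_scaleR_def sum_distrib_left)
      also have "\<bar>\<dots>\<bar> \<le> (\<Sum>f\<in>?F. \<Sum>k\<in>?F. 1 * (1 * \<epsilon>'))"
      proof (intro order_trans[OF sum_abs] sum_mono)
        fix f k assume fk: "f \<in> ?F" "k \<in> ?F"
        have "\<bar>d f k\<bar> \<le> \<epsilon>'" using close fk by (simp add: d_def less_imp_le)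
        then show "\<bar>std e f * (std e k * d f k)\<bar> \<le> 1 * (1 * \<epsilon>')"
          unfolding abs_mult using c1 fk by (intro mult_mono) auto
      qed
      also have "\<dots> = real (card ?F) * real (card ?F) * \<epsilon>'" by simp
      finally show "\<bar>y e e - 1\<bar> < \<epsilon>" using \<epsilon>'(2) e(2) by (simp add: d_def)
    qed
  qed
qed

text \<open>The strict inequality \<open>5 L < 2\<close> leaves room for the \<open>\<eta>\<close> in \<open>weighted_exponential_inequality\<close>, and
  metrics close to \<open>std\<close> have eigenvalues whose logarithms are small enough for the quadratic bounds.\<close>

theorem einstein_local_min:
  assumes r: "einstein_constant G \<kappa> H std r" and L: "2 - 4 * r < 2 / 5"
  shows "local_min_on (unit_volume_metrics G \<kappa> H) (scal G \<kappa> H) std"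
proof -
  interpret S: invariant_metric G T A \<kappa> H std by (rule std_metric)
  define L where "L = 2 - 4 * r"
  obtain \<eta> :: real where \<eta>: "\<eta> > 0" "5 * L * (1 + \<eta>) \<le> 2 * (1 - \<eta>)"
  proof (cases "L \<le> 0")
    case True
    then have "5 * L * (1 + 1 / 2) \<le> 2 * (1 - 1 / 2)" by simp
    then show ?thesis using that[of "1 / 2"] by simp
  next
    case False
    (* the solution of 5 L (1 + \<eta>) = 2 (1 - \<eta>) *)
    define \<eta> where "\<eta> = (2 - 5 * L) / (2 + 5 * L)"
    have "2 + 5 * L > 0" using False by simp
    moreover have "2 - 5 * L > 0" using assms(2) by (simp add: L_def)
    ultimately have "\<eta> > 0" "5 * L * (1 + \<eta>) \<le> 2 * (1 - \<eta>)"
      by (auto simp: \<eta>_def field_simps)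
    then show ?thesis by (rule that)
  qed
  obtain \<delta> where \<delta>: "\<delta> > 0"
    "\<And>x. \<bar>x\<bar> \<le> \<delta> \<Longrightarrow> 1 + x + (1 - \<eta>) / 2 * x\<^sup>2 \<le> exp x"
    "\<And>x. \<bar>x\<bar> \<le> \<delta> \<Longrightarrow> exp x \<le> 1 + x + (1 + \<eta>) / 2 * x\<^sup>2"
    using exp_quadratic_bounds[OF \<eta>(1)] by blast
  have "isCont (ln :: real \<Rightarrow> real) 1" by (intro isCont_ln) simp
  moreover have "\<delta> / 3 > 0" using \<delta>(1) by simp
  ultimately obtain \<epsilon> where "\<epsilon> > 0" "\<And>m::real. dist m 1 < \<epsilon> \<Longrightarrow> dist (ln m) (ln 1) < \<delta> / 3"
    unfolding continuous_at_eps_delta by blast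
  then have \<epsilon>: "\<epsilon> > 0" "\<And>m::real. \<bar>m - 1\<bar> < \<epsilon> \<Longrightarrow> \<bar>ln m\<bar> < \<delta> / 3"
    by (simp_all add: dist_real_def)
  have "\<forall>\<^sub>F y in nhds std. y \<in> unit_volume_metrics G \<kappa> H \<longrightarrow> scal G \<kappa> H std \<le> scal G \<kappa> H y"
    using eventually_close[OF \<epsilon>(1)]
  proof eventually_elim
    fix y assume close: "y \<in> invariant_inner_products G \<kappa> H \<longrightarrow>
      (\<forall>e\<in>pp. std e e = 1 \<longrightarrow> \<bar>y e e - 1\<bar> < \<epsilon>)"
    show "y \<in> unit_volume_metrics G \<kappa> H \<longrightarrow> scal G \<kappa> H std \<le> scal G \<kappa> H y"
    proof
      assume y: "y \<in> unit_volume_metrics G \<kappa> H"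
      then have yi: "y \<in> invariant_inner_products G \<kappa> H" by (simp add: unit_volume_metrics_def)
      obtain E a where E: "orthonormal_basis_on pp std E" and a0: "(\<Sum>e\<in>E. a e) = 0"
        and a: "\<And>e x. e \<in> E \<Longrightarrow> x \<in> pp \<Longrightarrow> y e x = exp (a e) * std e x"
        using diagonal_unit_volume[OF y] by blast
      have Epp: "e \<in> pp" if "e \<in> E" for e using onbD(1)[OF E] that by blast
      have small: "\<bar>a e\<bar> < \<delta> / 3" if e: "e \<in> E" for e
      proof -
        have 1: "std e e = 1" using onbD(3)[OF E e e] by simp
        then have "\<bar>exp (a e) - 1\<bar> < \<epsilon>" using close yi a[OF e Epp[OF e]] Epp[OF e] by auto
        from \<epsilon>(2)[OF this] show ?thesis by simp
      qed
      define w where "w e f k = (std (br e f) k)\<^sup>2" for e f k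
      have "real (card E) / 2 - (\<Sum>e\<in>E. \<Sum>f\<in>E. \<Sum>k\<in>E. w e f k) / 4 \<le>
        (\<Sum>e\<in>E. exp (- a e)) / 2 - (\<Sum>e\<in>E. \<Sum>f\<in>E. \<Sum>k\<in>E. w e f k * exp (a k - a e - a f)) / 4"
      proof (rule weighted_exponential_inequality[where L = L and \<eta> = \<eta>])
        fix e f k assume e: "e \<in> E" and f: "f \<in> E" and k: "k \<in> E"
        show "0 \<le> w e f k" by (simp add: w_def)
        show "w f e k = w e f k" using br_skew[of f e] by (simp add: w_def S.g_simps)
        have "std (br e k) f = - std (br e f) k"
          using B_ad[of e k f] B_commute[of k] Epp[OF f] Epp[OF k] by (simp add: std_pp)
        then show "w e k f = w e f k" by (simp add: w_def)
        have "\<bar>a k - a e - a f\<bar> \<le> \<delta>" using small[OF e] small[OF f] small[OF k] by linarith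
        then show "exp (a k - a e - a f) \<le> 1 + (a k - a e - a f) + (1 + \<eta>) / 2 * (a k - a e - a f)\<^sup>2"
          by (rule \<delta>(3))
      next
        fix e assume e: "e \<in> E"
        have "\<bar>- a e\<bar> \<le> \<delta>" using small[OF e] \<delta>(1) by linarith
        then show "1 + - a e + (1 - \<eta>) / 2 * (- a e)\<^sup>2 \<le> exp (- a e)" by (rule \<delta>(2))
        have "(\<Sum>k\<in>E. w e f k) = std (br e f) (br e f)" for f
        proof -
          have "std (pr (br e f)) (br e f) = (\<Sum>k\<in>E. std (pr (br e f)) k * std k (br e f))"
            by (rule onb_parseval[OF S.g_bilinear E pr_mem(1)])
          also have "\<dots> = (\<Sum>k\<in>E. w e f k)"
            by (intro sum.cong refl) (simp add: w_def power2_eq_square S.g_commute[of _ "br e f"])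
          finally show ?thesis by simp
        qed
        then show "(\<Sum>f\<in>E. \<Sum>k\<in>E. w e f k) = L"
          using einstein_structure_constants[OF r Epp[OF e] E] onbD(3)[OF E e e] by (simp add: L_def)
      qed (use \<eta> a0 in auto)
      moreover have "scal G \<kappa> H std = real (card E) / 2 - (\<Sum>e\<in>E. \<Sum>f\<in>E. \<Sum>k\<in>E. w e f k) / 4"
        using scal_diagonal[OF std_invariant E, of "\<lambda>e. 0"] by (simp add: w_def)
      ultimately show "scal G \<kappa> H std \<le> scal G \<kappa> H y"
        using scal_diagonal[OF yi E a] by (simp add: w_def)
    qed
  qed
  then have "\<forall>\<^sub>F y in at std within unit_volume_metrics G \<kappa> H. scal G \<kappa> H std \<le> scal G \<kappa> H y"
    unfolding eventually_at_filter by eventually_elim simp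
  then show ?thesis using std_unit_volume by (simp add: local_min_on_def)
qed

end

theorem theorem2:
  fixes G :: "('g, 'm) monoid_scheme"
    and T :: "'g topology"
    and A :: "('g, 'a::euclidean_space) chart set"
    and \<kappa> :: "('g, 'a) chart"
    and H :: "'g set"
    and r c :: real
  assumes "lie_group G T A"
    and "compact_space T" and "connected_space T"
    and "\<kappa> \<in> A" and "\<one>\<^bsub>G\<^esub> \<in> fst \<kappa>"
    and "semisimple G \<kappa>"
    and "subgroup H G" and "compactin T H"
    and "almost_effective G \<kappa> H"
    and "einstein_constant G \<kappa> H (standard_metric G \<kappa> H) r"
    and "c = (4 * r - 1) / 2"
    and "c > 3 / 10"
  shows "local_min_on (unit_volume_metrics G \<kappa> H) (scal G \<kappa> H) (standard_metric G \<kappa> H)"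
proof -
  interpret lie_group G T A by (rule assms(1))
  interpret compact_homogeneous G T A \<kappa> H
    by (intro compact_homogeneous.intro lie_chart.intro lie_chart_axioms.intro
        compact_homogeneous_axioms.intro assms)
  show ?thesis
    by (rule einstein_local_min[OF assms(10)]) (use assms(11,12) in simp)
qed


end
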